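(* Let $K$ be a discrete group acting on itself by conjugation, and form $K\rtimes K$. The homomorphism in cohomology $\tau^*:H^*(K,\mathbb Z)\to H^*(K\rtimes K,\mathbb Z)$ defined by the cochain map $$\tau^\vee:C^n(K,\mathbb Z)\to\bigoplus_{p+q=n}C^{p,q}(K\rtimes K,\mathbb Z),\qquad (\tau^\vee F)[s_1|\dots|s_n]=\bigoplus_{p+q=n}F\big(\tau[s_1|\dots|s_p||s_{p+1}|\dots|s_{p+q}]\big),$$ is equal to $\mu^*:H^*(K,\mathbb Z)\to H^*(K\rtimes K,\mathbb Z)$, the pullback of the group homomorphism $\mu:K\rtimes K\to K$, $(k,g)\mapsto kg$.
   Context: Here $K\rtimes K$ is the set $K\times K$ with $(a,g)(b,h)=(a\,gbg^{-1},gh)$; the second factor is called $G$ ($=K$), acting on the first by $g(k)=gkg^{-1}$. $C^n(K,\mathbb Z)$ is the normalized bar cochain group: maps $F:K^n\to\mathbb Z$ vanishing if some entry is $1$, extended linearly to formal sums of symbols $[h_1|\dots|h_n]$, with $$(\delta_KF)[h_1|\dots|h_{n+1}]=F[h_2|\dots|h_{n+1}]+\sum_{i=1}^n(-1)^iF[h_1|\dots|h_ih_{i+1}|\dots|h_{n+1}]+(-1)^{n+1}F[h_1|\dots|h_n].$$ $C^{p,q}(K\rtimes K,\mathbb Z)$ is the group of maps $F:G^p\times K^q\to\mathbb Z$, values $F[g_1|\dots|g_p||k_1|\dots|k_q]$, vanishing if some $g_i$ or $k_j$ is $1$ ($C^{0,0}=\mathbb Z$), with $(\delta_GF)[g_1|\dots|g_{p+1}||k_1|\dots|k_q]=F[g_2|\dots|g_{p+1}||k_1|\dots|k_q]+\sum_{i=1}^p(-1)^iF[\dots|g_ig_{i+1}|\dots||k_1|\dots|k_q]+(-1)^{p+1}F[g_1|\dots|g_p||g_{p+1}(k_1)|\dots|g_{p+1}(k_q)]$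 and $\delta_K$ the bar differential in the $k$-variables with $g_1,\dots,g_p$ fixed, that is, $(\delta_KF)[g_1|\dots|g_p||k_1|\dots|k_{q+1}]=F[g_1|\dots|g_p||k_2|\dots|k_{q+1}]+\sum_{j=1}^q(-1)^jF[g_1|\dots|g_p||k_1|\dots|k_jk_{j+1}|\dots|k_{q+1}]+(-1)^{q+1}F[g_1|\dots|g_p||k_1|\dots|k_q]$. The total complex $\mathrm{Tot}^n=\bigoplus_{p+q=n}C^{p,q}$ with differential $\delta_G\oplus(-1)^p\delta_K$ computes $H^*(K\rtimes K,\mathbb Z)$, via the free resolution $\mathrm{Tot}_*(C_*(EG,\mathbb Z)\otimes C_*(EK,\mathbb Z))$ of $\mathbb Z$ over $\mathbb Z(K\rtimes G)$: here $C_n(EH,\mathbb Z)=\mathbb Z H^{\otimes n+1}$ with $\partial_H(h_1,\dots,h_{n+1})=(h_2,\dots,h_{n+1})+\sum_{i=1}^n(-1)^i(h_1,\dots,h_ih_{i+1},\dots,h_{n+1})$, the total differential is $\partial_G\otimes1\oplus(-1)^p1\otimes\partial_K$, the action is $(k,g)\cdot(g_1,\dots,g_{p+1}||k_1,\dots,k_{q+1})=(g_1,\dots,g_{p+1}g^{-1}||g(k_1),\dots,g(k_q),g(k_{q+1})k^{-1})$, and the module basis is $[g_1|\dots|g_p||k_1|\dots|k_q]=(g_1,\dots,g_p,1||k_1,\dots,k_q,1)$. **Shuffle.** A $(p,q)$-shuffle is $\lambda\in\mathfrak S_{p+q}$ with $\lambda(i)<\lambda(j)$ whenever $1\le i<j\le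 p$ or $p+1\le i<j\le p+q$. Define $\lambda[g_1|\dots|g_p|k_1|\dots|k_q]=[s_1|\dots|s_{p+q}]$ with $s_{\lambda(i)}=g_i$ for $i\le p$ and $s_{\lambda(i)}=u\,k_{i-p}\,u^{-1}$, $u=g_{p+\lambda(i)-i+1}\cdots g_{p-1}g_p$ (empty product $=1$), for $i>p$. Then $$\tau[g_1|\dots|g_p||k_1|\dots|k_q]=\sum_{\lambda\in\mathrm{Shuff}(p,q)}(-1)^{|\lambda|}\lambda[g_1|\dots|g_p|k_1|\dots|k_q],$$ where $(-1)^{|\lambda|}$ is the sign of the permutation $\lambda$. *)

theory Defs
  imports "HOL-Algebra.Free_Abelian_Groups" "HOL-Combinatorics.Permutations"
begin

section \<open>The group \<open>K \<rtimes> K\<close>\<close>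

definition conj_by :: "('a, 'b) monoid_scheme \<Rightarrow> 'a \<Rightarrow> 'a \<Rightarrow> 'a" where
  "conj_by K g k = g \<otimes>\<^bsub>K\<^esub> k \<otimes>\<^bsub>K\<^esub> inv\<^bsub>K\<^esub> g"

definition conj_semidirect :: "('a, 'b) monoid_scheme \<Rightarrow> ('a \<times> 'a) monoid" where
  "conj_semidirect K =
     \<lparr>carrier = carrier K \<times> carrier K,
      monoid.mult = (\<lambda>(a, g) (b, h). (a \<otimes>\<^bsub>K\<^esub> conj_by K g b, g \<otimes>\<^bsub>K\<^esub> h)),
      one = (\<one>\<^bsub>K\<^esub>, \<one>\<^bsub>K\<^esub>)\<rparr>"

definition mu :: "('a, 'b) monoid_scheme \<Rightarrow> 'a \<times> 'a \<Rightarrow> 'a" where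
  "mu K = (\<lambda>(k, g). k \<otimes>\<^bsub>K\<^esub> g)"


section \<open>Cochain complexes of integer-valued functions and their cohomology\<close>

text \<open>A cochain complex is given by sets \<open>C n\<close> of integer-valued functions, closed under
  pointwise addition, and differentials \<open>d n\<close> from \<open>C n\<close> to \<open>C (n + 1)\<close>.\<close>

definition int_fun_group :: "('x \<Rightarrow> int) set \<Rightarrow> ('x \<Rightarrow> int) monoid" where
  "int_fun_group S = \<lparr>carrier = S, monoid.mult = (\<lambda>F F' x. F x + F' x), one = (\<lambda>_. 0)\<rparr>"

definition cocycles ::
  "(nat \<Rightarrow> ('x \<Rightarrow> int) set) \<Rightarrow> (nat \<Rightarrow> ('x \<Rightarrow> int) \<Rightarrow> 'x \<Rightarrow> int) \<Rightarrow> nat \<Rightarrow> ('x \<Rightarrow> int) set" where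
  "cocycles C d n = {F \<in> C n. d n F = (\<lambda>_. 0)}"

definition coboundaries ::
  "(nat \<Rightarrow> ('x \<Rightarrow> int) set) \<Rightarrow> (nat \<Rightarrow> ('x \<Rightarrow> int) \<Rightarrow> 'x \<Rightarrow> int) \<Rightarrow> nat \<Rightarrow> ('x \<Rightarrow> int) set" where
  "coboundaries C d n = (case n of 0 \<Rightarrow> {\<lambda>_. 0} | Suc m \<Rightarrow> d m ` C m)"

definition cohomology ::
  "(nat \<Rightarrow> ('x \<Rightarrow> int) set) \<Rightarrow> (nat \<Rightarrow> ('x \<Rightarrow> int) \<Rightarrow> 'x \<Rightarrow> int) \<Rightarrow> nat \<Rightarrow> ('x \<Rightarrow> int) set monoid" where
  "cohomology C d n = int_fun_group (cocycles C d n) Mod coboundaries C d n"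

text \<open>The map \<open>[F] \<mapsto> [f F]\<close> into the cohomology of \<open>(C, d)\<close>; cohomology classes are cosets.\<close>

definition cohomology_map ::
  "(nat \<Rightarrow> ('y \<Rightarrow> int) set) \<Rightarrow> (nat \<Rightarrow> ('y \<Rightarrow> int) \<Rightarrow> 'y \<Rightarrow> int) \<Rightarrow> nat \<Rightarrow>
   (('x \<Rightarrow> int) \<Rightarrow> 'y \<Rightarrow> int) \<Rightarrow> ('x \<Rightarrow> int) set \<Rightarrow> ('y \<Rightarrow> int) set" where
  "cohomology_map C d n f X = coboundaries C d n <#>\<^bsub>int_fun_group UNIV\<^esub> (f ` X)"


section \<open>Bar cochains of a group\<close>

definition tuples :: "('a, 'b) monoid_scheme \<Rightarrow> nat \<Rightarrow> 'a list set" where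
  "tuples H n = {hs. length hs = n \<and> set hs \<subseteq> carrier H}"

text \<open>\<open>merge H i [h\<^sub>1, \<dots>, h\<^sub>m] = [h\<^sub>1, \<dots>, h\<^sub>i h\<^sub>i\<^sub>+\<^sub>1, \<dots>, h\<^sub>m]\<close> for \<open>1 \<le> i < m\<close>.\<close>

definition merge :: "('a, 'b) monoid_scheme \<Rightarrow> nat \<Rightarrow> 'a list \<Rightarrow> 'a list" where
  "merge H i hs = take (i - 1) hs @ (hs ! (i - 1) \<otimes>\<^bsub>H\<^esub> hs ! i) # drop (i + 1) hs"

text \<open>Cochains are extended by zero to lists that are not argument tuples.\<close>

definition bar_cochains :: "('a, 'b) monoid_scheme \<Rightarrow> nat \<Rightarrow> ('a list \<Rightarrow> int) set" where
  "bar_cochains H n =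
     {F. (\<forall>hs. hs \<notin> tuples H n \<longrightarrow> F hs = 0) \<and> (\<forall>hs. \<one>\<^bsub>H\<^esub> \<in> set hs \<longrightarrow> F hs = 0)}"

definition bar_delta ::
  "('a, 'b) monoid_scheme \<Rightarrow> nat \<Rightarrow> ('a list \<Rightarrow> int) \<Rightarrow> 'a list \<Rightarrow> int" where
  "bar_delta H n F hs =
     (if hs \<in> tuples H (n + 1)
      then F (tl hs) + (\<Sum>i = 1..n. (- 1) ^ i * F (merge H i hs)) + (- 1) ^ (n + 1) * F (butlast hs)
      else 0)"

abbreviation bar_cohomology :: "('a, 'b) monoid_scheme \<Rightarrow> nat \<Rightarrow> ('a list \<Rightarrow> int) set monoid" where
  "bar_cohomology H \<equiv> cohomology (bar_cochains H) (bar_delta H)"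

definition pullback ::
  "('a, 'b) monoid_scheme \<Rightarrow> ('a \<Rightarrow> 'c) \<Rightarrow> nat \<Rightarrow> ('c list \<Rightarrow> int) \<Rightarrow> 'a list \<Rightarrow> int" where
  "pullback H f n F hs = (if hs \<in> tuples H n then F (map f hs) else 0)"

definition mu_star ::
  "('a, 'b) monoid_scheme \<Rightarrow> nat \<Rightarrow> ('a list \<Rightarrow> int) set \<Rightarrow> (('a \<times> 'a) list \<Rightarrow> int) set" where
  "mu_star K n =
     cohomology_map (bar_cochains (conj_semidirect K)) (bar_delta (conj_semidirect K)) n
       (pullback (conj_semidirect K) (mu K) n)"


section \<open>The total complex \<open>Tot\<close> of \<open>C\<^sup>p\<^sup>,\<^sup>q(K \<rtimes> K)\<close>\<close>

text \<open>An element of \<open>Tot\<^sup>n\<close> is a single function on pairs \<open>(gs, ks)\<close>; its component in \<open>C\<^sup>p\<^sup>,\<^sup>q\<close>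
  is its restriction to pairs with \<open>length gs = p\<close> and \<open>length ks = q\<close>.\<close>

definition bituples :: "('a, 'b) monoid_scheme \<Rightarrow> nat \<Rightarrow> ('a list \<times> 'a list) set" where
  "bituples K n = (\<Union>p\<le>n. tuples K p \<times> tuples K (n - p))"

definition full_tot_cochains ::
  "('a, 'b) monoid_scheme \<Rightarrow> nat \<Rightarrow> ('a list \<times> 'a list \<Rightarrow> int) set" where
  "full_tot_cochains K n = {F. \<forall>x. x \<notin> bituples K n \<longrightarrow> F x = 0}"

definition tot_cochains ::
  "('a, 'b) monoid_scheme \<Rightarrow> nat \<Rightarrow> ('a list \<times> 'a list \<Rightarrow> int) set" where
  "tot_cochains K n =
     {F \<in> full_tot_cochains K n. \<forall>gs ks. \<one>\<^bsub>K\<^esub> \<in> set gs \<union> set ks \<longrightarrow> F (gs, ks) = 0}"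

definition delta_G ::
  "('a, 'b) monoid_scheme \<Rightarrow> nat \<Rightarrow> nat \<Rightarrow> ('a list \<times> 'a list \<Rightarrow> int) \<Rightarrow> 'a list \<times> 'a list \<Rightarrow> int" where
  "delta_G K p q F = (\<lambda>(gs, ks).
     if gs \<in> tuples K (p + 1) \<and> ks \<in> tuples K q
     then F (tl gs, ks) + (\<Sum>i = 1..p. (- 1) ^ i * F (merge K i gs, ks))
          + (- 1) ^ (p + 1) * F (butlast gs, map (conj_by K (last gs)) ks)
     else 0)"

definition delta_K ::
  "('a, 'b) monoid_scheme \<Rightarrow> nat \<Rightarrow> nat \<Rightarrow> ('a list \<times> 'a list \<Rightarrow> int) \<Rightarrow> 'a list \<times> 'a list \<Rightarrow> int" where
  "delta_K K p q F = (\<lambda>(gs, ks).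
     if gs \<in> tuples K p then bar_delta K q (\<lambda>ks'. F (gs, ks')) ks else 0)"

definition tot_delta ::
  "('a, 'b) monoid_scheme \<Rightarrow> nat \<Rightarrow> ('a list \<times> 'a list \<Rightarrow> int) \<Rightarrow> 'a list \<times> 'a list \<Rightarrow> int" where
  "tot_delta K n F x = (\<Sum>p\<le>n. delta_G K p (n - p) F x + (- 1) ^ p * delta_K K p (n - p) F x)"

abbreviation tot_cohomology ::
  "('a, 'b) monoid_scheme \<Rightarrow> nat \<Rightarrow> ('a list \<times> 'a list \<Rightarrow> int) set monoid" where
  "tot_cohomology K \<equiv> cohomology (tot_cochains K) (tot_delta K)"

abbreviation full_tot_cohomology ::
  "('a, 'b) monoid_scheme \<Rightarrow> nat \<Rightarrow> ('a list \<times> 'a list \<Rightarrow> int) set monoid" where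
  "full_tot_cohomology K \<equiv> cohomology (full_tot_cochains K) (tot_delta K)"


section \<open>The shuffle map\<close>

definition shuffle_perms :: "nat \<Rightarrow> nat \<Rightarrow> (nat \<Rightarrow> nat) set" where
  "shuffle_perms p q =
     {\<sigma>. \<sigma> permutes {1..p + q} \<and> strict_mono_on {1..p} \<sigma> \<and> strict_mono_on {p + 1..p + q} \<sigma>}"

definition list_mult :: "('a, 'b) monoid_scheme \<Rightarrow> 'a list \<Rightarrow> 'a" where
  "list_mult K xs = foldr (\<otimes>\<^bsub>K\<^esub>) xs \<one>\<^bsub>K\<^esub>"

text \<open>\<open>shuffle_letter K \<sigma> gs ks i\<close> is the entry \<open>s\<^bsub>\<sigma>(i)\<^esub>\<close>. List positions count from 0, so
  \<open>drop (p + \<sigma> i - i) gs = [g\<^bsub>p+\<sigma>(i)-i+1\<^esub>, \<dots>, g\<^sub>p]\<close>; the subtraction does not truncate since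
  \<open>p + \<sigma> i \<ge> i\<close> for a shuffle and \<open>i > p\<close>.\<close>

definition shuffle_letter ::
  "('a, 'b) monoid_scheme \<Rightarrow> (nat \<Rightarrow> nat) \<Rightarrow> 'a list \<Rightarrow> 'a list \<Rightarrow> nat \<Rightarrow> 'a" where
  "shuffle_letter K \<sigma> gs ks i =
     (let p = length gs in
      if i \<le> p then gs ! (i - 1)
      else conj_by K (list_mult K (drop (p + \<sigma> i - i) gs)) (ks ! (i - p - 1)))"

definition shuffle_word ::
  "('a, 'b) monoid_scheme \<Rightarrow> (nat \<Rightarrow> nat) \<Rightarrow> 'a list \<Rightarrow> 'a list \<Rightarrow> 'a list" where
  "shuffle_word K \<sigma> gs ks =
     map (\<lambda>j. shuffle_letter K \<sigma> gs ks (inv_into UNIV \<sigma> j)) [1..<length gs + length ks + 1]"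

definition tau :: "('a, 'b) monoid_scheme \<Rightarrow> 'a list \<times> 'a list \<Rightarrow> 'a list \<Rightarrow>\<^sub>0 int" where
  "tau K = (\<lambda>(gs, ks).
     \<Sum>\<sigma>\<in>shuffle_perms (length gs) (length ks). frag_cmul (sign \<sigma>) (frag_of (shuffle_word K \<sigma> gs ks)))"

definition lin_eval :: "('x \<Rightarrow> int) \<Rightarrow> ('x \<Rightarrow>\<^sub>0 int) \<Rightarrow> int" where
  "lin_eval F c = (\<Sum>x\<in>Poly_Mapping.keys c. Poly_Mapping.lookup c x * F x)"

definition tau_dual ::
  "('a, 'b) monoid_scheme \<Rightarrow> nat \<Rightarrow> ('a list \<Rightarrow> int) \<Rightarrow> 'a list \<times> 'a list \<Rightarrow> int" where
  "tau_dual K n F x = (if x \<in> bituples K n then lin_eval F (tau K x) else 0)"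

definition tau_star ::
  "('a, 'b) monoid_scheme \<Rightarrow> nat \<Rightarrow> ('a list \<Rightarrow> int) set \<Rightarrow> ('a list \<times> 'a list \<Rightarrow> int) set" where
  "tau_star K n = cohomology_map (tot_cochains K) (tot_delta K) n (tau_dual K n)"


section \<open>Free resolutions of \<open>\<int>\<close> over \<open>\<int>(K \<rtimes> K)\<close>\<close>

text \<open>\<open>C\<^sub>n(EH)\<close> is free abelian on \<open>tuples H (n + 1)\<close>. The boundary and the action are given on
  generators; a list of length \<open>n + 1\<close> has degree \<open>n\<close>.\<close>

definition E_chains :: "('a, 'b) monoid_scheme \<Rightarrow> nat \<Rightarrow> ('a list \<Rightarrow>\<^sub>0 int) monoid" where
  "E_chains H n = free_Abelian_group (tuples H (n + 1))"

definition E_boundary :: "('a, 'b) monoid_scheme \<Rightarrow> 'a list \<Rightarrow> 'a list \<Rightarrow>\<^sub>0 int" where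
  "E_boundary H hs =
     (let n = length hs - 1 in
      if n = 0 then 0
      else frag_of (tl hs) + (\<Sum>i = 1..n. frag_cmul ((- 1) ^ i) (frag_of (merge H i hs))))"

definition E_action :: "('a, 'b) monoid_scheme \<Rightarrow> 'a \<Rightarrow> 'a list \<Rightarrow> 'a list" where
  "E_action H h hs = butlast hs @ [last hs \<otimes>\<^bsub>H\<^esub> inv\<^bsub>H\<^esub> h]"

text \<open>\<open>Tot\<^sub>n(C\<^sub>*(EG) \<otimes> C\<^sub>*(EK))\<close>, the tensor product of two generators being their pair.\<close>

definition tensor_chains ::
  "('a, 'b) monoid_scheme \<Rightarrow> nat \<Rightarrow> ('a list \<times> 'a list \<Rightarrow>\<^sub>0 int) monoid" where
  "tensor_chains K n = free_Abelian_group (\<Union>p\<le>n. tuples K (p + 1) \<times> tuples K (n - p + 1))"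

definition tensor_boundary ::
  "('a, 'b) monoid_scheme \<Rightarrow> 'a list \<times> 'a list \<Rightarrow> 'a list \<times> 'a list \<Rightarrow>\<^sub>0 int" where
  "tensor_boundary K = (\<lambda>(gs, ks).
     frag_extend (\<lambda>gs'. frag_of (gs', ks)) (E_boundary K gs)
     + frag_cmul ((- 1) ^ (length gs - 1)) (frag_extend (\<lambda>ks'. frag_of (gs, ks')) (E_boundary K ks)))"

definition tensor_action ::
  "('a, 'b) monoid_scheme \<Rightarrow> 'a \<times> 'a \<Rightarrow> 'a list \<times> 'a list \<Rightarrow> 'a list \<times> 'a list" where
  "tensor_action K = (\<lambda>(k, g) (gs, ks).
     (butlast gs @ [last gs \<otimes>\<^bsub>K\<^esub> inv\<^bsub>K\<^esub> g],
      map (conj_by K g) (butlast ks) @ [conj_by K g (last ks) \<otimes>\<^bsub>K\<^esub> inv\<^bsub>K\<^esub> k]))"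

definition augmentation :: "('x \<Rightarrow>\<^sub>0 int) \<Rightarrow> int" where
  "augmentation = lin_eval (\<lambda>_. 1)"

text \<open>A morphism of resolutions of \<open>\<int>\<close> over \<open>\<int>(K \<rtimes> K)\<close>, from \<open>Tot\<^sub>*(C\<^sub>*(EG) \<otimes> C\<^sub>*(EK))\<close> to the
  bar resolution \<open>C\<^sub>*(E(K \<rtimes> K))\<close>. It is unique up to equivariant chain homotopy.\<close>

definition resolution_morphism ::
  "('a, 'b) monoid_scheme \<Rightarrow>
   (nat \<Rightarrow> ('a list \<times> 'a list \<Rightarrow>\<^sub>0 int) \<Rightarrow> ('a \<times> 'a) list \<Rightarrow>\<^sub>0 int) \<Rightarrow> bool" where
  "resolution_morphism K \<phi> \<longleftrightarrow>
     (\<forall>n. \<phi> n \<in> hom (tensor_chains K n) (E_chains (conj_semidirect K) n)) \<and>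
     (\<forall>n. \<forall>\<gamma>\<in>carrier (conj_semidirect K). \<forall>c\<in>carrier (tensor_chains K n).
        \<phi> n (frag_extend (\<lambda>x. frag_of (tensor_action K \<gamma> x)) c) =
        frag_extend (\<lambda>y. frag_of (E_action (conj_semidirect K) \<gamma> y)) (\<phi> n c)) \<and>
     (\<forall>n. \<forall>c\<in>carrier (tensor_chains K (n + 1)).
        \<phi> n (frag_extend (tensor_boundary K) c) =
        frag_extend (E_boundary (conj_semidirect K)) (\<phi> (n + 1) c)) \<and>
     (\<forall>c\<in>carrier (tensor_chains K 0). augmentation (\<phi> 0 c) = augmentation c)"

text \<open>The cochain map \<open>\<phi>\<^sup>\<or>\<close> induced by a morphism \<open>\<phi>\<close> of resolutions. A bar cochain \<open>F\<close> corresponds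
  to the invariant functional \<open>(h\<^sub>1, \<dots>, h\<^sub>n\<^sub>+\<^sub>1) \<mapsto> F [h\<^sub>1|\<dots>|h\<^sub>n]\<close> on \<open>C\<^sub>n(E(K \<rtimes> K))\<close>, and an invariant
  functional on \<open>Tot\<^sub>n\<close> corresponds to its values on the module basis \<open>(g\<^sub>1, \<dots>, g\<^sub>p, 1||k\<^sub>1, \<dots>, k\<^sub>q, 1)\<close>.
  Since \<open>\<phi>\<close> need not respect degenerate chains, the result need not be normalized.\<close>

definition resolution_dual ::
  "('a, 'b) monoid_scheme \<Rightarrow>
   (nat \<Rightarrow> ('a list \<times> 'a list \<Rightarrow>\<^sub>0 int) \<Rightarrow> ('a \<times> 'a) list \<Rightarrow>\<^sub>0 int) \<Rightarrow>
   nat \<Rightarrow> (('a \<times> 'a) list \<Rightarrow> int) \<Rightarrow> 'a list \<times> 'a list \<Rightarrow> int" where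
  "resolution_dual K \<phi> n F = (\<lambda>(gs, ks).
     if (gs, ks) \<in> bituples K n
     then lin_eval (\<lambda>hs. F (butlast hs)) (\<phi> n (frag_of (gs @ [\<one>\<^bsub>K\<^esub>], ks @ [\<one>\<^bsub>K\<^esub>])))
     else 0)"

text \<open>The identification of \<open>H\<^sup>n(K \<rtimes> K)\<close>, computed by normalized bar cochains, with the cohomology
  of the normalized total complex: \<open>\<phi>\<^sup>\<or>\<close> followed by the inverse of the map induced by the inclusion
  of the normalized into the full total complex.\<close>

definition tot_identification ::
  "('a, 'b) monoid_scheme \<Rightarrow>
   (nat \<Rightarrow> ('a list \<times> 'a list \<Rightarrow>\<^sub>0 int) \<Rightarrow> ('a \<times> 'a) list \<Rightarrow>\<^sub>0 int) \<Rightarrow>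
   nat \<Rightarrow> (('a \<times> 'a) list \<Rightarrow> int) set \<Rightarrow> ('a list \<times> 'a list \<Rightarrow> int) set" where
  "tot_identification K \<phi> n X =
     inv_into (carrier (tot_cohomology K n))
       (cohomology_map (full_tot_cochains K) (tot_delta K) n id)
       (cohomology_map (full_tot_cochains K) (tot_delta K) n (resolution_dual K \<phi> n) X)"

end

theory Submission
  imports Defs
begin

text \<open>Three resolutions of \<open>\<int>\<close> over \<open>\<int>(K \<rtimes> K)\<close> are compared: the normalized bar resolution, the tensor product
  resolution and its normalization. Each has a basis and is exact because of a contracting homotopy, so that
  equivariant chain maps between them exist and are unique up to homotopy; hence every such map induces an
  isomorphism of cohomology, the same for all. Sending \<open>[g\<^sub>1|\<dots>|g\<^sub>p||k\<^sub>1|\<dots>|k\<^sub>q]\<close> to the signed sum of the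
  shuffles of the letters \<open>(1, g\<^sub>i)\<close> and \<open>(k\<^sub>j, 1)\<close>, corrected by \<open>(1, g)(k, 1) = (gkg\<inverse>, 1)(1, g)\<close>, is
  such a chain map. As \<open>\<mu>(1, g) = g\<close> and \<open>\<mu>(k, 1) = k\<close>, its composite with \<open>\<mu>\<close> is \<open>\<tau>\<close>. Shuffles are
  treated by recursion on the last letter, which reduces the chain map property to a Leibniz rule.\<close>

section \<open>Linear extension\<close>

text \<open>The given morphism \<open>\<phi>\<close> of resolutions is arbitrary and may send a
  degenerate generator anywhere, so it does not descend to the normalized tensor complex. The
  comparison is therefore made from the full tensor complex to the normalized bar complex: any chain
  map into the bar complex can be followed by the projection, and normalized cochains do not notice
  it. Only afterwards is the result moved to normalized total cochains, along an inclusion that is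
  dual to the projection of the tensor complex onto its normalization. Words are taken apart at the
  end because everything happens there: the group acts on the last letter, the contraction appends
  \<open>1\<close>, and the factor \<open>u\<close> of a shuffle is a product of final letters of
  \<open>gs\<close>. Moving the last \<open>g\<close> past all of \<open>ks\<close> conjugates the
  whole second word, so the recursion changes its letters. The contractions are additive but not
  equivariant. They serve to prove exactness; equivariant maps are then obtained by choosing values
  on a basis.\<close>

abbreviation keys :: "('x \<Rightarrow>\<^sub>0 int) \<Rightarrow> 'x set" where
  "keys \<equiv> Poly_Mapping.keys"

abbreviation frag_map :: "('x \<Rightarrow> 'y) \<Rightarrow> ('x \<Rightarrow>\<^sub>0 int) \<Rightarrow> 'y \<Rightarrow>\<^sub>0 int" where
  "frag_map f \<equiv> frag_extend (\<lambda>x. frag_of (f x))"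

lemma lin_eval_superset:
  assumes "finite A" "keys c \<subseteq> A"
  shows "lin_eval F c = (\<Sum>x\<in>A. Poly_Mapping.lookup c x * F x)"
  unfolding lin_eval_def using assms
  by (intro sum.mono_neutral_left) (auto simp: in_keys_iff)

lemma lin_eval_0 [simp]: "lin_eval F 0 = 0"
  by (simp add: lin_eval_def)

lemma lin_eval_of [simp]: "lin_eval F (frag_of x) = F x"
  by (simp add: lin_eval_def)

lemma lin_eval_cmul [simp]: "lin_eval F (frag_cmul k c) = k * lin_eval F c"
  by (subst lin_eval_superset[of "keys c"])
    (auto simp: lin_eval_def sum_distrib_left mult.assoc)

lemma lin_eval_add [simp]: "lin_eval F (a + b) = lin_eval F a + lin_eval F b"
proof -
  let ?A = "keys a \<union> keys b"
  have "keys (a + b) \<subseteq> ?A"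
    by (rule keys_add)
  then show ?thesis
    by (simp add: lin_eval_superset[of ?A] lookup_add sum.distrib distrib_right)
qed

lemma lin_eval_minus [simp]: "lin_eval F (- a) = - lin_eval F a"
  using lin_eval_cmul[of F "-1" a] by simp

lemma lin_eval_diff [simp]: "lin_eval F (a - b) = lin_eval F a - lin_eval F b"
  using lin_eval_add[of F a "- b"] by simp

lemma lin_eval_sum [simp]: "lin_eval F (sum f I) = (\<Sum>i\<in>I. lin_eval F (f i))"
  by (induction I rule: infinite_finite_induct) auto

lemma lin_eval_frag_extend [simp]:
  "lin_eval F (frag_extend f c) = lin_eval (\<lambda>x. lin_eval F (f x)) c"
  using subset_UNIV by (induction c rule: frag_induction) (auto simp: frag_extend_diff)

lemma lin_eval_cong:
  "(\<And>x. x \<in> keys c \<Longrightarrow> F x = F' x) \<Longrightarrow> lin_eval F c = lin_eval F' c"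
  by (simp add: lin_eval_def)

lemma lin_eval_zero_on:
  "(\<And>x. x \<in> keys c \<Longrightarrow> F x = 0) \<Longrightarrow> lin_eval F c = 0"
  by (simp add: lin_eval_def)

lemma lin_eval_fun_add: "lin_eval (\<lambda>x. F x + F' x) c = lin_eval F c + lin_eval F' c"
  by (simp add: lin_eval_def distrib_left sum.distrib)

lemma lin_eval_fun_cmul: "lin_eval (\<lambda>x. k * F x) c = k * lin_eval F c"
  by (simp add: lin_eval_def sum_distrib_left mult.left_commute)

lemma lin_eval_fun_minus: "lin_eval (\<lambda>x. - F x) c = - lin_eval F c"
  using lin_eval_fun_cmul[of "- 1" F] by simp

lemma lin_eval_fun_diff: "lin_eval (\<lambda>x. F x - F' x) c = lin_eval F c - lin_eval F' c"
  using lin_eval_fun_add[of F "\<lambda>x. - F' x"] by (simp add: lin_eval_fun_minus)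

lemma lin_eval_fun_zero [simp]: "lin_eval (\<lambda>x. 0) c = 0"
  by (simp add: lin_eval_def)

text \<open>The functionals that are \<open>1\<close> at one generator and \<open>0\<close>
  elsewhere read off the coefficients. Identities between nested linear extensions thereby become
  identities between integers, which the rules for \<open>lin_eval\<close> settle.\<close>

lemma frag_eqI:
  assumes "\<And>F. lin_eval F a = lin_eval F b"
  shows "a = b"
proof (rule poly_mapping_eqI)
  fix x
  have *: "lin_eval (\<lambda>y. if y = x then 1 else 0) c = Poly_Mapping.lookup c x" for c :: "'a \<Rightarrow>\<^sub>0 int"
    by (simp add: lin_eval_def if_distrib in_keys_iff cong: if_cong)
  show "Poly_Mapping.lookup a x = Poly_Mapping.lookup b x"
    using assms[of "\<lambda>y. if y = x then 1 else 0"] by (simp add: *)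
qed

lemma frag_extend_frag_extend:
  "frag_extend f (frag_extend g c) = frag_extend (\<lambda>x. frag_extend f (g x)) c"
  using subset_UNIV by (induction c rule: frag_induction) (auto simp: frag_extend_diff)

lemma frag_extend_fun_add:
  "frag_extend (\<lambda>x. f x + g x) c = frag_extend f c + frag_extend g c"
  by (rule frag_eqI) (simp add: lin_eval_fun_add)

lemma frag_extend_fun_cmul:
  "frag_extend (\<lambda>x. frag_cmul k (f x)) c = frag_cmul k (frag_extend f c)"
  by (rule frag_eqI) (simp add: lin_eval_fun_cmul)

lemma frag_extend_fun_diff:
  "frag_extend (\<lambda>x. f x - g x) c = frag_extend f c - frag_extend g c"
  by (rule frag_eqI) (simp add: lin_eval_fun_diff)

lemma frag_extend_sum': "frag_extend f (sum g I) = (\<Sum>i\<in>I. frag_extend f (g i))"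
  by (induction I rule: infinite_finite_induct) (simp_all add: frag_extend_add)

lemma frag_extend_frag_of [simp]: "frag_extend frag_of c = c"
  by (rule frag_expansion[symmetric])

lemma keys_frag_extend_subset:
  assumes "\<And>x. x \<in> keys c \<Longrightarrow> keys (f x) \<subseteq> S"
  shows "keys (frag_extend f c) \<subseteq> S"
  by (rule order_trans[OF keys_frag_extend]) (use assms in auto)

lemma keys_add_subset:
  "keys a \<subseteq> S \<Longrightarrow> keys b \<subseteq> S \<Longrightarrow> keys (a + b) \<subseteq> S"
  by (rule order_trans[OF keys_add]) simp

lemma keys_diff_subset:
  "keys (a :: 'x \<Rightarrow>\<^sub>0 int) \<subseteq> S \<Longrightarrow> keys b \<subseteq> S \<Longrightarrow> keys (a - b) \<subseteq> S"
  by (rule order_trans[OF keys_diff]) simp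

lemma keys_cmul_subset: "keys c \<subseteq> S \<Longrightarrow> keys (frag_cmul k c) \<subseteq> S"
  by (rule order_trans[OF keys_cmul])


section \<open>Cohomology classes\<close>

locale cochain_complex =
  fixes C :: "nat \<Rightarrow> ('x \<Rightarrow> int) set" and d :: "nat \<Rightarrow> ('x \<Rightarrow> int) \<Rightarrow> 'x \<Rightarrow> int"
  assumes zero_mem: "(\<lambda>_. 0) \<in> C n"
    and add_mem: "F \<in> C n \<Longrightarrow> F' \<in> C n \<Longrightarrow> (\<lambda>x. F x + F' x) \<in> C n"
    and minus_mem: "F \<in> C n \<Longrightarrow> (\<lambda>x. - F x) \<in> C n"
    and d_mem: "F \<in> C n \<Longrightarrow> d n F \<in> C (Suc n)"
    and d_add: "F \<in> C n \<Longrightarrow> F' \<in> C n \<Longrightarrow> d n (\<lambda>x. F x + F' x) = (\<lambda>x. d n F x + d n F' x)"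
    and d_d: "F \<in> C n \<Longrightarrow> d (Suc n) (d n F) = (\<lambda>_. 0)"
begin

lemma d_zero: "d n (\<lambda>_. 0) = (\<lambda>_. 0)"
proof
  fix x
  show "d n (\<lambda>_. 0) x = 0"
    using fun_cong[OF d_add[OF zero_mem zero_mem, of n], of x] by simp
qed

lemma d_minus:
  assumes "F \<in> C n"
  shows "d n (\<lambda>x. - F x) = (\<lambda>x. - d n F x)"
proof
  fix x
  show "d n (\<lambda>x. - F x) x = - d n F x"
    using fun_cong[OF d_add[OF assms minus_mem[OF assms]], of x] by (simp add: d_zero)
qed

lemma cocycles_mem: "F \<in> cocycles C d n \<Longrightarrow> F \<in> C n"
  by (simp add: cocycles_def)

lemma cocycles_add:
  "F \<in> cocycles C d n \<Longrightarrow> F' \<in> cocycles C d n \<Longrightarrow> (\<lambda>x. F x + F' x) \<in> cocycles C d n"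
  by (simp add: cocycles_def add_mem d_add)

lemma coboundaries_subset: "coboundaries C d n \<subseteq> cocycles C d n"
  by (cases n) (auto simp: coboundaries_def cocycles_def zero_mem d_zero d_mem d_d)

lemma coboundaries_zero: "(\<lambda>_. 0) \<in> coboundaries C d n"
  using zero_mem d_zero by (cases n) (auto simp: coboundaries_def image_iff intro: sym)

lemma coboundaries_add:
  assumes "F \<in> coboundaries C d n" "F' \<in> coboundaries C d n"
  shows "(\<lambda>x. F x + F' x) \<in> coboundaries C d n"
proof (cases n)
  case (Suc m)
  with assms obtain H H' where H: "H \<in> C m" "F = d m H" "H' \<in> C m" "F' = d m H'"
    by (auto simp: coboundaries_def)
  have "(\<lambda>x. F x + F' x) = d m (\<lambda>x. H x + H' x)"
    using H by (simp add: d_add)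
  with H Suc show ?thesis
    by (auto simp: coboundaries_def intro: add_mem)
qed (use assms in \<open>auto simp: coboundaries_def\<close>)

lemma coboundaries_minus:
  assumes "F \<in> coboundaries C d n"
  shows "(\<lambda>x. - F x) \<in> coboundaries C d n"
proof (cases n)
  case (Suc m)
  with assms obtain H where H: "H \<in> C m" "F = d m H"
    by (auto simp: coboundaries_def)
  have "(\<lambda>x. - F x) = d m (\<lambda>x. - H x)"
    using H by (simp add: d_minus)
  with H Suc show ?thesis
    by (auto simp: coboundaries_def intro: minus_mem)
qed (use assms in \<open>auto simp: coboundaries_def\<close>)

end

text \<open>The coset of \<open>F\<close>. Classes are handled through representatives; by
  \<open>carrier_cohomology\<close> these cosets of cocycles are the elements of the quotient
  group.\<close>

definition coh_class ::
  "(nat \<Rightarrow> ('x \<Rightarrow> int) set) \<Rightarrow> (nat \<Rightarrow> ('x \<Rightarrow> int) \<Rightarrow> 'x \<Rightarrow> int) \<Rightarrow> nat \<Rightarrow> ('x \<Rightarrow> int) \<Rightarrow> ('x \<Rightarrow> int) set" where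
  "coh_class C d n F = (\<lambda>B x. B x + F x) ` coboundaries C d n"

lemma carrier_cohomology: "carrier (cohomology C d n) = coh_class C d n ` cocycles C d n"
  by (auto simp: cohomology_def FactGroup_def RCOSETS_def r_coset_def int_fun_group_def coh_class_def)

lemma (in cochain_complex) coh_class_eq_iff:
  assumes "F \<in> cocycles C d n" "F' \<in> cocycles C d n"
  shows "coh_class C d n F = coh_class C d n F' \<longleftrightarrow> (\<lambda>x. F x - F' x) \<in> coboundaries C d n"
proof
  assume eq: "coh_class C d n F = coh_class C d n F'"
  have "F \<in> coh_class C d n F"
    using coboundaries_zero by (force simp: coh_class_def)
  with eq obtain B where "B \<in> coboundaries C d n" "F = (\<lambda>x. B x + F' x)"
    by (auto simp: coh_class_def)
  then show "(\<lambda>x. F x - F' x) \<in> coboundaries C d n"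
    by simp
next
  have *: "coh_class C d n F \<subseteq> coh_class C d n F'"
    if D: "(\<lambda>x. F x - F' x) \<in> coboundaries C d n" for F F'
  proof
    fix H assume "H \<in> coh_class C d n F"
    then obtain B where "B \<in> coboundaries C d n" "H = (\<lambda>x. B x + F x)"
      by (auto simp: coh_class_def)
    then show "H \<in> coh_class C d n F'"
      using coboundaries_add[OF _ D, of B]
      by (auto simp: coh_class_def intro!: image_eqI[of _ _ "\<lambda>x. B x + (F x - F' x)"])
  qed
  assume D: "(\<lambda>x. F x - F' x) \<in> coboundaries C d n"
  show "coh_class C d n F = coh_class C d n F'"
    using *[OF D] *[of F' F] coboundaries_minus[OF D] by auto
qed

lemma (in cochain_complex) mult_cohomology:
  "coh_class C d n F \<otimes>\<^bsub>cohomology C d n\<^esub> coh_class C d n F' = coh_class C d n (\<lambda>x. F x + F' x)"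
    (is "?L = ?R")
proof (rule Set.set_eqI)
  fix H
  have "H \<in> ?L \<longleftrightarrow> (\<exists>B\<in>coboundaries C d n. \<exists>B'\<in>coboundaries C d n. H = (\<lambda>x. (B x + F x) + (B' x + F' x)))"
    by (simp add: cohomology_def FactGroup_def set_mult_def int_fun_group_def coh_class_def)
  also have "\<dots> \<longleftrightarrow> (\<exists>B\<in>coboundaries C d n. H = (\<lambda>x. B x + (F x + F' x)))"
  proof
    assume "\<exists>B\<in>coboundaries C d n. \<exists>B'\<in>coboundaries C d n. H = (\<lambda>x. (B x + F x) + (B' x + F' x))"
    then obtain B B' where "B \<in> coboundaries C d n" "B' \<in> coboundaries C d n"
      "H = (\<lambda>x. (B x + F x) + (B' x + F' x))" by auto
    then show "\<exists>B\<in>coboundaries C d n. H = (\<lambda>x. B x + (F x + F' x))"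
      by (intro bexI[of _ "\<lambda>x. B x + B' x"] coboundaries_add) (auto simp: add_ac)
  next
    assume "\<exists>B\<in>coboundaries C d n. H = (\<lambda>x. B x + (F x + F' x))"
    then obtain B where "B \<in> coboundaries C d n" "H = (\<lambda>x. B x + (F x + F' x))" by auto
    then show "\<exists>B\<in>coboundaries C d n. \<exists>B'\<in>coboundaries C d n. H = (\<lambda>x. (B x + F x) + (B' x + F' x))"
      by (intro bexI[of _ B] bexI[of _ "\<lambda>_. 0"] coboundaries_zero) (auto simp: add_ac)
  qed
  also have "\<dots> \<longleftrightarrow> H \<in> ?R"
    by (auto simp: coh_class_def)
  finally show "H \<in> ?L \<longleftrightarrow> H \<in> ?R" .
qed

lemma
  assumes "\<And>n F. F \<in> C n \<Longrightarrow> d n F = d' n F"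
  shows cocycles_cong: "cocycles C d n = cocycles C d' n"
    and coboundaries_cong: "coboundaries C d n = coboundaries C d' n"
  using assms by (auto simp: cocycles_def coboundaries_def split: nat.split)

text \<open>The bar and total differentials are identified with those of the normalized based
  complexes on normalized cochains only, so equality is assumed on \<open>C n\<close> and not
  everywhere.\<close>

lemma cohomology_cong:
  assumes "\<And>n F. F \<in> C n \<Longrightarrow> d n F = d' n F"
  shows "cohomology C d n = cohomology C d' n"
  by (simp add: cohomology_def cocycles_cong[OF assms] coboundaries_cong[OF assms])

text \<open>A class is a set of cocycles, hence of elements of \<open>C n\<close>, and
  \<open>cohomology_map\<close> applies \<open>f\<close> to nothing else.\<close>

lemma (in cochain_complex) cohomology_map_cong_on:
  assumes "\<And>F. F \<in> C n \<Longrightarrow> f F = f' F" "X \<in> carrier (cohomology C d n)"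
  shows "cohomology_map C' d' n f X = cohomology_map C' d' n f' X"
proof -
  obtain F where F: "F \<in> cocycles C d n" "X = coh_class C d n F"
    using assms(2) by (auto simp: carrier_cohomology)
  have "X \<subseteq> C n"
    using F coboundaries_subset by (auto simp: coh_class_def cocycles_def intro!: add_mem)
  then have "f ` X = f' ` X"
    using assms(1) by (intro image_cong) auto
  then show ?thesis
    by (simp add: cohomology_map_def)
qed

lemma (in cochain_complex) cohomology_mult_closed:
  assumes "X \<in> carrier (cohomology C d n)" "Y \<in> carrier (cohomology C d n)"
  shows "X \<otimes>\<^bsub>cohomology C d n\<^esub> Y \<in> carrier (cohomology C d n)"
  using assms by (auto simp: carrier_cohomology mult_cohomology cocycles_add)

lemma iso_cong_on:
  assumes "f \<in> iso A B" "\<And>x. x \<in> carrier A \<Longrightarrow> f x = g x"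
    and closed: "\<And>x y. x \<in> carrier A \<Longrightarrow> y \<in> carrier A \<Longrightarrow> x \<otimes>\<^bsub>A\<^esub> y \<in> carrier A"
  shows "g \<in> iso A B"
proof (rule isoI[OF homI])
  have bij: "bij_betw f (carrier A) (carrier B)" and hom: "f \<in> hom A B"
    using assms(1) by (auto simp: iso_def)
  show "bij_betw g (carrier A) (carrier B)"
    using bij bij_betw_cong[of "carrier A" f g] assms(2) by blast
  show "g x \<in> carrier B" if "x \<in> carrier A" for x
    using hom_in_carrier[OF hom that] assms(2)[OF that] by simp
  show "g (x \<otimes>\<^bsub>A\<^esub> y) = g x \<otimes>\<^bsub>B\<^esub> g y" if "x \<in> carrier A" "y \<in> carrier A" for x y
    using hom_mult[OF hom that] assms(2)[OF that(1)] assms(2)[OF that(2)] assms(2)[OF closed[OF that]]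
    by simp
qed

text \<open>Injectivity of \<open>f\<close> is applied to a product of two preimages, and
  \<open>closed\<close> puts this product into the carrier.\<close>

lemma iso_inv_into:
  assumes f: "f \<in> iso A B"
    and closed: "\<And>x y. x \<in> carrier A \<Longrightarrow> y \<in> carrier A \<Longrightarrow> x \<otimes>\<^bsub>A\<^esub> y \<in> carrier A"
  shows "inv_into (carrier A) f \<in> iso B A"
proof (rule isoI[OF homI])
  have bij: "bij_betw f (carrier A) (carrier B)" and hom: "f \<in> hom A B"
    using f by (auto simp: iso_def)
  show bij': "bij_betw (inv_into (carrier A) f) (carrier B) (carrier A)"
    by (rule bij_betw_inv_into[OF bij])
  show mem: "inv_into (carrier A) f x \<in> carrier A" if "x \<in> carrier B" for x
    using bij_betw_apply[OF bij' that] .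
  show "inv_into (carrier A) f (x \<otimes>\<^bsub>B\<^esub> y) = inv_into (carrier A) f x \<otimes>\<^bsub>A\<^esub> inv_into (carrier A) f y"
    if "x \<in> carrier B" "y \<in> carrier B" for x y
  proof -
    have "f (inv_into (carrier A) f x \<otimes>\<^bsub>A\<^esub> inv_into (carrier A) f y) = x \<otimes>\<^bsub>B\<^esub> y"
      using that mem by (simp add: hom_mult[OF hom] bij_betw_inv_into_right[OF bij])
    then show ?thesis
      using bij_betw_inv_into_left[OF bij closed[OF mem mem]] that by metis
  qed
qed

section \<open>Cochain maps and the maps they induce in cohomology\<close>

locale cochain_map = A: cochain_complex C d + B: cochain_complex C' d'
  for C :: "nat \<Rightarrow> ('x \<Rightarrow> int) set" and d and C' :: "nat \<Rightarrow> ('y \<Rightarrow> int) set" and d' +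
  fixes f :: "nat \<Rightarrow> ('x \<Rightarrow> int) \<Rightarrow> 'y \<Rightarrow> int"
  assumes map_mem: "F \<in> C n \<Longrightarrow> f n F \<in> C' n"
    and map_add: "F \<in> C n \<Longrightarrow> F' \<in> C n \<Longrightarrow> f n (\<lambda>x. F x + F' x) = (\<lambda>y. f n F y + f n F' y)"
    and map_d: "F \<in> C n \<Longrightarrow> d' n (f n F) = f (Suc n) (d n F)"
begin

lemma map_zero: "f n (\<lambda>_. 0) = (\<lambda>_. 0)"
proof
  fix x
  show "f n (\<lambda>_. 0) x = 0"
    using fun_cong[OF map_add[OF A.zero_mem A.zero_mem, of n], of x] by simp
qed

lemma map_diff:
  assumes "F \<in> C n" "F' \<in> C n"
  shows "f n (\<lambda>x. F x - F' x) = (\<lambda>y. f n F y - f n F' y)"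
proof
  fix y
  have "(\<lambda>x. F x - F' x) \<in> C n"
    using A.add_mem[OF assms(1) A.minus_mem[OF assms(2)]] by simp
  from fun_cong[OF map_add[OF this assms(2)], of y]
  show "f n (\<lambda>x. F x - F' x) y = f n F y - f n F' y"
    by simp
qed

lemma map_cocycles: "F \<in> cocycles C d n \<Longrightarrow> f n F \<in> cocycles C' d' n"
  by (simp add: cocycles_def map_mem map_d map_zero)

lemma map_coboundaries: "F \<in> coboundaries C d n \<Longrightarrow> f n F \<in> coboundaries C' d' n"
  by (cases n) (auto simp: coboundaries_def map_zero map_d[symmetric] map_mem)

lemma map_cohomologous:
  assumes "F \<in> cocycles C d n" "F' \<in> cocycles C d n" "(\<lambda>x. F x - F' x) \<in> coboundaries C d n"
  shows "(\<lambda>y. f n F y - f n F' y) \<in> coboundaries C' d' n"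
  using map_coboundaries[OF assms(3)] assms(1,2) by (simp add: map_diff A.cocycles_mem)

text \<open>The image of a coset under \<open>f n\<close> may be smaller than a coset. Adding all
  coboundaries of the target in \<open>cohomology_map\<close> completes it, and the images of
  coboundaries are absorbed.\<close>

lemma cohomology_map_class:
  assumes "F \<in> cocycles C d n"
  shows "cohomology_map C' d' n (f n) (coh_class C d n F) = coh_class C' d' n (f n F)"
    (is "?L = ?R")
proof (rule Set.set_eqI)
  fix H
  have F: "F \<in> C n"
    using assms by (rule A.cocycles_mem)
  have add: "f n (\<lambda>x. B x + F x) = (\<lambda>x. f n B x + f n F x)" if "B \<in> coboundaries C d n" for B
    using that A.coboundaries_subset by (intro map_add F) (auto simp: cocycles_def)
  have "H \<in> ?L \<longleftrightarrow> (\<exists>B'\<in>coboundaries C' d' n. \<exists>B\<in>coboundaries C d n.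
      H = (\<lambda>x. B' x + f n (\<lambda>x. B x + F x) x))"
    by (auto simp: cohomology_map_def set_mult_def int_fun_group_def coh_class_def)
  also have "\<dots> \<longleftrightarrow> (\<exists>B'\<in>coboundaries C' d' n. H = (\<lambda>x. B' x + f n F x))"
  proof
    assume "\<exists>B'\<in>coboundaries C' d' n. \<exists>B\<in>coboundaries C d n. H = (\<lambda>x. B' x + f n (\<lambda>x. B x + F x) x)"
    then obtain B B' where "B' \<in> coboundaries C' d' n" "B \<in> coboundaries C d n"
      "H = (\<lambda>x. B' x + f n (\<lambda>x. B x + F x) x)" by auto
    then show "\<exists>B'\<in>coboundaries C' d' n. H = (\<lambda>x. B' x + f n F x)"
      by (intro bexI[of _ "\<lambda>x. B' x + f n B x"] B.coboundaries_add map_coboundaries)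
        (auto simp: add add_ac)
  next
    assume "\<exists>B'\<in>coboundaries C' d' n. H = (\<lambda>x. B' x + f n F x)"
    then obtain B' where "B' \<in> coboundaries C' d' n" "H = (\<lambda>x. B' x + f n F x)" by auto
    then show "\<exists>B'\<in>coboundaries C' d' n. \<exists>B\<in>coboundaries C d n. H = (\<lambda>x. B' x + f n (\<lambda>x. B x + F x) x)"
      by (intro bexI[of _ B'] bexI[of _ "\<lambda>_. 0"] A.coboundaries_zero) auto
  qed
  also have "\<dots> \<longleftrightarrow> H \<in> ?R"
    by (auto simp: coh_class_def)
  finally show "H \<in> ?L \<longleftrightarrow> H \<in> ?R" .
qed

lemma cohomology_map_hom:
  "cohomology_map C' d' n (f n) \<in> hom (cohomology C d n) (cohomology C' d' n)"
proof (rule homI)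
  show "cohomology_map C' d' n (f n) X \<in> carrier (cohomology C' d' n)"
    if "X \<in> carrier (cohomology C d n)" for X
    using that by (auto simp: carrier_cohomology cohomology_map_class map_cocycles)
next
  fix X Y
  assume "X \<in> carrier (cohomology C d n)" "Y \<in> carrier (cohomology C d n)"
  then obtain F F' where F: "F \<in> cocycles C d n" "X = coh_class C d n F"
      "F' \<in> cocycles C d n" "Y = coh_class C d n F'"
    by (auto simp: carrier_cohomology)
  then show "cohomology_map C' d' n (f n) (X \<otimes>\<^bsub>cohomology C d n\<^esub> Y) =
      cohomology_map C' d' n (f n) X \<otimes>\<^bsub>cohomology C' d' n\<^esub> cohomology_map C' d' n (f n) Y"
    by (simp add: A.mult_cohomology B.mult_cohomology cohomology_map_class A.cocycles_add
        map_add[OF A.cocycles_mem A.cocycles_mem])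
qed

text \<open>\<open>g\<close> is an inverse up to coboundaries, given on cocycles. That it respects
  cohomologous cocycles gives injectivity by way of \<open>gf\<close>, while \<open>fg\<close> gives
  surjectivity.\<close>

lemma cohomology_map_iso:
  assumes g: "\<And>F. F \<in> cocycles C' d' n \<Longrightarrow> g F \<in> cocycles C d n"
    and g_cob: "\<And>F F'. \<lbrakk>F \<in> cocycles C' d' n; F' \<in> cocycles C' d' n;
        (\<lambda>y. F y - F' y) \<in> coboundaries C' d' n\<rbrakk> \<Longrightarrow> (\<lambda>x. g F x - g F' x) \<in> coboundaries C d n"
    and gf: "\<And>F. F \<in> cocycles C d n \<Longrightarrow> (\<lambda>x. g (f n F) x - F x) \<in> coboundaries C d n"
    and fg: "\<And>F. F \<in> cocycles C' d' n \<Longrightarrow> (\<lambda>y. f n (g F) y - F y) \<in> coboundaries C' d' n"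
  shows "cohomology_map C' d' n (f n) \<in> iso (cohomology C d n) (cohomology C' d' n)"
proof (rule isoI[OF cohomology_map_hom], rule bij_betw_imageI)
  show "inj_on (cohomology_map C' d' n (f n)) (carrier (cohomology C d n))"
  proof (rule inj_onI)
    fix X Y
    assume X: "X \<in> carrier (cohomology C d n)" "Y \<in> carrier (cohomology C d n)"
      and eq: "cohomology_map C' d' n (f n) X = cohomology_map C' d' n (f n) Y"
    from X obtain F F' where F: "F \<in> cocycles C d n" "X = coh_class C d n F"
        "F' \<in> cocycles C d n" "Y = coh_class C d n F'"
      by (auto simp: carrier_cohomology)
    have "(\<lambda>y. f n F y - f n F' y) \<in> coboundaries C' d' n"
      using eq F by (simp add: cohomology_map_class B.coh_class_eq_iff map_cocycles)
    then have "(\<lambda>x. g (f n F) x - g (f n F') x) \<in> coboundaries C d n"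
      using F by (intro g_cob map_cocycles)
    \<comment> \<open>The coboundaries telescope: \<open>g (f F) - g (f F')\<close>,
      \<open>F - g (f F)\<close> and \<open>g (f F') - F'\<close> add up to
      \<open>F - F'\<close>.\<close>
    from A.coboundaries_add[OF this A.coboundaries_add[OF A.coboundaries_minus[OF gf[OF F(1)]] gf[OF F(3)]]]
    show "X = Y"
      using F by (simp add: A.coh_class_eq_iff)
  qed
  show "cohomology_map C' d' n (f n) ` carrier (cohomology C d n) = carrier (cohomology C' d' n)"
  proof
    show "cohomology_map C' d' n (f n) ` carrier (cohomology C d n) \<subseteq> carrier (cohomology C' d' n)"
      using cohomology_map_hom[of n] by (auto simp: hom_def)
    show "carrier (cohomology C' d' n) \<subseteq> cohomology_map C' d' n (f n) ` carrier (cohomology C d n)"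
    proof
      fix Y assume "Y \<in> carrier (cohomology C' d' n)"
      then obtain F where F: "F \<in> cocycles C' d' n" "Y = coh_class C' d' n F"
        by (auto simp: carrier_cohomology)
      have "Y = cohomology_map C' d' n (f n) (coh_class C d n (g F))"
        using F fg[OF F(1)] B.coh_class_eq_iff[OF map_cocycles[OF g[OF F(1)]] F(1)]
        by (simp add: cohomology_map_class g)
      then show "Y \<in> cohomology_map C' d' n (f n) ` carrier (cohomology C d n)"
        using g[OF F(1)] by (auto simp: carrier_cohomology)
    qed
  qed
qed

end

lemma cochain_complex_cong:
  assumes "cochain_complex C d" "\<And>n F. F \<in> C n \<Longrightarrow> d n F = d' n F"
  shows "cochain_complex C d'"
proof -
  interpret cochain_complex C d by fact
  show ?thesis
    by unfold_locales
      (auto simp flip: assms(2) simp: zero_mem add_mem minus_mem d_mem d_add d_d)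
qed

lemma cochain_map_cong:
  assumes "cochain_map C d C' d' f" "\<And>n F. F \<in> C n \<Longrightarrow> d n F = e n F"
    "\<And>n F. F \<in> C' n \<Longrightarrow> d' n F = e' n F" "\<And>n F. F \<in> C n \<Longrightarrow> f n F = g n F"
  shows "cochain_map C e C' e' g"
proof -
  interpret cochain_map C d C' d' f by fact
  show ?thesis
    by (intro cochain_map.intro cochain_complex_cong[OF A.cochain_complex_axioms assms(2)]
        cochain_complex_cong[OF B.cochain_complex_axioms assms(3)] cochain_map_axioms.intro)
      (simp_all add: map_mem map_add map_d A.add_mem A.d_mem flip: assms(2-4))
qed

section \<open>Free resolutions with a basis\<close>

text \<open>Every generator \<open>x\<close> is \<open>act (pos x) (emb (idx x))\<close>; \<open>emb z\<close> is the basis element with index \<open>z\<close>,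
  and cochains are functions of the index.\<close>

record ('g, 'x, 'z) based_complex =
  gens :: "nat \<Rightarrow> 'x set"
  bidx :: "nat \<Rightarrow> 'z set"
  emb :: "'z \<Rightarrow> 'x"
  idx :: "'x \<Rightarrow> 'z"
  act :: "'g \<Rightarrow> 'x \<Rightarrow> 'x"
  pos :: "'x \<Rightarrow> 'g"
  bd :: "'x \<Rightarrow> 'x \<Rightarrow>\<^sub>0 int"

text \<open>The linear extension of \<open>f\<close> is a homomorphism of modules over the group
  ring from degree \<open>n\<close> to degree \<open>k\<close>, given by its values on
  generators.\<close>

definition equivariant ::
  "('g, 'm) monoid_scheme \<Rightarrow> ('g, 'x, 'z, 'n) based_complex_scheme \<Rightarrow> ('g, 'y, 'w, 'k) based_complex_scheme \<Rightarrow>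
   nat \<Rightarrow> nat \<Rightarrow> ('x \<Rightarrow> 'y \<Rightarrow>\<^sub>0 int) \<Rightarrow> bool" where
  "equivariant G X Y n k f \<longleftrightarrow>
     (\<forall>x\<in>gens X n. keys (f x) \<subseteq> gens Y k \<and>
        (\<forall>g\<in>carrier G. f (act X g x) = frag_map (act Y g) (f x)))"

definition cochains :: "('g, 'x, 'z, 'n) based_complex_scheme \<Rightarrow> nat \<Rightarrow> ('z \<Rightarrow> int) set" where
  "cochains X n = {F. \<forall>z. z \<notin> bidx X n \<longrightarrow> F z = 0}"

text \<open>Functions of the index are invariant functionals in disguise: \<open>F\<close> stands
  for \<open>F \<circ> idx Y\<close>, which is constant on orbits. Under this identification
  \<open>dual\<close> is precomposition with \<open>f\<close>; outside \<open>bidx X n\<close> its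
  value is \<open>0\<close> by convention.\<close>

definition dual ::
  "('g, 'x, 'z, 'n) based_complex_scheme \<Rightarrow> ('g, 'y, 'w, 'k) based_complex_scheme \<Rightarrow>
   nat \<Rightarrow> ('x \<Rightarrow> 'y \<Rightarrow>\<^sub>0 int) \<Rightarrow> ('w \<Rightarrow> int) \<Rightarrow> 'z \<Rightarrow> int" where
  "dual X Y n f F z = (if z \<in> bidx X n then lin_eval (\<lambda>y. F (idx Y y)) (f (emb X z)) else 0)"

definition delta ::
  "('g, 'x, 'z, 'n) based_complex_scheme \<Rightarrow> nat \<Rightarrow> ('z \<Rightarrow> int) \<Rightarrow> 'z \<Rightarrow> int" where
  "delta X n = dual X X (Suc n) (bd X)"

definition chain_map ::
  "('g, 'm) monoid_scheme \<Rightarrow> ('g, 'x, 'z, 'n) based_complex_scheme \<Rightarrow> ('g, 'y, 'w, 'k) based_complex_scheme \<Rightarrow>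
   (nat \<Rightarrow> 'x \<Rightarrow> 'y \<Rightarrow>\<^sub>0 int) \<Rightarrow> bool" where
  "chain_map G X Y f \<longleftrightarrow>
     (\<forall>n. equivariant G X Y n n (f n)) \<and>
     (\<forall>n. \<forall>x\<in>gens X (Suc n). frag_extend (bd Y) (f (Suc n) x) = frag_extend (f n) (bd X x)) \<and>
     (\<forall>x\<in>gens X 0. augmentation (f 0 x) = 1)"

text \<open>In degree \<open>0\<close> the kernel of the augmentation takes the place of the kernel
  of the boundary, so that exactness refers to the augmented complex.\<close>

definition chain_cycles :: "('g, 'x, 'z, 'n) based_complex_scheme \<Rightarrow> nat \<Rightarrow> ('x \<Rightarrow>\<^sub>0 int) set" where
  "chain_cycles X n =
     {c. keys c \<subseteq> gens X n \<and> (if n = 0 then augmentation c = 0 else frag_extend (bd X) c = 0)}"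

lemma augmentation_simps [simp]:
  "augmentation (frag_of x) = 1"
  "augmentation (a + b) = augmentation a + augmentation b"
  "augmentation (a - b) = augmentation a - augmentation b"
  "augmentation (- a) = - augmentation a"
  "augmentation (frag_cmul k a) = k * augmentation a"
  "augmentation 0 = 0"
  by (simp_all add: augmentation_def)

lemma augmentation_frag_extend:
  assumes "\<And>x. x \<in> keys c \<Longrightarrow> augmentation (f x) = k"
  shows "augmentation (frag_extend f c) = k * augmentation c"
proof -
  have "augmentation (frag_extend f c) = lin_eval (\<lambda>x. augmentation (f x)) c"
    by (simp add: augmentation_def)
  also have "\<dots> = lin_eval (\<lambda>x. k * 1) c"
    by (rule lin_eval_cong) (simp add: assms)
  also have "\<dots> = k * augmentation c"
    unfolding augmentation_def by (rule lin_eval_fun_cmul)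
  finally show ?thesis .
qed

lemma equivariantD:
  assumes "equivariant G X Y n k f" "x \<in> gens X n"
  shows "keys (f x) \<subseteq> gens Y k"
    and "g \<in> carrier G \<Longrightarrow> f (act X g x) = frag_map (act Y g) (f x)"
  using assms by (auto simp: equivariant_def)

lemma keys_equivariant:
  assumes "equivariant G X Y n k f" "keys c \<subseteq> gens X n"
  shows "keys (frag_extend f c) \<subseteq> gens Y k"
  using assms by (intro keys_frag_extend_subset) (auto simp: equivariant_def)

lemma equivariant_frag_map_act:
  assumes "equivariant G X Y n k f" "keys c \<subseteq> gens X n" "g \<in> carrier G"
  shows "frag_extend f (frag_map (act X g) c) = frag_map (act Y g) (frag_extend f c)"
  unfolding frag_extend_frag_extend
  by (rule frag_extend_eq) (use assms in \<open>auto simp: equivariant_def\<close>)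

lemma equivariant_comp:
  assumes "equivariant G X Y n k f" "equivariant G Y W k l h"
  shows "equivariant G X W n l (\<lambda>x. frag_extend h (f x))"
  unfolding equivariant_def
  using assms by (auto simp: equivariantD(2) equivariant_frag_map_act equivariantD(1)
      dest!: keys_equivariant[OF assms(2) equivariantD(1)[OF assms(1)]])

lemma equivariant_diff:
  assumes "equivariant G X Y n k f" "equivariant G X Y n k h"
  shows "equivariant G X Y n k (\<lambda>x. f x - h x)"
  unfolding equivariant_def
proof (intro ballI conjI)
  fix x assume x: "x \<in> gens X n"
  show "keys (f x - h x) \<subseteq> gens Y k"
    by (intro keys_diff_subset equivariantD(1)[OF assms(1) x] equivariantD(1)[OF assms(2) x])
  show "f (act X g x) - h (act X g x) = frag_map (act Y g) (f x - h x)" if "g \<in> carrier G" for g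
    by (simp add: equivariantD(2)[OF assms(1) x that] equivariantD(2)[OF assms(2) x that] frag_extend_diff)
qed

text \<open>\<open>act_emb\<close>, \<open>idx_act\<close> and \<open>pos_act\<close> make the
  generators a free \<open>G\<close>-set with one orbit for each index, so that each chain module is
  free over the group ring.\<close>

locale equivariant_complex = group G for G (structure) +
  fixes X :: "('a, 'x, 'z, 'n) based_complex_scheme"
  assumes emb_gens: "z \<in> bidx X n \<Longrightarrow> emb X z \<in> gens X n"
    and idx_emb: "z \<in> bidx X n \<Longrightarrow> idx X (emb X z) = z"
    and idx_gens: "x \<in> gens X n \<Longrightarrow> idx X x \<in> bidx X n"
    and pos_closed: "x \<in> gens X n \<Longrightarrow> pos X x \<in> carrier G"
    and act_emb: "x \<in> gens X n \<Longrightarrow> act X (pos X x) (emb X (idx X x)) = x"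
    and act_gens: "x \<in> gens X n \<Longrightarrow> g \<in> carrier G \<Longrightarrow> act X g x \<in> gens X n"
    and idx_act: "x \<in> gens X n \<Longrightarrow> g \<in> carrier G \<Longrightarrow> idx X (act X g x) = idx X x"
    and pos_act: "x \<in> gens X n \<Longrightarrow> g \<in> carrier G \<Longrightarrow> pos X (act X g x) = g \<otimes> pos X x"
    and act_act: "x \<in> gens X n \<Longrightarrow> g \<in> carrier G \<Longrightarrow> h \<in> carrier G \<Longrightarrow>
      act X g (act X h x) = act X (g \<otimes> h) x"
    and bd_equivariant: "equivariant G X X (Suc n) n (bd X)"
    and bd_bd: "x \<in> gens X (Suc (Suc n)) \<Longrightarrow> frag_extend (bd X) (bd X x) = 0"
    and augmentation_bd: "x \<in> gens X (Suc 0) \<Longrightarrow> augmentation (bd X x) = 0"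

text \<open>\<open>gens_0\<close> makes the augmentation onto, since a generator has augmentation
  \<open>1\<close>; \<open>exact\<close> is the rest of the exactness of the augmented
  complex.\<close>

locale resolution = equivariant_complex +
  assumes exact: "c \<in> chain_cycles X n \<Longrightarrow>
      \<exists>b. keys b \<subseteq> gens X (Suc n) \<and> frag_extend (bd X) b = c"
    and gens_0: "gens X 0 \<noteq> {}"

text \<open>\<open>x\<close> is its basis element translated by \<open>pos X x\<close>;
  \<open>f\<close> carries the translation to the target, where \<open>idx\<close> forgets
  it.\<close>

lemma (in equivariant_complex) lin_eval_equivariant:
  assumes f: "equivariant G X Y n k f" and Y: "equivariant_complex G Y" and x: "x \<in> gens X n"
  shows "lin_eval (\<lambda>y. F (idx Y y)) (f x) = dual X Y n f F (idx X x)"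
proof -
  interpret Y: equivariant_complex G Y by fact
  let ?b = "emb X (idx X x)"
  have b: "?b \<in> gens X n"
    using x by (intro emb_gens idx_gens)
  have "f x = frag_map (act Y (pos X x)) (f ?b)"
    using equivariantD(2)[OF f b pos_closed[OF x]] by (simp add: act_emb[OF x])
  then have "lin_eval (\<lambda>y. F (idx Y y)) (f x) = lin_eval (\<lambda>y. F (idx Y (act Y (pos X x) y))) (f ?b)"
    by simp
  also have "\<dots> = lin_eval (\<lambda>y. F (idx Y y)) (f ?b)"
    using equivariantD(1)[OF f b] pos_closed[OF x]
    by (intro lin_eval_cong) (auto simp: Y.idx_act)
  finally show ?thesis
    using x by (simp add: dual_def idx_gens)
qed

text \<open>The functional built from \<open>h\<close> factors through the index by
  \<open>lin_eval_equivariant\<close>, which turns composition of maps into composition of duals. It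
  yields both that \<open>delta\<close> squares to zero and that duals of chain maps commute with
  \<open>delta\<close>.\<close>

lemma (in equivariant_complex) dual_comp:
  assumes f: "equivariant G X Y n k f" and h: "equivariant G Y W k l h"
    and Y: "equivariant_complex G Y" and W: "equivariant_complex G W"
  shows "dual X W n (\<lambda>x. frag_extend h (f x)) F = dual X Y n f (dual Y W k h F)"
proof
  fix z
  interpret Y: equivariant_complex G Y by fact
  show "dual X W n (\<lambda>x. frag_extend h (f x)) F z = dual X Y n f (dual Y W k h F) z"
  proof (cases "z \<in> bidx X n")
    case True
    have "lin_eval (\<lambda>y. lin_eval (\<lambda>w. F (idx W w)) (h y)) (f (emb X z))
        = lin_eval (\<lambda>y. dual Y W k h F (idx Y y)) (f (emb X z))"
      using equivariantD(1)[OF f emb_gens[OF True]]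
      by (intro lin_eval_cong Y.lin_eval_equivariant[OF h W]) auto
    with True show ?thesis
      by (simp add: dual_def[of X])
  qed (simp add: dual_def)
qed

lemma dual_mem: "dual X Y n f F \<in> cochains X n"
  by (simp add: dual_def cochains_def)

lemma dual_fun_add: "dual X Y n f (\<lambda>z. F z + F' z) = (\<lambda>z. dual X Y n f F z + dual X Y n f F' z)"
  by (auto simp: dual_def lin_eval_fun_add)

lemma dual_diff: "dual X Y n (\<lambda>x. f x - h x) F z = dual X Y n f F z - dual X Y n h F z"
  by (simp add: dual_def)

lemma (in equivariant_complex) dual_cong:
  assumes "\<And>x. x \<in> gens X n \<Longrightarrow> f x = h x"
  shows "dual X Y n f F = dual X Y n h F"
  using assms by (auto simp: dual_def emb_gens)

lemma (in equivariant_complex) cochain_complex: "cochain_complex (cochains X) (delta X)"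
proof
  fix n F
  have "delta X (Suc n) (delta X n F) = dual X X (Suc (Suc n)) (\<lambda>x. frag_extend (bd X) (bd X x)) F"
    using dual_comp[OF bd_equivariant bd_equivariant] by (simp add: delta_def equivariant_complex_axioms)
  also have "\<dots> = dual X X (Suc (Suc n)) (\<lambda>_. 0) F"
    by (rule dual_cong) (rule bd_bd)
  finally show "delta X (Suc n) (delta X n F) = (\<lambda>_. 0)"
    by (auto simp: dual_def)
qed (auto simp: delta_def dual_mem dual_fun_add, auto simp: cochains_def)

lemma dual_cochain_map:
  assumes f: "chain_map G X Y f" and X: "equivariant_complex G X" and Y: "equivariant_complex G Y"
  shows "cochain_map (cochains Y) (delta Y) (cochains X) (delta X) (\<lambda>n. dual X Y n (f n))"
proof -
  interpret X: equivariant_complex G X by fact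
  interpret Y: equivariant_complex G Y by fact
  have eq: "equivariant G X Y n n (f n)" for n
    using f by (simp add: chain_map_def)
  have "delta X n (dual X Y n (f n) F) = dual X Y (Suc n) (f (Suc n)) (delta Y n F)" for n F
  proof -
    have "delta X n (dual X Y n (f n) F) = dual X Y (Suc n) (\<lambda>x. frag_extend (f n) (bd X x)) F"
      unfolding delta_def by (rule X.dual_comp[OF X.bd_equivariant eq X Y, symmetric])
    also have "\<dots> = dual X Y (Suc n) (\<lambda>x. frag_extend (bd Y) (f (Suc n) x)) F"
      by (rule X.dual_cong) (use f in \<open>simp add: chain_map_def\<close>)
    also have "\<dots> = dual X Y (Suc n) (f (Suc n)) (delta Y n F)"
      unfolding delta_def by (rule X.dual_comp[OF eq Y.bd_equivariant Y Y])
    finally show ?thesis .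
  qed
  then show ?thesis
    by (intro cochain_map.intro X.cochain_complex Y.cochain_complex)
      (unfold_locales, auto simp: dual_mem dual_fun_add)
qed

lemma (in equivariant_complex) chain_map_id: "chain_map G X X (\<lambda>_. frag_of)"
  by (auto simp: chain_map_def equivariant_def)

lemma chain_map_comp:
  assumes f: "chain_map G X Y f" and h: "chain_map G Y W h" and X: "equivariant_complex G X"
  shows "chain_map G X W (\<lambda>n x. frag_extend (h n) (f n x))"
  unfolding chain_map_def
proof (intro conjI allI ballI)
  interpret X: equivariant_complex G X by fact
  have fe: "equivariant G X Y n n (f n)" and he: "equivariant G Y W n n (h n)" for n
    using f h by (simp_all add: chain_map_def)
  fix n
  show "equivariant G X W n n (\<lambda>x. frag_extend (h n) (f n x))"
    by (rule equivariant_comp[OF fe he])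
  show "frag_extend (bd W) (frag_extend (h (Suc n)) (f (Suc n) x))
      = frag_extend (\<lambda>x. frag_extend (h n) (f n x)) (bd X x)" if x: "x \<in> gens X (Suc n)" for x
  proof -
    have "frag_extend (bd W) (frag_extend (h (Suc n)) (f (Suc n) x))
        = frag_extend (\<lambda>y. frag_extend (h n) (bd Y y)) (f (Suc n) x)"
      unfolding frag_extend_frag_extend
      using equivariantD(1)[OF fe x] h by (intro frag_extend_eq) (auto simp: chain_map_def)
    also have "\<dots> = frag_extend (h n) (frag_extend (bd Y) (f (Suc n) x))"
      by (simp add: frag_extend_frag_extend)
    also have "\<dots> = frag_extend (h n) (frag_extend (f n) (bd X x))"
      using f x by (simp add: chain_map_def)
    finally show ?thesis
      by (simp add: frag_extend_frag_extend)
  qed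
  show "augmentation (frag_extend (h 0) (f 0 x)) = 1" if x: "x \<in> gens X 0" for x
    using f h x equivariantD(1)[OF fe x]
    by (subst augmentation_frag_extend[where k = 1]) (auto simp: chain_map_def)
qed

section \<open>The comparison theorem\<close>

text \<open>Freeness at work: the values \<open>w\<close> on the basis are spread over the orbits by
  means of \<open>pos\<close>, and \<open>pos_act\<close> makes the result equivariant.\<close>

lemma equivariant_extension:
  assumes "equivariant_complex G X" "equivariant_complex G Y"
    and w: "\<And>z. z \<in> bidx X n \<Longrightarrow> keys (w z) \<subseteq> gens Y k"
  shows "equivariant G X Y n k (\<lambda>x. frag_map (act Y (pos X x)) (w (idx X x)))"
  unfolding equivariant_def
proof (intro ballI conjI)
  interpret X: equivariant_complex G X by fact
  interpret Y: equivariant_complex G Y by fact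
  fix x assume x: "x \<in> gens X n"
  show "keys (frag_map (act Y (pos X x)) (w (idx X x))) \<subseteq> gens Y k"
    using w[OF X.idx_gens[OF x]] X.pos_closed[OF x]
    by (intro keys_frag_extend_subset) (auto intro: Y.act_gens)
  fix g assume g: "g \<in> carrier G"
  show "frag_map (act Y (pos X (act X g x))) (w (idx X (act X g x)))
      = frag_map (act Y g) (frag_map (act Y (pos X x)) (w (idx X x)))"
    unfolding frag_extend_frag_extend X.pos_act[OF x g] X.idx_act[OF x g] frag_extend_of
    using w[OF X.idx_gens[OF x]] X.pos_closed[OF x] g
    by (intro frag_extend_eq) (auto simp: Y.act_act)
qed

text \<open>Exactness lifts \<open>u\<close> at the basis elements; the lift is then spread over the
  orbits, and its boundary is \<open>u\<close> everywhere because both are equivariant.\<close>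

lemma equivariant_preimage:
  assumes X: "equivariant_complex G X" and Y: "resolution G Y"
    and u: "equivariant G X Y n k u" and cyc: "\<And>x. x \<in> gens X n \<Longrightarrow> u x \<in> chain_cycles Y k"
  shows "\<exists>v. equivariant G X Y n (Suc k) v \<and> (\<forall>x\<in>gens X n. frag_extend (bd Y) (v x) = u x)"
proof -
  interpret X: equivariant_complex G X by fact
  interpret Y: resolution G Y by fact
  have "\<forall>z\<in>bidx X n. \<exists>b. keys b \<subseteq> gens Y (Suc k) \<and> frag_extend (bd Y) b = u (emb X z)"
    using cyc X.emb_gens Y.exact by blast
  then obtain w where w: "\<And>z. z \<in> bidx X n \<Longrightarrow> keys (w z) \<subseteq> gens Y (Suc k)"
      "\<And>z. z \<in> bidx X n \<Longrightarrow> frag_extend (bd Y) (w z) = u (emb X z)"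
    by metis
  let ?v = "\<lambda>x. frag_map (act Y (pos X x)) (w (idx X x))"
  have "frag_extend (bd Y) (?v x) = u x" if x: "x \<in> gens X n" for x
  proof -
    have z: "idx X x \<in> bidx X n"
      using x by (rule X.idx_gens)
    have "frag_extend (bd Y) (?v x) = frag_map (act Y (pos X x)) (u (emb X (idx X x)))"
      using equivariant_frag_map_act[OF Y.bd_equivariant w(1)[OF z] X.pos_closed[OF x]]
      by (simp add: w(2)[OF z])
    also have "\<dots> = u x"
      using equivariantD(2)[OF u X.emb_gens[OF z] X.pos_closed[OF x]] by (simp add: X.act_emb[OF x])
    finally show ?thesis .
  qed
  then show ?thesis
    using equivariant_extension[OF X Y.equivariant_complex_axioms, where w = w and n = n, OF w(1)]
    by (intro exI[of _ ?v]) simp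
qed

theorem chain_map_exists:
  assumes X: "equivariant_complex G X" and Y: "resolution G Y"
  shows "\<exists>f. chain_map G X Y f"
proof -
  interpret X: equivariant_complex G X by fact
  interpret Y: resolution G Y by fact
  obtain y where y: "y \<in> gens Y 0"
    using Y.gens_0 by blast
  \<comment> \<open>The last clause of \<open>P\<close> is carried through the induction because
    exactness lifts cycles only; it is what makes the next map possible. \<open>Q\<close> links
    consecutive maps.\<close>
  define P where "P n f \<longleftrightarrow> equivariant G X Y n n f
      \<and> (n = 0 \<longrightarrow> (\<forall>x\<in>gens X 0. augmentation (f x) = 1))
      \<and> (\<forall>x\<in>gens X (Suc n). frag_extend f (bd X x) \<in> chain_cycles Y n)" for n f
  define Q where "Q n f f' \<longleftrightarrow> (\<forall>x\<in>gens X (Suc n). frag_extend (bd Y) (f' x) = frag_extend f (bd X x))"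
    for n f f'
  have "\<exists>f. \<forall>n. P n (f n) \<and> Q n (f n) (f (Suc n))"
  proof (rule dependent_nat_choice)
    let ?f = "\<lambda>x. frag_map (act Y (pos X x)) (frag_of y)"
    have eq: "equivariant G X Y 0 0 ?f"
      by (rule equivariant_extension[OF X Y.equivariant_complex_axioms]) (use y in auto)
    have aug: "\<forall>x\<in>gens X 0. augmentation (?f x) = 1"
      by simp
    have "frag_extend ?f (bd X x) \<in> chain_cycles Y 0" if "x \<in> gens X (Suc 0)" for x
      using keys_equivariant[OF eq equivariantD(1)[OF X.bd_equivariant that]]
      by (simp add: chain_cycles_def augmentation_frag_extend[where k = 1] X.augmentation_bd[OF that])
    with eq aug show "\<exists>f. P 0 f"
      unfolding P_def by blast
  next
    fix f n assume P: "P n f"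
    then have f: "equivariant G X Y n n f"
      and cyc: "\<And>x. x \<in> gens X (Suc n) \<Longrightarrow> frag_extend f (bd X x) \<in> chain_cycles Y n"
      by (auto simp: P_def)
    from equivariant_preimage[OF X Y equivariant_comp[OF X.bd_equivariant f] cyc]
    obtain f' where f': "equivariant G X Y (Suc n) (Suc n) f'"
        "\<And>x. x \<in> gens X (Suc n) \<Longrightarrow> frag_extend (bd Y) (f' x) = frag_extend f (bd X x)"
      by blast
    have "frag_extend f' (bd X x) \<in> chain_cycles Y (Suc n)" if x: "x \<in> gens X (Suc (Suc n))" for x
    proof -
      have "frag_extend (bd Y) (frag_extend f' (bd X x)) = frag_extend (\<lambda>x. frag_extend f (bd X x)) (bd X x)"
        unfolding frag_extend_frag_extend
        using equivariantD(1)[OF X.bd_equivariant x] by (intro frag_extend_eq f'(2)) auto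
      also have "\<dots> = frag_extend f (frag_extend (bd X) (bd X x))"
        by (simp add: frag_extend_frag_extend)
      finally show ?thesis
        using keys_equivariant[OF f'(1) equivariantD(1)[OF X.bd_equivariant x]]
        by (simp add: chain_cycles_def X.bd_bd[OF x])
    qed
    with f' show "\<exists>f'. P (Suc n) f' \<and> Q n f f'"
      unfolding P_def Q_def by blast
  qed
  then obtain f where "\<And>n. P n (f n)" "\<And>n. Q n (f n) (f (Suc n))"
    by blast
  then show ?thesis
    unfolding chain_map_def P_def Q_def by (intro exI[of _ f]) auto
qed

theorem chain_homotopy_exists:
  assumes X: "equivariant_complex G X" and Y: "resolution G Y"
    and f: "chain_map G X Y f" and g: "chain_map G X Y g"
  shows "\<exists>h. (\<forall>n. equivariant G X Y n (Suc n) (h n))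
      \<and> (\<forall>x\<in>gens X 0. frag_extend (bd Y) (h 0 x) = f 0 x - g 0 x)
      \<and> (\<forall>n. \<forall>x\<in>gens X (Suc n). frag_extend (bd Y) (h (Suc n) x)
            = f (Suc n) x - g (Suc n) x - frag_extend (h n) (bd X x))"
proof -
  interpret X: equivariant_complex G X by fact
  interpret Y: resolution G Y by fact
  define w where "w n = (\<lambda>x. f n x - g n x)" for n
  have w: "equivariant G X Y n n (w n)" for n
    using f g unfolding w_def by (intro equivariant_diff) (auto simp: chain_map_def)
  have w_bd: "frag_extend (bd Y) (w (Suc n) x) = frag_extend (w n) (bd X x)"
    if "x \<in> gens X (Suc n)" for n x
    using f g that by (simp add: w_def chain_map_def frag_extend_diff frag_extend_fun_diff)
  \<comment> \<open>The next value of the homotopy is a lift of \<open>w - h \<circ> bd\<close>,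
    whose boundary has to vanish; the last clause of \<open>P\<close> says just that.\<close>
  define P where "P n h \<longleftrightarrow> equivariant G X Y n (Suc n) h
      \<and> (n = 0 \<longrightarrow> (\<forall>x\<in>gens X 0. frag_extend (bd Y) (h x) = w 0 x))
      \<and> (\<forall>x\<in>gens X (Suc n). frag_extend (bd Y) (frag_extend h (bd X x)) = frag_extend (w n) (bd X x))"
    for n h
  define Q where "Q n h h' \<longleftrightarrow> (\<forall>x\<in>gens X (Suc n).
      frag_extend (bd Y) (h' x) = w (Suc n) x - frag_extend h (bd X x))" for n h h'
  have "\<exists>h. \<forall>n. P n (h n) \<and> Q n (h n) (h (Suc n))"
  proof (rule dependent_nat_choice)
    have "w 0 x \<in> chain_cycles Y 0" if "x \<in> gens X 0" for x
      using f g that equivariantD(1)[OF w that] by (simp add: chain_cycles_def w_def chain_map_def)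
    from equivariant_preimage[OF X Y w this] obtain h where
      h: "equivariant G X Y 0 (Suc 0) h" "\<And>x. x \<in> gens X 0 \<Longrightarrow> frag_extend (bd Y) (h x) = w 0 x"
      by blast
    have "frag_extend (bd Y) (frag_extend h (bd X x)) = frag_extend (w 0) (bd X x)"
      if "x \<in> gens X (Suc 0)" for x
      unfolding frag_extend_frag_extend
      using equivariantD(1)[OF X.bd_equivariant that] by (intro frag_extend_eq h(2)) auto
    with h show "\<exists>h. P 0 h"
      unfolding P_def by blast
  next
    fix h n assume "P n h"
    then have h: "equivariant G X Y n (Suc n) h"
      and hb: "\<And>x. x \<in> gens X (Suc n) \<Longrightarrow>
        frag_extend (bd Y) (frag_extend h (bd X x)) = frag_extend (w n) (bd X x)"
      by (auto simp: P_def)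
    let ?u = "\<lambda>x. w (Suc n) x - frag_extend h (bd X x)"
    have u: "equivariant G X Y (Suc n) (Suc n) ?u"
      by (intro equivariant_diff w equivariant_comp[OF X.bd_equivariant h])
    have "?u x \<in> chain_cycles Y (Suc n)" if "x \<in> gens X (Suc n)" for x
      using equivariantD(1)[OF u that] by (simp add: chain_cycles_def frag_extend_diff hb w_bd that)
    from equivariant_preimage[OF X Y u this]
    obtain h' where h': "equivariant G X Y (Suc n) (Suc (Suc n)) h'"
        "\<And>x. x \<in> gens X (Suc n) \<Longrightarrow> frag_extend (bd Y) (h' x) = ?u x"
      by blast
    have "frag_extend (bd Y) (frag_extend h' (bd X x)) = frag_extend (w (Suc n)) (bd X x)"
      if x: "x \<in> gens X (Suc (Suc n))" for x
    proof -
      have "frag_extend (bd Y) (frag_extend h' (bd X x)) = frag_extend ?u (bd X x)"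
        unfolding frag_extend_frag_extend
        using equivariantD(1)[OF X.bd_equivariant x] by (intro frag_extend_eq h'(2)) auto
      also have "\<dots> = frag_extend (w (Suc n)) (bd X x) - frag_extend h (frag_extend (bd X) (bd X x))"
        by (simp add: frag_extend_frag_extend frag_extend_fun_diff)
      finally show ?thesis
        by (simp add: X.bd_bd[OF x])
    qed
    with h' show "\<exists>h'. P (Suc n) h' \<and> Q n h h'"
      unfolding P_def Q_def by blast
  qed
  then obtain h where "\<And>n. P n (h n)" "\<And>n. Q n (h n) (h (Suc n))"
    by blast
  then show ?thesis
    unfolding P_def Q_def w_def by (intro exI[of _ h]) auto
qed

text \<open>Dualizing the homotopy splits the difference into a part with \<open>bd Y\<close> after
  \<open>h\<close>, which vanishes on the cocycle \<open>F\<close>, and a part that is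
  \<open>delta\<close> of the dual of \<open>h\<close>. In degree \<open>0\<close> only the first
  part exists, so the two images are equal.\<close>

corollary chain_maps_cohomologous:
  assumes X: "equivariant_complex G X" and Y: "resolution G Y"
    and f: "chain_map G X Y f" and g: "chain_map G X Y g"
    and F: "F \<in> cocycles (cochains Y) (delta Y) n"
  shows "(\<lambda>z. dual X Y n (f n) F z - dual X Y n (g n) F z) \<in> coboundaries (cochains X) (delta X) n"
proof -
  interpret X: equivariant_complex G X by fact
  interpret Y: resolution G Y by fact
  note Y' = Y.equivariant_complex_axioms
  obtain h where h: "\<And>n. equivariant G X Y n (Suc n) (h n)"
      "\<And>x. x \<in> gens X 0 \<Longrightarrow> frag_extend (bd Y) (h 0 x) = f 0 x - g 0 x"
      "\<And>n x. x \<in> gens X (Suc n) \<Longrightarrow> frag_extend (bd Y) (h (Suc n) x)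
            = f (Suc n) x - g (Suc n) x - frag_extend (h n) (bd X x)"
    using chain_homotopy_exists[OF X Y f g] by blast
  have dF: "dual Y Y (Suc n) (bd Y) F = (\<lambda>_. 0)"
    using F by (simp add: cocycles_def delta_def)
  have bdh: "dual X Y n (\<lambda>x. frag_extend (bd Y) (h n x)) F = (\<lambda>_. 0)"
    using X.dual_comp[OF h(1) Y.bd_equivariant Y' Y', of n F]
    unfolding dF by (auto simp: dual_def[of X Y n "h n"])
  show ?thesis
  proof (cases n)
    case 0
    have "dual X Y 0 (\<lambda>x. f 0 x - g 0 x) F = dual X Y 0 (\<lambda>x. frag_extend (bd Y) (h 0 x)) F"
      by (rule X.dual_cong) (simp add: h(2))
    with bdh 0 show ?thesis
      by (simp add: coboundaries_def dual_diff[symmetric])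
  next
    case (Suc m)
    have "dual X Y n (\<lambda>x. f n x - g n x - frag_extend (h m) (bd X x)) F
        = dual X Y n (\<lambda>x. frag_extend (bd Y) (h n x)) F"
      by (rule X.dual_cong) (simp add: h(3) Suc)
    also note bdh
    finally have "dual X Y n (f n) F z - dual X Y n (g n) F z
        - dual X Y n (\<lambda>x. frag_extend (h m) (bd X x)) F z = 0" for z
      by (simp add: fun_eq_iff dual_diff)
    then have "(\<lambda>z. dual X Y n (f n) F z - dual X Y n (g n) F z)
        = dual X Y n (\<lambda>x. frag_extend (h m) (bd X x)) F"
      by (simp add: fun_eq_iff)
    also have "\<dots> = delta X m (dual X Y m (h m) F)"
      unfolding Suc delta_def by (rule X.dual_comp[OF X.bd_equivariant h(1) X Y'])
    finally show ?thesis
      by (simp add: coboundaries_def Suc dual_mem)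
  qed
qed

lemma (in equivariant_complex) dual_id:
  assumes "F \<in> cochains X n"
  shows "dual X X n frag_of F = F"
  using assms by (auto simp: dual_def cochains_def idx_emb fun_eq_iff)

text \<open>A chain map in the other direction exists, and by uniqueness up to homotopy both
  composites act on cohomology as the identity.\<close>

theorem cohomology_map_dual_iso:
  assumes X: "resolution G X" and Y: "resolution G Y" and f: "chain_map G X Y f"
  shows "cohomology_map (cochains X) (delta X) n (dual X Y n (f n))
    \<in> iso (cohomology (cochains Y) (delta Y) n) (cohomology (cochains X) (delta X) n)"
proof -
  interpret X: resolution G X by fact
  interpret Y: resolution G Y by fact
  note X' = X.equivariant_complex_axioms and Y' = Y.equivariant_complex_axioms
  obtain h where h: "chain_map G Y X h"
    using chain_map_exists[OF Y' X] by blast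
  interpret f: cochain_map "cochains Y" "delta Y" "cochains X" "delta X" "\<lambda>n. dual X Y n (f n)"
    by (rule dual_cochain_map[OF f X' Y'])
  interpret h: cochain_map "cochains X" "delta X" "cochains Y" "delta Y" "\<lambda>n. dual Y X n (h n)"
    by (rule dual_cochain_map[OF h Y' X'])
  have fe: "equivariant G X Y n n (f n)" and he: "equivariant G Y X n n (h n)"
    using f h by (simp_all add: chain_map_def)
  show ?thesis
  proof (rule f.cohomology_map_iso)
    fix F assume F: "F \<in> cocycles (cochains Y) (delta Y) n"
    show "(\<lambda>z. dual Y X n (h n) (dual X Y n (f n) F) z - F z) \<in> coboundaries (cochains Y) (delta Y) n"
      using chain_maps_cohomologous[OF Y' Y chain_map_comp[OF h f Y'] Y.chain_map_id F]
      by (simp add: Y.dual_comp[OF he fe X' Y'] Y.dual_id[OF f.A.cocycles_mem[OF F]])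
  next
    fix F assume F: "F \<in> cocycles (cochains X) (delta X) n"
    show "(\<lambda>z. dual X Y n (f n) (dual Y X n (h n) F) z - F z) \<in> coboundaries (cochains X) (delta X) n"
      using chain_maps_cohomologous[OF X' X chain_map_comp[OF f h X'] X.chain_map_id F]
      by (simp add: X.dual_comp[OF fe he Y' X'] X.dual_id[OF f.B.cocycles_mem[OF F]])
  qed (auto intro: h.map_cocycles h.map_cohomologous)
qed

section \<open>Normalization\<close>

definition nondeg ::
  "('g, 'x, 'z, 'n) based_complex_scheme \<Rightarrow> 'z set \<Rightarrow> ('x \<Rightarrow>\<^sub>0 int) \<Rightarrow> 'x \<Rightarrow>\<^sub>0 int" where
  "nondeg X M = frag_extend (\<lambda>x. if idx X x \<in> M then 0 else frag_of x)"

text \<open>A chain of the quotient by the span of the generators with index in \<open>M\<close> is represented by its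
  part outside that span.\<close>

definition quotient_complex ::
  "('g, 'x, 'z, 'n) based_complex_scheme \<Rightarrow> 'z set \<Rightarrow> ('g, 'x, 'z, 'n) based_complex_scheme" where
  "quotient_complex X M = X\<lparr>gens := \<lambda>n. {x \<in> gens X n. idx X x \<notin> M}, bidx := \<lambda>n. bidx X n - M,
     bd := \<lambda>x. nondeg X M (bd X x)\<rparr>"

lemma quotient_complex_simps [simp]:
  "gens (quotient_complex X M) n = {x \<in> gens X n. idx X x \<notin> M}"
  "bidx (quotient_complex X M) n = bidx X n - M"
  "emb (quotient_complex X M) = emb X"
  "idx (quotient_complex X M) = idx X"
  "act (quotient_complex X M) = act X"
  "pos (quotient_complex X M) = pos X"
  "bd (quotient_complex X M) x = nondeg X M (bd X x)"
  by (simp_all add: quotient_complex_def)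

lemma keys_nondeg: "keys (nondeg X M c) \<subseteq> {x \<in> keys c. idx X x \<notin> M}"
  unfolding nondeg_def by (rule keys_frag_extend_subset) auto

lemma nondeg_id:
  assumes "\<And>x. x \<in> keys c \<Longrightarrow> idx X x \<notin> M"
  shows "nondeg X M c = c"
proof -
  have "nondeg X M c = frag_extend frag_of c"
    unfolding nondeg_def by (rule frag_extend_eq) (simp add: assms)
  then show ?thesis by simp
qed

lemma nondeg_zero:
  "(\<And>x. x \<in> keys c \<Longrightarrow> idx X x \<in> M) \<Longrightarrow> nondeg X M c = 0"
  unfolding nondeg_def by (rule frag_extend_eq_0) simp

lemma nondeg_diff: "nondeg X M (a - b) = nondeg X M a - nondeg X M b"
  by (simp add: nondeg_def frag_extend_diff)

lemma lin_eval_nondeg: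
  assumes "\<And>z. z \<in> M \<Longrightarrow> F z = 0"
  shows "lin_eval (\<lambda>x. F (idx X x)) (nondeg X M c) = lin_eval (\<lambda>x. F (idx X x)) c"
  unfolding nondeg_def lin_eval_frag_extend by (rule lin_eval_cong) (simp add: assms)

lemma frag_extend_nondeg:
  assumes "\<And>x. x \<in> keys c \<Longrightarrow> idx X x \<in> M \<Longrightarrow> h x = 0"
  shows "frag_extend h (nondeg X M c) = frag_extend h c"
  unfolding nondeg_def frag_extend_frag_extend by (rule frag_extend_eq) (simp add: assms)

text \<open>Well-definedness of \<open>h\<close> on the quotients, in terms of representatives: what
  is dropped first is sent by \<open>h\<close> to terms that would be dropped later.\<close>

lemma nondeg_frag_extend_nondeg:
  assumes "\<And>x y. x \<in> keys c \<Longrightarrow> idx X x \<in> M \<Longrightarrow> y \<in> keys (h x) \<Longrightarrow> idx Y y \<in> N"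
  shows "nondeg Y N (frag_extend h (nondeg X M c)) = nondeg Y N (frag_extend h c)"
proof -
  have *: "nondeg Y N (frag_extend h c) = frag_extend (\<lambda>x. nondeg Y N (h x)) c" for c
    by (simp add: nondeg_def frag_extend_frag_extend)
  show ?thesis
    unfolding * by (rule frag_extend_nondeg) (use assms in \<open>blast intro: nondeg_zero\<close>)
qed

lemma quotient_complex_empty [simp]: "quotient_complex X {} = X"
proof -
  have "nondeg X {} = (\<lambda>c. c)"
    by (simp add: nondeg_def fun_eq_iff)
  then show ?thesis
    by (simp add: quotient_complex_def)
qed

text \<open>\<open>s\<close> is additive but need not be equivariant. It contracts the complex onto
  \<open>x0\<close>, and since \<open>s\<close> and \<open>bd\<close> preserve the span of the
  degenerate generators, the same \<open>s\<close> contracts the quotient.\<close>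

locale contracted_complex = equivariant_complex +
  fixes M :: "'d set" and s :: "'c \<Rightarrow> 'c \<Rightarrow>\<^sub>0 int" and x0 :: 'c
  assumes bd_degenerate: "x \<in> gens X (Suc n) \<Longrightarrow> idx X x \<in> M \<Longrightarrow> y \<in> keys (bd X x) \<Longrightarrow> idx X y \<in> M"
    and gens_0_nondegenerate: "x \<in> gens X 0 \<Longrightarrow> idx X x \<notin> M"
    and x0: "x0 \<in> gens X 0"
    and s_gens: "x \<in> gens X n \<Longrightarrow> keys (s x) \<subseteq> gens X (Suc n)"
    and s_degenerate: "x \<in> gens X n \<Longrightarrow> idx X x \<in> M \<Longrightarrow> y \<in> keys (s x) \<Longrightarrow> idx X y \<in> M"
    and bd_s_0: "x \<in> gens X 0 \<Longrightarrow> frag_extend (bd X) (s x) = frag_of x - frag_of x0"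
    and bd_s_Suc: "x \<in> gens X (Suc n) \<Longrightarrow> frag_extend (bd X) (s x) = frag_of x - frag_extend s (bd X x)"
begin

lemma equivariant_nondeg:
  assumes "equivariant G W X n k f"
  shows "equivariant G W (quotient_complex X M) n k (\<lambda>x. nondeg X M (f x))"
  unfolding equivariant_def
proof (intro ballI conjI)
  fix x assume x: "x \<in> gens W n"
  note f = equivariantD[OF assms x]
  show "keys (nondeg X M (f x)) \<subseteq> gens (quotient_complex X M) k"
    using keys_nondeg[of X M "f x"] f(1) by auto
  fix g assume g: "g \<in> carrier G"
  have "nondeg X M (frag_map (act X g) (f x))
      = frag_map (act X g) (nondeg X M (f x))"
    unfolding nondeg_def frag_extend_frag_extend
    using f(1) g by (intro frag_extend_eq) (auto simp: idx_act)
  then show "nondeg X M (f (act W g x)) = frag_map (act (quotient_complex X M) g) (nondeg X M (f x))"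
    by (simp add: f(2)[OF g])
qed

lemma nondeg_bd_nondeg:
  assumes "keys c \<subseteq> gens X (Suc n)"
  shows "nondeg X M (frag_extend (bd X) (nondeg X M c)) = nondeg X M (frag_extend (bd X) c)"
  using assms bd_degenerate by (intro nondeg_frag_extend_nondeg) blast

lemma frag_extend_bd_quotient:
  "frag_extend (bd (quotient_complex X M)) c = nondeg X M (frag_extend (bd X) c)"
proof -
  have "bd (quotient_complex X M) = (\<lambda>x. nondeg X M (bd X x))"
    by (simp add: fun_eq_iff)
  then show ?thesis
    by (simp add: nondeg_def frag_extend_frag_extend)
qed

lemma nondeg_gens_0: "keys c \<subseteq> gens X 0 \<Longrightarrow> nondeg X M c = c"
  using gens_0_nondegenerate by (intro nondeg_id) auto

lemma equivariant_complex_quotient: "equivariant_complex G (quotient_complex X M)"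
proof
  fix n
  have "equivariant G (quotient_complex X M) X (Suc n) n (bd X)"
    using bd_equivariant[of n] by (simp add: equivariant_def)
  from equivariant_nondeg[OF this]
  show "equivariant G (quotient_complex X M) (quotient_complex X M) (Suc n) n (bd (quotient_complex X M))"
    by (simp add: equivariant_def)
  show "frag_extend (bd (quotient_complex X M)) (bd (quotient_complex X M) x) = 0"
    if "x \<in> gens (quotient_complex X M) (Suc (Suc n))" for x
  proof -
    have x: "x \<in> gens X (Suc (Suc n))"
      using that by simp
    show ?thesis
      using equivariantD(1)[OF bd_equivariant x]
      by (simp add: frag_extend_bd_quotient nondeg_bd_nondeg bd_bd[OF x])
        (simp add: nondeg_def)
  qed
  show "augmentation (bd (quotient_complex X M) x) = 0"
    if "x \<in> gens (quotient_complex X M) (Suc 0)" for x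
    using that equivariantD(1)[OF bd_equivariant, of x 0] augmentation_bd by (simp add: nondeg_gens_0)
qed (auto simp: emb_gens idx_emb idx_gens pos_closed act_emb act_gens idx_act pos_act act_act)

lemma resolution_quotient: "resolution G (quotient_complex X M)"
proof (intro resolution.intro equivariant_complex_quotient, unfold_locales)
  show "gens (quotient_complex X M) 0 \<noteq> {}"
    using x0 gens_0_nondegenerate by auto
  fix c n assume c: "c \<in> chain_cycles (quotient_complex X M) n"
  then have keys: "keys c \<subseteq> gens X n" and c_id: "nondeg X M c = c"
    by (auto simp: chain_cycles_def intro: nondeg_id)
  let ?b = "nondeg X M (frag_extend s c)"
  have sk: "keys (frag_extend s c) \<subseteq> gens X (Suc n)"
    using keys s_gens by (intro keys_frag_extend_subset) auto
  have "frag_extend (bd (quotient_complex X M)) ?b = nondeg X M (frag_extend (bd X) (frag_extend s c))"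
    by (simp only: frag_extend_bd_quotient nondeg_bd_nondeg[OF sk])
  also have "\<dots> = c"
  proof (cases n)
    case 0
    have "frag_extend (bd X) (frag_extend s c) = frag_extend (\<lambda>x. frag_of x - frag_of x0) c"
      unfolding frag_extend_frag_extend using keys 0 by (intro frag_extend_eq bd_s_0) auto
    \<comment> \<open>The base point is subtracted once for every generator, counted with its
      coefficient; the total is the augmentation, which vanishes on cycles of degree
      \<open>0\<close>.\<close>
    also have "\<dots> = c - frag_cmul (augmentation c) (frag_of x0)"
    proof (rule frag_eqI)
      fix F :: "'c \<Rightarrow> int"
      have "lin_eval (\<lambda>x. F x0) c = F x0 * lin_eval (\<lambda>x. 1) c"
        using lin_eval_fun_cmul[of "F x0" "\<lambda>x. 1" c] by simp
      then show "lin_eval F (frag_extend (\<lambda>x. frag_of x - frag_of x0) c)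
          = lin_eval F (c - frag_cmul (augmentation c) (frag_of x0))"
        by (simp add: augmentation_def lin_eval_fun_diff)
    qed
    finally show ?thesis
      using c 0 by (simp add: chain_cycles_def c_id)
  next
    case (Suc m)
    have bk: "keys (frag_extend (bd X) c) \<subseteq> gens X m"
      using keys_equivariant[OF bd_equivariant] keys Suc by blast
    have "frag_extend (bd X) (frag_extend s c) = frag_extend (\<lambda>x. frag_of x - frag_extend s (bd X x)) c"
      unfolding frag_extend_frag_extend using keys Suc by (intro frag_extend_eq bd_s_Suc) auto
    also have "\<dots> = c - frag_extend s (frag_extend (bd X) c)"
      by (simp add: frag_extend_fun_diff frag_extend_frag_extend)
    finally have "nondeg X M (frag_extend (bd X) (frag_extend s c))
        = c - nondeg X M (frag_extend s (frag_extend (bd X) c))"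
      by (simp add: nondeg_diff c_id)
    \<comment> \<open>Inserting the projection makes the boundary of the quotient appear, which is
      zero on the cycle \<open>c\<close>.\<close>
    also have "nondeg X M (frag_extend s (frag_extend (bd X) c))
        = nondeg X M (frag_extend s (nondeg X M (frag_extend (bd X) c)))"
      using bk s_degenerate by (intro nondeg_frag_extend_nondeg[symmetric]) blast
    also have "nondeg X M (frag_extend (bd X) c) = 0"
      using c Suc by (simp add: chain_cycles_def flip: frag_extend_bd_quotient)
    finally show ?thesis
      by (simp add: nondeg_def)
  qed
  finally show "\<exists>b. keys b \<subseteq> gens (quotient_complex X M) (Suc n) \<and>
      frag_extend (bd (quotient_complex X M)) b = c"
    using keys_nondeg[of X M "frag_extend s c"] sk by (intro exI[of _ ?b]) auto
qed

text \<open>The case of no degenerate indices in \<open>resolution_quotient\<close>, where the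
  quotient is the complex itself.\<close>

lemma resolution: "resolution G X"
proof -
  interpret E: contracted_complex G X "{}" s x0
    by unfold_locales (use x0 s_gens bd_s_0 bd_s_Suc in auto)
  show ?thesis
    using E.resolution_quotient by simp
qed

lemma chain_map_nondeg:
  assumes f: "chain_map G W X f"
  shows "chain_map G W (quotient_complex X M) (\<lambda>n x. nondeg X M (f n x))"
  unfolding chain_map_def
proof (intro conjI allI ballI)
  have fe: "equivariant G W X n n (f n)" for n
    using f by (simp add: chain_map_def)
  fix n
  show "equivariant G W (quotient_complex X M) n n (\<lambda>x. nondeg X M (f n x))"
    by (rule equivariant_nondeg[OF fe])
  show "frag_extend (bd (quotient_complex X M)) (nondeg X M (f (Suc n) x))
      = frag_extend (\<lambda>x. nondeg X M (f n x)) (bd W x)" if x: "x \<in> gens W (Suc n)" for x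
  proof -
    have "frag_extend (bd (quotient_complex X M)) (nondeg X M (f (Suc n) x))
        = nondeg X M (frag_extend (bd X) (f (Suc n) x))"
      by (simp only: frag_extend_bd_quotient nondeg_bd_nondeg[OF equivariantD(1)[OF fe x]])
    also have "\<dots> = nondeg X M (frag_extend (f n) (bd W x))"
      using f x by (simp add: chain_map_def)
    finally show ?thesis
      by (simp add: nondeg_def frag_extend_frag_extend)
  qed
  show "augmentation (nondeg X M (f 0 x)) = 1" if x: "x \<in> gens W 0" for x
    using f x equivariantD(1)[OF fe x] by (simp add: chain_map_def nondeg_gens_0)
qed

text \<open>At a degenerate index the left side is zero by convention, and the right side because
  the boundary of a degenerate generator is degenerate and \<open>F\<close> vanishes there.\<close>

lemma delta_quotient:
  assumes F: "F \<in> cochains (quotient_complex X M) n"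
  shows "delta (quotient_complex X M) n F = delta X n F"
proof
  fix z
  have F0: "\<And>z. z \<in> M \<Longrightarrow> F z = 0"
    using F by (simp add: cochains_def)
  have "lin_eval (\<lambda>y. F (idx X y)) (bd X (emb X z)) = 0" if "z \<in> bidx X (Suc n)" "z \<in> M"
    using bd_degenerate[OF emb_gens[OF that(1)]] that
    by (intro lin_eval_zero_on F0) (auto simp: idx_emb)
  then show "delta (quotient_complex X M) n F z = delta X n F z"
    by (auto simp: delta_def dual_def lin_eval_nondeg F0)
qed


text \<open>Exhibits the inclusion of normalized cochains as the dual of the projection onto the
  quotient, so that the comparison theorem applies to it.\<close>

lemma dual_nondeg_id:
  assumes "F \<in> cochains (quotient_complex X M) n"
  shows "dual X (quotient_complex X M) n (\<lambda>x. nondeg X M (frag_of x)) F = F"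
proof
  fix z
  have F: "\<And>z. z \<in> M \<Longrightarrow> F z = 0" "\<And>z. z \<notin> bidx X n \<Longrightarrow> F z = 0"
    using assms by (auto simp: cochains_def)
  show "dual X (quotient_complex X M) n (\<lambda>x. nondeg X M (frag_of x)) F z = F z"
    by (simp add: dual_def lin_eval_nondeg F idx_emb)
qed

lemma inclusion_cochain_map:
  "cochain_map (cochains (quotient_complex X M)) (delta (quotient_complex X M)) (cochains X) (delta X) (\<lambda>_. id)"
  by (rule cochain_map_cong[OF dual_cochain_map[OF chain_map_nondeg[OF chain_map_id]
        equivariant_complex_axioms equivariant_complex_quotient]])
    (simp_all add: dual_nondeg_id)

lemma cohomology_inclusion_iso:
  "cohomology_map (cochains X) (delta X) n id
     \<in> iso (cohomology (cochains (quotient_complex X M)) (delta (quotient_complex X M)) n)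
         (cohomology (cochains X) (delta X) n)"
proof -
  interpret N: cochain_complex "cochains (quotient_complex X M)" "delta (quotient_complex X M)"
    by (rule equivariant_complex.cochain_complex[OF equivariant_complex_quotient])
  show ?thesis
  proof (rule iso_cong_on[OF cohomology_map_dual_iso[OF resolution resolution_quotient
            chain_map_nondeg[OF chain_map_id]]])
    show "cohomology_map (cochains X) (delta X) n (dual X (quotient_complex X M) n (\<lambda>x. nondeg X M (frag_of x))) x
        = cohomology_map (cochains X) (delta X) n id x"
      if "x \<in> carrier (cohomology (cochains (quotient_complex X M)) (delta (quotient_complex X M)) n)" for x
      by (rule N.cohomology_map_cong_on[OF _ that]) (simp add: dual_nondeg_id)
  qed (rule N.cohomology_mult_closed)
qed

end

section \<open>The bar resolution\<close>

abbreviation snoc_map :: "'a \<Rightarrow> ('a list \<Rightarrow>\<^sub>0 int) \<Rightarrow> 'a list \<Rightarrow>\<^sub>0 int" where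
  "snoc_map a \<equiv> frag_map (\<lambda>w. w @ [a])"

text \<open>This shape is shared by the group action, with \<open>a\<close> an inverse, and by the
  face that merges an appended letter \<open>a\<close> into a word.\<close>

definition mult_last :: "('a, 'b) monoid_scheme \<Rightarrow> 'a \<Rightarrow> 'a list \<Rightarrow> 'a list" where
  "mult_last H a w = butlast w @ [last w \<otimes>\<^bsub>H\<^esub> a]"

text \<open>All faces but the last one. Unlike \<open>E_boundary\<close>, a word with one letter has the empty word as its face.\<close>

definition front_faces :: "('a, 'b) monoid_scheme \<Rightarrow> 'a list \<Rightarrow> 'a list \<Rightarrow>\<^sub>0 int" where
  "front_faces H w = (if w = [] then 0 else
     frag_of (tl w) + (\<Sum>i = 1..length w - 1. frag_cmul ((- 1) ^ i) (frag_of (merge H i w))))"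

lemma mult_last_snoc [simp]: "mult_last H a (w @ [b]) = w @ [b \<otimes>\<^bsub>H\<^esub> a]"
  by (simp add: mult_last_def)

lemma tuples_0: "tuples H 0 = {[]}"
  by (auto simp: tuples_def)

lemma tuples_Suc: "tuples H (Suc n) = {w @ [a] | w a. w \<in> tuples H n \<and> a \<in> carrier H}"
proof (rule Set.set_eqI)
  fix x
  show "x \<in> tuples H (Suc n) \<longleftrightarrow> x \<in> {w @ [a] | w a. w \<in> tuples H n \<and> a \<in> carrier H}"
    by (cases x rule: rev_cases) (auto simp: tuples_def)
qed

lemma tuples_SucE:
  assumes "x \<in> tuples H (Suc n)"
  obtains w a where "x = w @ [a]" "w \<in> tuples H n" "a \<in> carrier H"
  using assms by (auto simp: tuples_Suc)

lemma snoc_tuples: "w @ [a] \<in> tuples H (Suc n) \<longleftrightarrow> w \<in> tuples H n \<and> a \<in> carrier H"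
  by (auto simp: tuples_def)

lemma merge_append: "\<lbrakk>1 \<le> i; i < length w\<rbrakk> \<Longrightarrow> merge H i (w @ v) = merge H i w @ v"
  by (auto simp: merge_def nth_append)

lemma front_faces_simps [simp]:
  "front_faces H [] = 0"
  "front_faces H [a] = frag_of []"
  by (simp_all add: front_faces_def)

text \<open>Appending \<open>a\<close> creates one new face, the product of the last two letters;
  every other face leaves \<open>a\<close> untouched. The convention that \<open>[b]\<close> has the
  empty word as its face keeps this true for \<open>w = []\<close>.\<close>

lemma front_faces_snoc:
  "front_faces H (w @ [b, a]) =
     snoc_map a (front_faces H (w @ [b])) + frag_cmul ((- 1) ^ Suc (length w)) (frag_of (w @ [b \<otimes>\<^bsub>H\<^esub> a]))"
proof -
  have merge: "merge H i (w @ [b, a]) = merge H i (w @ [b]) @ [a]" if "i \<in> {1..length w}" for i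
    using merge_append[of i "w @ [b]" H "[a]"] that by simp
  have last: "merge H (Suc (length w)) (w @ [b, a]) = w @ [b \<otimes>\<^bsub>H\<^esub> a]"
    by (simp add: merge_def nth_append)
  have "(\<Sum>i = 1..length w. frag_cmul ((- 1) ^ i) (frag_of (merge H i (w @ [b, a]))))
      = (\<Sum>i = 1..length w. frag_cmul ((- 1) ^ i) (frag_of (merge H i (w @ [b]) @ [a])))"
    by (rule sum.cong) (simp_all only: merge)
  then have "(\<Sum>i = 1..Suc (length w). frag_cmul ((- 1) ^ i) (frag_of (merge H i (w @ [b, a]))))
      = (\<Sum>i = 1..length w. frag_cmul ((- 1) ^ i) (frag_of (merge H i (w @ [b]) @ [a])))
        + frag_cmul ((- 1) ^ Suc (length w)) (frag_of (w @ [b \<otimes>\<^bsub>H\<^esub> a]))"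
    by (simp add: last)
  moreover have "tl (w @ [b, a]) = tl (w @ [b]) @ [a]"
    by (cases w) auto
  ultimately show ?thesis
    by (simp add: front_faces_def frag_extend_add frag_extend_sum' frag_extend_cmul add.assoc)
qed

lemma E_boundary_single [simp]: "E_boundary H [a] = 0"
  by (simp add: E_boundary_def)

lemma E_boundary_front_faces: "1 < length w \<Longrightarrow> E_boundary H w = front_faces H w"
  by (cases w) (auto simp: E_boundary_def front_faces_def Let_def)

lemma E_boundary_snoc:
  "E_boundary H (w @ [b, a]) =
     snoc_map a (front_faces H (w @ [b])) + frag_cmul ((- 1) ^ Suc (length w)) (frag_of (w @ [b \<otimes>\<^bsub>H\<^esub> a]))"
  using E_boundary_front_faces[of "w @ [b, a]" H] front_faces_snoc[of H w b a] by simp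

text \<open>A common length gives the new faces a common sign, so that they can be collected into
  one term.\<close>

lemma front_faces_snoc_map:
  assumes "\<And>w. w \<in> keys c \<Longrightarrow> length w = Suc m"
  shows "frag_extend (front_faces H) (snoc_map a c)
    = snoc_map a (frag_extend (front_faces H) c) + frag_cmul ((- 1) ^ Suc m) (frag_map (mult_last H a) c)"
proof -
  have "front_faces H (w @ [a]) = snoc_map a (front_faces H w) + frag_cmul ((- 1) ^ Suc m) (frag_of (mult_last H a w))"
    if "w \<in> keys c" for w
    using assms[OF that] front_faces_snoc[of H "butlast w" "last w" a]
    by (cases w rule: rev_cases) auto
  then have "frag_extend (front_faces H) (snoc_map a c) = frag_extend (\<lambda>w. snoc_map a (front_faces H w)
      + frag_cmul ((- 1) ^ Suc m) (frag_of (mult_last H a w))) c"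
    unfolding frag_extend_frag_extend by (intro frag_extend_eq) simp
  then show ?thesis
    by (simp only: frag_extend_fun_add frag_extend_fun_cmul frag_extend_frag_extend)
qed

lemma keys_snoc_map:
  assumes "keys c \<subseteq> tuples H n" "a \<in> carrier H"
  shows "keys (snoc_map a c) \<subseteq> tuples H (Suc n)"
  using assms by (intro keys_frag_extend_subset) (auto simp: snoc_tuples)

section \<open>Face identities and contraction of the bar resolution\<close>

context group
begin

lemma keys_front_faces: "w \<in> tuples G (Suc n) \<Longrightarrow> keys (front_faces G w) \<subseteq> tuples G n"
proof (induction n arbitrary: w)
  case 0
  then show ?case
    by (auto simp: tuples_Suc tuples_0)
next
  case (Suc n)
  then obtain v b a where w: "w = v @ [b, a]" "v \<in> tuples G n" "b \<in> carrier G" "a \<in> carrier G"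
    by (auto elim!: tuples_SucE)
  have "keys (front_faces G (v @ [b])) \<subseteq> tuples G n"
    using w by (intro Suc.IH) (simp add: snoc_tuples)
  with w show ?case
    unfolding w(1) front_faces_snoc
    by (intro keys_add_subset keys_snoc_map keys_cmul_subset) (auto simp: snoc_tuples)
qed

lemma front_faces_mult_last:
  assumes "w \<in> tuples G (Suc (Suc n))" "a \<in> carrier G"
  shows "front_faces G (mult_last G a w) = frag_map (mult_last G a) (front_faces G w)"
proof -
  from assms(1) obtain v c b where w: "w = v @ [c, b]" "v \<in> tuples G n" "c \<in> carrier G" "b \<in> carrier G"
    by (auto elim!: tuples_SucE)
  have "mult_last G a (v @ [c, b]) = v @ [c, b \<otimes> a]"
    using mult_last_snoc[of G a "v @ [c]" b] by simp
  then show ?thesis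
    using w assms(2)
    by (simp add: front_faces_snoc frag_extend_add frag_extend_frag_extend frag_extend_cmul m_assoc)
qed

text \<open>Induction on the last letter: the faces of the new term
  \<open>u @ [b \<otimes> a]\<close> are those of \<open>u @ [b]\<close> with the last letter
  multiplied by \<open>a\<close>, and merging \<open>a\<close> into the faces of
  \<open>u @ [b]\<close> gives the same with the opposite sign.\<close>

lemma front_faces_front_faces:
  "w \<in> tuples G (Suc (Suc n)) \<Longrightarrow> frag_extend (front_faces G) (front_faces G w) = 0"
proof (induction n arbitrary: w)
  case 0
  then obtain b a where "w = [b, a]"
    by (auto simp: tuples_0 elim!: tuples_SucE)
  then show ?case
    using front_faces_snoc[of G "[]" b a] by (simp add: frag_extend_diff)
next
  case (Suc n)
  then obtain u b a where w: "w = u @ [b, a]" "u \<in> tuples G (Suc n)" "b \<in> carrier G" "a \<in> carrier G"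
    by (metis append.assoc append_Cons append_Nil tuples_SucE)
  have ub: "u @ [b] \<in> tuples G (Suc (Suc n))"
    using w by (simp add: snoc_tuples)
  have len: "length v = Suc n" if "v \<in> keys (front_faces G (u @ [b]))" for v
    using keys_front_faces[OF ub] that by (auto simp: tuples_def)
  have "front_faces G (u @ [b \<otimes> a]) = frag_map (mult_last G a) (front_faces G (u @ [b]))"
    using front_faces_mult_last[OF ub w(4)] by simp
  then show ?case
    using w(2) by (simp add: w(1) front_faces_snoc frag_extend_add frag_extend_cmul
        front_faces_snoc_map[OF len] Suc.IH[OF ub] tuples_def flip: frag_cmul_distrib)
qed

text \<open>The products of a letter \<open>1\<close> with its two neighbours (or its deletion, if
  it comes first) give the same word with opposite signs; all other faces keep the \<open>1\<close>.
  The last letter \<open>a\<close> is set apart because it does not belong to the index.\<close>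

lemma front_faces_degenerate:
  assumes "\<one> \<in> set v" "set v \<subseteq> carrier G" "a \<in> carrier G" "y \<in> keys (front_faces G (v @ [a]))"
  shows "\<one> \<in> set (butlast y)"
  using assms
proof (induction v arbitrary: a y rule: rev_induct)
  case (snoc b u)
  have sub: "keys (front_faces G (u @ [b, a])) \<subseteq> {y. \<one> \<in> set (butlast y)}"
  proof (cases "\<one> \<in> set u")
    case True
    then have "keys (front_faces G (u @ [b])) \<subseteq> {y. \<one> \<in> set (butlast y)}"
      using snoc by auto
    with True show ?thesis
      unfolding front_faces_snoc
      by (intro keys_add_subset keys_cmul_subset keys_frag_extend_subset) (auto dest: in_set_butlastD)
  next
    case False
    with snoc.prems have b: "b = \<one>"
      by simp
    show ?thesis
    proof (cases u rule: rev_cases)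
      case Nil
      then show ?thesis
        using snoc.prems front_faces_snoc[of G "[]" b a] by (simp add: b)
    next
      case (snoc t c)
      \<comment> \<open>The faces with \<open>c \<otimes> \<one>\<close> and with
        \<open>\<one> \<otimes> a\<close> are the same word and cancel.\<close>
      have "front_faces G (u @ [b, a]) = snoc_map a (snoc_map \<one> (front_faces G u))"
        using \<open>set (u @ [b]) \<subseteq> carrier G\<close> \<open>a \<in> carrier G\<close>
        by (simp add: snoc b front_faces_snoc[of G "t @ [c]" \<one> a, simplified] front_faces_snoc[of G t c \<one>]
            frag_extend_add frag_extend_cmul flip: frag_cmul_distrib)
      then show ?thesis
        by (simp only: frag_extend_frag_extend) (intro keys_frag_extend_subset, auto simp: butlast_append)
    qed
  qed
  with snoc.prems show ?case
    by auto
qed simp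

text \<open>The action multiplies the last letter on the right by an inverse, so a word is the
  translate by \<open>inv (last w)\<close> of the word ending in \<open>1\<close>.\<close>

definition bar_complex :: "('a, 'a list, 'a list) based_complex" where
  "bar_complex = \<lparr>gens = \<lambda>n. tuples G (Suc n), bidx = tuples G, emb = \<lambda>w. w @ [\<one>], idx = butlast,
     act = E_action G, pos = \<lambda>w. inv (last w), bd = E_boundary G\<rparr>"

lemma bar_complex_simps [simp]:
  "gens bar_complex n = tuples G (Suc n)"
  "bidx bar_complex = tuples G"
  "emb bar_complex w = w @ [\<one>]"
  "idx bar_complex = butlast"
  "act bar_complex = E_action G"
  "pos bar_complex w = inv (last w)"
  "bd bar_complex = E_boundary G"
  by (simp_all add: bar_complex_def)

lemma E_action_mult_last: "E_action G g = mult_last G (inv g)"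
  by (simp add: E_action_def mult_last_def fun_eq_iff)

lemma E_boundary_equivariant: "equivariant G bar_complex bar_complex (Suc n) n (E_boundary G)"
  unfolding equivariant_def
proof (intro ballI conjI)
  fix w assume "w \<in> gens bar_complex (Suc n)"
  then have w: "w \<in> tuples G (Suc (Suc n))"
    by simp
  then have ff: "E_boundary G w = front_faces G w"
    by (intro E_boundary_front_faces) (simp add: tuples_def)
  with keys_front_faces[OF w] show "keys (E_boundary G w) \<subseteq> gens bar_complex n"
    by simp
  fix g assume g: "g \<in> carrier G"
  have "E_boundary G (E_action G g w) = front_faces G (E_action G g w)"
    using w by (intro E_boundary_front_faces) (simp add: tuples_def E_action_def)
  then show "E_boundary G (act bar_complex g w) = frag_map (act bar_complex g) (E_boundary G w)"
    by (simp add: ff E_action_mult_last front_faces_mult_last[OF w] g)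
qed

lemma E_boundary_E_boundary:
  assumes "w \<in> tuples G (Suc n)"
  shows "frag_extend (E_boundary G) (E_boundary G w) = 0"
proof -
  consider "n = 0" | "n = Suc 0" | m where "n = Suc (Suc m)"
    by (metis not0_implies_Suc)
  then show ?thesis
  proof cases
    case 1
    with assms show ?thesis
      by (auto simp: tuples_Suc tuples_0)
  next
    case 2
    with assms obtain a b where "w = [a, b]"
      by (auto simp: tuples_Suc tuples_0)
    then show ?thesis
      using E_boundary_snoc[of G "[]" a b] by (simp add: frag_extend_diff)
  next
    case 3
    with assms have w: "w \<in> tuples G (Suc (Suc (Suc m)))"
      by simp
    have "E_boundary G w = front_faces G w"
      using w by (intro E_boundary_front_faces) (simp add: tuples_def)
    moreover have "frag_extend (E_boundary G) (front_faces G w) = frag_extend (front_faces G) (front_faces G w)"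
      using keys_front_faces[OF w] by (intro frag_extend_eq E_boundary_front_faces) (auto simp: tuples_def)
    ultimately show ?thesis
      by (simp add: front_faces_front_faces[OF w])
  qed
qed

lemma augmentation_E_boundary:
  assumes "w \<in> tuples G (Suc (Suc 0))"
  shows "augmentation (E_boundary G w) = 0"
proof -
  from assms obtain b a where "w = [b, a]"
    by (auto simp: tuples_0 elim!: tuples_SucE)
  then show ?thesis
    using E_boundary_snoc[of G "[]" b a] by simp
qed

lemma equivariant_bar_complex: "equivariant_complex G bar_complex"
  by unfold_locales
    (auto simp: E_boundary_equivariant E_boundary_E_boundary augmentation_E_boundary E_action_def
      snoc_tuples inv_mult_group m_assoc elim!: tuples_SucE)

text \<open>Merging the appended \<open>1\<close> into \<open>w\<close> gives the face
  \<open>w\<close> itself, with sign \<open>(- 1) ^ length w\<close>; the factor makes this sign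
  positive.\<close>

definition bar_contraction :: "'a list \<Rightarrow> 'a list \<Rightarrow>\<^sub>0 int" where
  "bar_contraction w = frag_cmul ((- 1) ^ length w) (frag_of (w @ [\<one>]))"

text \<open>The extra term in degree \<open>0\<close> arises because
  \<open>front_faces G [a]\<close> is the empty word while \<open>E_boundary G [a]\<close> is zero:
  appending \<open>1\<close> to the empty word leaves \<open>[\<one>]\<close>, the base
  point.\<close>

lemma E_boundary_bar_contraction:
  assumes "w \<in> tuples G (Suc n)"
  shows "frag_extend (E_boundary G) (bar_contraction w)
    = frag_of w - frag_extend bar_contraction (E_boundary G w) - (if n = 0 then frag_of [\<one>] else 0)"
proof -
  obtain v a where w: "w = v @ [a]" "v \<in> tuples G n" "a \<in> carrier G"
    using assms by (rule tuples_SucE)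
  have v: "length v = n"
    using w(2) by (simp add: tuples_def)
  have "frag_extend (E_boundary G) (bar_contraction w)
      = frag_of w + frag_cmul ((- 1) ^ Suc n) (snoc_map \<one> (front_faces G w))"
    using w(3) by (simp add: bar_contraction_def w(1) v frag_extend_cmul E_boundary_snoc frag_cmul_distrib2
        flip: power_mult_distrib)
  also have "frag_cmul ((- 1) ^ Suc n) (snoc_map \<one> (front_faces G w))
      = - frag_extend bar_contraction (E_boundary G w) - (if n = 0 then frag_of [\<one>] else 0)"
  proof (cases n)
    case 0
    then show ?thesis
      using w(2) by (simp add: w(1) tuples_0 bar_contraction_def frag_extend_minus)
  next
    case (Suc m)
    have "frag_extend bar_contraction (front_faces G w)
        = frag_extend (\<lambda>w. frag_cmul ((- 1) ^ n) (frag_of (w @ [\<one>]))) (front_faces G w)"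
      using keys_front_faces[OF assms]
      by (intro frag_extend_eq) (auto simp: bar_contraction_def tuples_def)
    moreover have "E_boundary G w = front_faces G w"
      using v Suc by (intro E_boundary_front_faces) (simp add: w(1))
    ultimately show ?thesis
      using Suc by (simp add: frag_extend_fun_cmul)
  qed
  finally show ?thesis
    by simp
qed

definition degenerate_words :: "'a list set" where
  "degenerate_words = {w. \<one> \<in> set w}"

lemma contracted_bar_complex: "contracted_complex G bar_complex degenerate_words bar_contraction [\<one>]"
proof (intro contracted_complex.intro equivariant_bar_complex, unfold_locales)
  fix n x y
  assume "x \<in> gens bar_complex (Suc n)" "idx bar_complex x \<in> degenerate_words"
    "y \<in> keys (bd bar_complex x)"
  then obtain v a where v: "x = v @ [a]" "v \<in> tuples G (Suc n)" "a \<in> carrier G" "\<one> \<in> set v"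
      "y \<in> keys (E_boundary G (v @ [a]))"
    by (auto simp: degenerate_words_def elim!: tuples_SucE[of x])
  then have "y \<in> keys (front_faces G (v @ [a]))"
    by (subst (asm) E_boundary_front_faces) (auto simp: tuples_def)
  with v show "idx bar_complex y \<in> degenerate_words"
    using front_faces_degenerate[of v a y] by (auto simp: degenerate_words_def tuples_def)
next
  fix n x
  assume x: "x \<in> gens bar_complex n"
  then show "keys (bar_contraction x) \<subseteq> gens bar_complex (Suc n)"
    unfolding bar_contraction_def by (intro keys_cmul_subset) (simp add: snoc_tuples)
  show "idx bar_complex y \<in> degenerate_words"
    if "idx bar_complex x \<in> degenerate_words" "y \<in> keys (bar_contraction x)" for y
    using that by (auto simp: bar_contraction_def degenerate_words_def dest: in_set_butlastD)
next
  show "frag_extend (bd bar_complex) (bar_contraction x) = frag_of x - frag_of [\<one>]"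
    if "x \<in> gens bar_complex 0" for x
    using E_boundary_bar_contraction[of x 0] that by (auto simp: tuples_Suc tuples_0)
  show "frag_extend (bd bar_complex) (bar_contraction x) = frag_of x - frag_extend bar_contraction (bd bar_complex x)"
    if "x \<in> gens bar_complex (Suc n)" for n x
    using E_boundary_bar_contraction[of x "Suc n"] that by simp
qed (auto simp: degenerate_words_def tuples_Suc tuples_0)

text \<open>In the basis element \<open>w @ [\<one>]\<close> the last face multiplies the final
  letter of \<open>w\<close> by \<open>1\<close>; taking the index deletes this letter, which gives
  the summand with \<open>butlast\<close>.\<close>

lemma bar_delta_eq_delta: "bar_delta G n F = delta bar_complex n F"
proof
  fix w
  show "bar_delta G n F w = delta bar_complex n F w"
  proof (cases "w \<in> tuples G (Suc n)")
    case True
    then obtain v a where w: "w = v @ [a]" "v \<in> tuples G n" "a \<in> carrier G"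
      by (rule tuples_SucE)
    have "lin_eval F (front_faces G w) = F (tl w) + (\<Sum>i = 1..n. (- 1) ^ i * F (merge G i w))"
      using w by (simp add: front_faces_def tuples_def)
    with True w show ?thesis
      by (simp add: bar_delta_def delta_def dual_def E_boundary_snoc tuples_def butlast_append)
  qed (simp add: bar_delta_def delta_def dual_def)
qed

lemma bar_cochains_eq: "bar_cochains G n = cochains (quotient_complex bar_complex degenerate_words) n"
  by (auto simp: bar_cochains_def cochains_def degenerate_words_def)

end

section \<open>Functoriality of the faces and pullback of cochains\<close>

lemma merge_map:
  assumes "f \<in> hom H H'" "set w \<subseteq> carrier H" "1 \<le> i" "i < length w"
  shows "merge H' i (map f w) = map f (merge H i w)"
proof -
  have "w ! (i - 1) \<in> carrier H" "w ! i \<in> carrier H"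
    using assms by auto
  then show ?thesis
    using assms by (simp add: merge_def take_map drop_map hom_mult[OF assms(1)])
qed

lemma front_faces_map:
  assumes "f \<in> hom H H'" "set w \<subseteq> carrier H"
  shows "front_faces H' (map f w) = frag_map (map f) (front_faces H w)"
proof -
  have "(\<Sum>i = 1..length w - 1. frag_cmul ((- 1) ^ i) (frag_of (merge H' i (map f w))))
      = (\<Sum>i = 1..length w - 1. frag_cmul ((- 1) ^ i) (frag_of (map f (merge H i w))))"
    using assms by (intro sum.cong refl) (auto simp: merge_map)
  then show ?thesis
    by (simp add: front_faces_def frag_extend_add frag_extend_sum' frag_extend_cmul map_tl)
qed

lemma E_boundary_map:
  assumes "f \<in> hom H H'" "w \<in> tuples H (Suc n)"
  shows "E_boundary H' (map f w) = frag_map (map f) (E_boundary H w)"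
proof (cases n)
  case 0
  with assms(2) obtain a where "w = [a]"
    by (auto simp: tuples_Suc tuples_0)
  then show ?thesis
    by simp
next
  case (Suc m)
  with assms show ?thesis
    by (simp add: E_boundary_front_faces tuples_def front_faces_map)
qed

lemma bar_delta_front_faces:
  assumes "w \<in> tuples H (Suc n)"
  shows "bar_delta H n F w = lin_eval F (front_faces H w) + (- 1) ^ Suc n * F (butlast w)"
  using assms by (auto simp: bar_delta_def front_faces_def tuples_def)

lemma bar_delta_pullback:
  assumes H: "group H" and f: "f \<in> hom H K"
  shows "bar_delta H n (pullback H f n F) = pullback H f (Suc n) (bar_delta K n F)"
proof
  fix w
  interpret H: group H by fact
  show "bar_delta H n (pullback H f n F) w = pullback H f (Suc n) (bar_delta K n F) w"
  proof (cases "w \<in> tuples H (Suc n)")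
    case True
    have fw: "map f w \<in> tuples K (Suc n)"
      using True hom_in_carrier[OF f] by (auto simp: tuples_def)
    have "butlast w \<in> tuples H n"
      using True by (auto simp: tuples_def dest: in_set_butlastD)
    moreover have "lin_eval (pullback H f n F) (front_faces H w) = lin_eval (\<lambda>v. F (map f v)) (front_faces H w)"
      using H.keys_front_faces[OF True] by (intro lin_eval_cong) (auto simp: pullback_def)
    moreover have "front_faces K (map f w) = frag_map (map f) (front_faces H w)"
      using True by (intro front_faces_map[OF f]) (simp add: tuples_def)
    ultimately show ?thesis
      using True fw by (simp add: bar_delta_front_faces pullback_def map_butlast)
  qed (simp add: bar_delta_def pullback_def)
qed

section \<open>The tensor product resolution\<close>

lemma carrier_conj_semidirect [simp]: "carrier (conj_semidirect K) = carrier K \<times> carrier K"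
  by (simp add: conj_semidirect_def)

lemma mult_conj_semidirect [simp]:
  "(a, g) \<otimes>\<^bsub>conj_semidirect K\<^esub> (b, h) = (a \<otimes>\<^bsub>K\<^esub> conj_by K g b, g \<otimes>\<^bsub>K\<^esub> h)"
  by (simp add: conj_semidirect_def)

lemma one_conj_semidirect [simp]: "\<one>\<^bsub>conj_semidirect K\<^esub> = (\<one>\<^bsub>K\<^esub>, \<one>\<^bsub>K\<^esub>)"
  by (simp add: conj_semidirect_def)

text \<open>The tensor product of two chains, expanded into pairs of generators.\<close>

definition cross :: "('x \<Rightarrow>\<^sub>0 int) \<Rightarrow> ('y \<Rightarrow>\<^sub>0 int) \<Rightarrow> 'x \<times> 'y \<Rightarrow>\<^sub>0 int" where
  "cross c d = frag_extend (\<lambda>x. frag_extend (\<lambda>y. frag_of (x, y)) d) c"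

lemma lin_eval_cross: "lin_eval F (cross c d) = lin_eval (\<lambda>x. lin_eval (\<lambda>y. F (x, y)) d) c"
  by (simp add: cross_def)

lemma cross_simps [simp]:
  "cross (frag_of x) (frag_of y) = frag_of (x, y)"
  "cross 0 d = 0"
  "cross c 0 = 0"
  "cross (- c) d = - cross c d"
  "cross c (- d) = - cross c d"
  "cross (frag_cmul k c) d = frag_cmul k (cross c d)"
  "cross c (frag_cmul k d) = frag_cmul k (cross c d)"
  by (auto simp: lin_eval_cross lin_eval_fun_cmul lin_eval_fun_minus intro!: frag_eqI)

lemma cross_add_left: "cross (c + c') d = cross c d + cross c' d"
  and cross_add_right: "cross c (d + d') = cross c d + cross c d'"
  and cross_diff_left: "cross (c - c') d = cross c d - cross c' d"
  and cross_diff_right: "cross c (d - d') = cross c d - cross c d'"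
  by (auto simp: lin_eval_cross lin_eval_fun_add lin_eval_fun_diff intro!: frag_eqI)

lemma keys_cross:
  assumes "keys c \<subseteq> A" "keys d \<subseteq> B"
  shows "keys (cross c d) \<subseteq> A \<times> B"
  unfolding cross_def using assms by (intro keys_frag_extend_subset) auto

lemma frag_extend_cross:
  "frag_extend f (cross c d) = frag_extend (\<lambda>x. frag_extend (\<lambda>y. f (x, y)) d) c"
  by (simp add: cross_def frag_extend_frag_extend)

lemma augmentation_cross: "augmentation (cross c d) = augmentation c * augmentation d"
  unfolding cross_def by (subst augmentation_frag_extend[where k = "augmentation d"])
    (auto simp: augmentation_frag_extend[where k = 1])

lemma cross_frag_map: "cross (frag_map f c) (frag_map g d) = frag_map (\<lambda>(x, y). (f x, g y)) (cross c d)"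
  by (simp add: cross_def frag_extend_frag_extend)

lemma cross_frag_of_right: "cross c (frag_of y) = frag_map (\<lambda>x. (x, y)) c"
  and cross_frag_of_left: "cross (frag_of x) d = frag_map (\<lambda>y. (x, y)) d"
  by (simp_all add: cross_def)

lemma tensor_boundary_cross:
  "tensor_boundary K (gs, ks) = cross (E_boundary K gs) (frag_of ks)
     + frag_cmul ((- 1) ^ (length gs - 1)) (cross (frag_of gs) (E_boundary K ks))"
  by (simp add: tensor_boundary_def cross_def)

text \<open>The Leibniz rule; homogeneity of \<open>c\<close> is what gives a single sign.\<close>

lemma frag_extend_tensor_boundary_cross:
  assumes "\<And>w. w \<in> keys c \<Longrightarrow> length w = Suc p"
  shows "frag_extend (tensor_boundary K) (cross c d) = cross (frag_extend (E_boundary K) c) d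
     + frag_cmul ((- 1) ^ p) (cross c (frag_extend (E_boundary K) d))"
proof -
  have "frag_extend (tensor_boundary K) (cross c d)
      = frag_extend (\<lambda>x. frag_extend (\<lambda>y. cross (E_boundary K x) (frag_of y)
          + frag_cmul ((- 1) ^ p) (cross (frag_of x) (E_boundary K y))) d) c"
    unfolding frag_extend_cross
    by (rule frag_extend_eq) (simp add: tensor_boundary_cross assms)
  also have "\<dots> = frag_extend (\<lambda>x. frag_extend (\<lambda>y. cross (E_boundary K x) (frag_of y)) d) c
      + frag_cmul ((- 1) ^ p) (frag_extend (\<lambda>x. frag_extend (\<lambda>y. cross (frag_of x) (E_boundary K y)) d) c)"
    by (simp add: frag_extend_fun_add frag_extend_fun_cmul)
  \<comment> \<open>After evaluation the two sides are double sums that differ in the order of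
    summation.\<close>
  also have "frag_extend (\<lambda>x. frag_extend (\<lambda>y. cross (E_boundary K x) (frag_of y)) d) c
      = cross (frag_extend (E_boundary K) c) d"
    by (rule frag_eqI) (simp add: lin_eval_cross, simp add: lin_eval_def sum_distrib_left,
        simp add: sum.swap[of _ "keys d"] mult.left_commute)
  also have "frag_extend (\<lambda>x. frag_extend (\<lambda>y. cross (frag_of x) (E_boundary K y)) d) c
      = cross c (frag_extend (E_boundary K) d)"
    by (rule frag_eqI) (simp add: lin_eval_cross)
  finally show ?thesis .
qed

lemma tensor_action_E_action:
  "ks \<noteq> [] \<Longrightarrow> tensor_action K (k, g) (gs, ks) = (E_action K g gs, E_action K k (map (conj_by K g) ks))"
  by (simp add: tensor_action_def E_action_def map_butlast last_map)

section \<open>Conjugation, the group \<open>K \<rtimes> K\<close> and the based tensor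
  complex\<close>

context group
begin

lemma conj_by_closed [simp, intro]: "\<lbrakk>g \<in> carrier G; k \<in> carrier G\<rbrakk> \<Longrightarrow> conj_by G g k \<in> carrier G"
  by (simp add: conj_by_def)

lemma conj_by_one [simp]: "k \<in> carrier G \<Longrightarrow> conj_by G \<one> k = k"
  by (simp add: conj_by_def)

lemma inv_mult_cancel [simp]:
  "\<lbrakk>g \<in> carrier G; x \<in> carrier G\<rbrakk> \<Longrightarrow> inv g \<otimes> (g \<otimes> x) = x"
  "\<lbrakk>g \<in> carrier G; x \<in> carrier G\<rbrakk> \<Longrightarrow> g \<otimes> (inv g \<otimes> x) = x"
  by (simp_all flip: m_assoc)

lemma conj_by_conj_by:
  "\<lbrakk>g \<in> carrier G; h \<in> carrier G; k \<in> carrier G\<rbrakk> \<Longrightarrow> conj_by G g (conj_by G h k) = conj_by G (g \<otimes> h) k"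
  by (simp add: conj_by_def inv_mult_group m_assoc)

lemma conj_by_eq_one [simp]:
  assumes "g \<in> carrier G" "k \<in> carrier G"
  shows "conj_by G g k = \<one> \<longleftrightarrow> k = \<one>"
proof
  assume "conj_by G g k = \<one>"
  then have "conj_by G (inv g) (conj_by G g k) = conj_by G (inv g) \<one>"
    by simp
  with assms show "k = \<one>"
    by (simp add: conj_by_conj_by) (simp add: conj_by_def)
qed (simp add: conj_by_def assms)

lemma conj_by_hom: "g \<in> carrier G \<Longrightarrow> conj_by G g \<in> hom G G"
  by (rule homI) (simp_all add: conj_by_def m_assoc)

lemma conj_by_mult:
  "\<lbrakk>g \<in> carrier G; h \<in> carrier G; k \<in> carrier G\<rbrakk> \<Longrightarrow>
     conj_by G g (h \<otimes> k) = conj_by G g h \<otimes> conj_by G g k"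
  using hom_mult[OF conj_by_hom] by blast

lemma conj_by_inv:
  "\<lbrakk>g \<in> carrier G; k \<in> carrier G\<rbrakk> \<Longrightarrow> conj_by G g (inv k) = inv (conj_by G g k)"
  by (simp add: conj_by_def inv_mult_group m_assoc)

lemma map_conj_by_one [simp]: "set ks \<subseteq> carrier G \<Longrightarrow> map (conj_by G \<one>) ks = ks"
  by (intro map_idI) auto

lemma map_conj_by_conj_by:
  "\<lbrakk>set ks \<subseteq> carrier G; g \<in> carrier G; h \<in> carrier G\<rbrakk> \<Longrightarrow>
     map (conj_by G g) (map (conj_by G h) ks) = map (conj_by G (g \<otimes> h)) ks"
  by (auto simp: conj_by_conj_by)

lemma map_conj_by_tuples:
  "\<lbrakk>ks \<in> tuples G n; g \<in> carrier G\<rbrakk> \<Longrightarrow> map (conj_by G g) ks \<in> tuples G n"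
  by (auto simp: tuples_def)

lemma group_conj_semidirect: "group (conj_semidirect G)"
proof (rule groupI)
  fix x assume "x \<in> carrier (conj_semidirect G)"
  then show "\<exists>y\<in>carrier (conj_semidirect G). y \<otimes>\<^bsub>conj_semidirect G\<^esub> x = \<one>\<^bsub>conj_semidirect G\<^esub>"
    by (intro bexI[of _ "(conj_by G (inv (snd x)) (inv (fst x)), inv (snd x))"])
      (auto simp flip: conj_by_mult)
qed (auto simp: m_assoc conj_by_mult conj_by_conj_by)

lemma mu_hom: "mu G \<in> hom (conj_semidirect G) G"
  by (rule homI) (auto simp: mu_def conj_by_def m_assoc)

text \<open>Translating so that the last letter \<open>g\<close> of \<open>gs\<close> becomes
  \<open>1\<close> conjugates the other word by \<open>g\<close>; hence the conjugation in
  \<open>idx\<close>, which in turn is the source of the conjugation in the last summand of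
  \<open>delta_G\<close>.\<close>

definition tensor_complex :: "('a \<times> 'a, 'a list \<times> 'a list, 'a list \<times> 'a list) based_complex" where
  "tensor_complex = \<lparr>gens = \<lambda>n. \<Union>p\<le>n. tuples G (p + 1) \<times> tuples G (n - p + 1),
     bidx = bituples G, emb = \<lambda>(gs, ks). (gs @ [\<one>], ks @ [\<one>]),
     idx = \<lambda>(gs, ks). (butlast gs, map (conj_by G (last gs)) (butlast ks)),
     act = tensor_action G, pos = \<lambda>(gs, ks). (inv (last ks), inv (last gs)), bd = tensor_boundary G\<rparr>"

lemma tensor_complex_simps [simp]:
  "gens tensor_complex n = (\<Union>p\<le>n. tuples G (p + 1) \<times> tuples G (n - p + 1))"
  "bidx tensor_complex = bituples G"
  "emb tensor_complex (gs, ks) = (gs @ [\<one>], ks @ [\<one>])"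
  "idx tensor_complex (gs, ks) = (butlast gs, map (conj_by G (last gs)) (butlast ks))"
  "act tensor_complex = tensor_action G"
  "pos tensor_complex (gs, ks) = (inv (last ks), inv (last gs))"
  "bd tensor_complex = tensor_boundary G"
  by (simp_all add: tensor_complex_def)

lemma bituples_iff:
  "(gs, ks) \<in> bituples G n \<longleftrightarrow> length gs + length ks = n \<and> set gs \<subseteq> carrier G \<and> set ks \<subseteq> carrier G"
  by (auto simp: bituples_def tuples_def)

lemma tensor_gens_iff:
  "(gs, ks) \<in> gens tensor_complex n \<longleftrightarrow>
     (\<exists>p q. p + q = n \<and> gs \<in> tuples G (Suc p) \<and> ks \<in> tuples G (Suc q))"
  by (auto simp: le_iff_add) (metis le_add1 add_diff_cancel_left')+

lemma tensor_gensE: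
  assumes "x \<in> gens tensor_complex n"
  obtains gs ks g k where "x = (gs @ [g], ks @ [k])" "(gs, ks) \<in> bituples G n" "g \<in> carrier G" "k \<in> carrier G"
proof -
  obtain as bs where x: "x = (as, bs)"
    by fastforce
  with assms obtain p q where pq: "p + q = n" "as \<in> tuples G (Suc p)" "bs \<in> tuples G (Suc q)"
    unfolding x tensor_gens_iff by blast
  obtain gs g ks k where "as = gs @ [g]" "gs \<in> tuples G p" "g \<in> carrier G"
      "bs = ks @ [k]" "ks \<in> tuples G q" "k \<in> carrier G"
    using pq by (auto elim!: tuples_SucE)
  then show ?thesis
    by (intro that[of gs g ks k]) (use pq(1) in \<open>auto simp: x bituples_iff tuples_def\<close>)
qed

lemma snoc_tensor_gens:
  "(gs @ [g], ks @ [k]) \<in> gens tensor_complex n \<longleftrightarrow>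
     (gs, ks) \<in> bituples G n \<and> g \<in> carrier G \<and> k \<in> carrier G"
  unfolding tensor_gens_iff bituples_iff by (auto simp: snoc_tuples tuples_def)

lemma keys_E_boundary:
  assumes "w \<in> tuples G (Suc n)"
  shows "keys (E_boundary G w) \<subseteq> tuples G n"
proof (cases n)
  case 0
  with assms show ?thesis
    by (auto simp: tuples_Suc tuples_0)
next
  case (Suc m)
  with assms show ?thesis
    using equivariantD(1)[OF E_boundary_equivariant, of w m] by simp
qed

lemma keys_tensor_boundary:
  assumes "gs \<in> tuples G (Suc p)" "ks \<in> tuples G (Suc q)"
  shows "keys (tensor_boundary G (gs, ks))
    \<subseteq> tuples G p \<times> tuples G (Suc q) \<union> tuples G (Suc p) \<times> tuples G q"
proof -
  have "keys (cross (E_boundary G gs) (frag_of ks)) \<subseteq> tuples G p \<times> tuples G (Suc q)"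
    by (intro keys_cross keys_E_boundary assms) (simp add: assms)
  moreover have "keys (cross (frag_of gs) (E_boundary G ks)) \<subseteq> tuples G (Suc p) \<times> tuples G q"
    by (intro keys_cross keys_E_boundary assms) (simp add: assms)
  ultimately show ?thesis
    unfolding tensor_boundary_cross by (intro keys_add_subset keys_cmul_subset) auto
qed

text \<open>Words of one letter have boundary zero and not the empty word, so every term of the
  boundary is again a pair of nonempty words and has a definite bidegree.\<close>

lemma tensor_boundary_nonempty:
  assumes "x \<in> gens tensor_complex n" "(gs, ks) \<in> keys (tensor_boundary G x)"
  shows "gs \<noteq> []" "ks \<noteq> []"
proof -
  have ne: "w' \<noteq> []" if "w' \<in> keys (E_boundary G w)" "w \<in> tuples G (Suc m)" for w w' m
    using keys_E_boundary[OF that(2)] that by (cases m) (auto simp: tuples_Suc tuples_0)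
  obtain as bs where x: "x = (as, bs)"
    by fastforce
  with assms obtain p q where pq: "as \<in> tuples G (Suc p)" "bs \<in> tuples G (Suc q)"
    unfolding x tensor_gens_iff by blast
  have "keys (E_boundary G as) \<subseteq> - {[]}" "keys (frag_of as) \<subseteq> - {[]}"
      "keys (E_boundary G bs) \<subseteq> - {[]}" "keys (frag_of bs) \<subseteq> - {[]}"
    using ne[OF _ pq(1)] ne[OF _ pq(2)] pq by (auto simp: tuples_def)
  then have *: "keys (tensor_boundary G (as, bs)) \<subseteq> (- {[]}) \<times> (- {[]})"
    unfolding tensor_boundary_cross by (intro keys_add_subset keys_cmul_subset keys_cross)
  show "gs \<noteq> []" "ks \<noteq> []"
    using assms(2) * unfolding x by blast+
qed

lemma keys_tensor_boundary_gens:
  assumes "x \<in> gens tensor_complex (Suc n)"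
  shows "keys (tensor_boundary G x) \<subseteq> gens tensor_complex n"
proof
  fix y assume y: "y \<in> keys (tensor_boundary G x)"
  obtain gs ks where yy: "y = (gs, ks)"
    by fastforce
  obtain as bs where x: "x = (as, bs)"
    by fastforce
  with assms obtain p q where pq: "p + q = Suc n" "as \<in> tuples G (Suc p)" "bs \<in> tuples G (Suc q)"
    unfolding x tensor_gens_iff by blast
  have ne: "gs \<noteq> []" "ks \<noteq> []"
    using tensor_boundary_nonempty[OF assms] y yy by auto
  have "(gs, ks) \<in> tuples G p \<times> tuples G (Suc q) \<union> tuples G (Suc p) \<times> tuples G q"
    using keys_tensor_boundary[OF pq(2,3)] y unfolding x yy by blast
  then show "y \<in> gens tensor_complex n"
  proof
    assume *: "(gs, ks) \<in> tuples G p \<times> tuples G (Suc q)"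
    with ne obtain p' where "p = Suc p'"
      by (cases p) (auto simp: tuples_0)
    with * pq(1) show ?thesis
      unfolding yy tensor_gens_iff by (intro exI[of _ p'] exI[of _ q]) simp
  next
    assume *: "(gs, ks) \<in> tuples G (Suc p) \<times> tuples G q"
    with ne obtain q' where "q = Suc q'"
      by (cases q) (auto simp: tuples_0)
    with * pq(1) show ?thesis
      unfolding yy tensor_gens_iff by (intro exI[of _ p] exI[of _ q']) simp
  qed
qed

lemma E_boundary_E_action:
  assumes "w \<in> tuples G (Suc n)" "g \<in> carrier G"
  shows "E_boundary G (E_action G g w) = frag_map (E_action G g) (E_boundary G w)"
proof (cases n)
  case 0
  with assms obtain a where "w = [a]"
    by (auto simp: tuples_Suc tuples_0)
  then show ?thesis
    by (simp add: E_action_def)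
next
  case (Suc m)
  with assms show ?thesis
    using equivariantD(2)[OF E_boundary_equivariant, of w m g] by simp
qed

lemma tensor_boundary_equivariant:
  "equivariant (conj_semidirect G) tensor_complex tensor_complex (Suc n) n (tensor_boundary G)"
  unfolding equivariant_def
proof (intro ballI conjI)
  fix x assume x: "x \<in> gens tensor_complex (Suc n)"
  show "keys (tensor_boundary G x) \<subseteq> gens tensor_complex n"
    by (rule keys_tensor_boundary_gens[OF x])
  fix \<gamma> assume "\<gamma> \<in> carrier (conj_semidirect G)"
  then obtain k g where \<gamma>: "\<gamma> = (k, g)" "k \<in> carrier G" "g \<in> carrier G"
    by auto
  obtain gs ks where xx: "x = (gs, ks)"
    by fastforce
  with x obtain p q where pq: "gs \<in> tuples G (Suc p)" "ks \<in> tuples G (Suc q)"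
    unfolding xx tensor_gens_iff by blast
  let ?K = "\<lambda>ks. E_action G k (map (conj_by G g) ks)"
  have Kks: "E_boundary G (?K ks) = frag_map ?K (E_boundary G ks)"
    using E_boundary_E_action[OF map_conj_by_tuples[OF pq(2) \<gamma>(3)] \<gamma>(2)]
      E_boundary_map[OF conj_by_hom[OF \<gamma>(3)] pq(2)] by (simp add: frag_extend_frag_extend)
  have len: "length (E_action G g gs) = length gs"
    using pq(1) by (simp add: E_action_def tuples_def)
  have "tensor_boundary G (tensor_action G \<gamma> x) = tensor_boundary G (E_action G g gs, ?K ks)"
    using pq(2) tensor_action_E_action[of ks G k g gs] by (force simp: xx \<gamma>(1) tuples_def)
  also have "\<dots> = cross (frag_map (E_action G g) (E_boundary G gs)) (frag_map ?K (frag_of ks))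
      + frag_cmul ((- 1) ^ (length gs - 1)) (cross (frag_map (E_action G g) (frag_of gs)) (frag_map ?K (E_boundary G ks)))"
    by (simp add: tensor_boundary_cross Kks E_boundary_E_action[OF pq(1) \<gamma>(3)] len)
  also have "\<dots> = frag_map (\<lambda>(gs, ks). (E_action G g gs, ?K ks)) (tensor_boundary G x)"
    unfolding cross_frag_map xx tensor_boundary_cross frag_extend_add frag_extend_cmul ..
  \<comment> \<open>The action splits into the two factors only for pairs whose second word is
    nonempty.\<close>
  also have "\<dots> = frag_map (tensor_action G \<gamma>) (tensor_boundary G x)"
    using tensor_boundary_nonempty[OF x]
    by (intro frag_extend_eq) (auto simp: \<gamma>(1) tensor_action_E_action)
  finally show "tensor_boundary G (act tensor_complex \<gamma> x) = frag_map (act tensor_complex \<gamma>) (tensor_boundary G x)"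
    by simp
qed

lemma length_keys_E_boundary:
  "\<lbrakk>w \<in> tuples G (Suc n); v \<in> keys (E_boundary G w)\<rbrakk> \<Longrightarrow> length v = n"
  using keys_E_boundary[of w n] by (auto simp: tuples_def)

text \<open>The two mixed terms cancel, because lowering the first degree reverses the sign in the
  Leibniz rule.\<close>

lemma tensor_boundary_tensor_boundary:
  assumes "x \<in> gens tensor_complex n"
  shows "frag_extend (tensor_boundary G) (tensor_boundary G x) = 0"
proof -
  obtain gs ks where xx: "x = (gs, ks)"
    by fastforce
  with assms obtain p q where pq: "gs \<in> tuples G (Suc p)" "ks \<in> tuples G (Suc q)"
    unfolding xx tensor_gens_iff by blast
  have lg: "length gs = Suc p"
    using pq by (simp add: tuples_def)
  note EE = E_boundary_E_boundary[OF pq(1)] E_boundary_E_boundary[OF pq(2)]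
  have "frag_extend (tensor_boundary G) (cross (E_boundary G gs) (frag_of ks))
      = - frag_cmul ((- 1) ^ p) (cross (E_boundary G gs) (E_boundary G ks))"
  proof (cases p)
    case 0
    with pq(1) show ?thesis
      by (auto simp: tuples_Suc tuples_0)
  next
    case (Suc p')
    have "frag_extend (tensor_boundary G) (cross (E_boundary G gs) (frag_of ks))
        = cross (frag_extend (E_boundary G) (E_boundary G gs)) (frag_of ks)
          + frag_cmul ((- 1) ^ p') (cross (E_boundary G gs) (frag_extend (E_boundary G) (frag_of ks)))"
      by (rule frag_extend_tensor_boundary_cross) (use length_keys_E_boundary[OF pq(1)] Suc in simp)
    then show ?thesis
      by (simp add: EE Suc)
  qed
  moreover have "frag_extend (tensor_boundary G) (cross (frag_of gs) (E_boundary G ks))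
      = cross (E_boundary G gs) (E_boundary G ks)"
    by (subst frag_extend_tensor_boundary_cross[where p = p]) (simp_all add: EE lg)
  ultimately show ?thesis
    by (simp add: xx tensor_boundary_cross frag_extend_add frag_extend_cmul lg del: minus_frag_cmul)
qed

lemma augmentation_tensor_boundary:
  assumes "x \<in> gens tensor_complex (Suc 0)"
  shows "augmentation (tensor_boundary G x) = 0"
proof -
  obtain gs ks where xx: "x = (gs, ks)"
    by fastforce
  with assms obtain p q where pq: "p + q = Suc 0" "gs \<in> tuples G (Suc p)" "ks \<in> tuples G (Suc q)"
    unfolding xx tensor_gens_iff by blast
  have "augmentation (E_boundary G w) = 0" if "w \<in> tuples G (Suc r)" "r \<le> Suc 0" for w r
    using that augmentation_E_boundary[of w] by (cases r) (auto simp: tuples_0 tuples_Suc[of _ 0])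
  with pq have "augmentation (E_boundary G gs) = 0" "augmentation (E_boundary G ks) = 0"
    by (metis le_add1 le_add2)+
  then show ?thesis
    by (simp add: xx tensor_boundary_cross augmentation_cross)
qed

lemma inv_conj_semidirect:
  "\<lbrakk>k \<in> carrier G; g \<in> carrier G\<rbrakk> \<Longrightarrow>
     inv\<^bsub>conj_semidirect G\<^esub> (k, g) = (conj_by G (inv g) (inv k), inv g)"
  by (rule group.inv_equality[OF group_conj_semidirect]) (auto simp flip: conj_by_mult)

lemma equivariant_tensor_complex: "equivariant_complex (conj_semidirect G) tensor_complex"
proof (intro equivariant_complex.intro group_conj_semidirect, unfold_locales)
  fix n z assume z: "z \<in> bidx tensor_complex n"
  obtain gs ks where zz: "z = (gs, ks)"
    by fastforce
  show "emb tensor_complex z \<in> gens tensor_complex n"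
    using z unfolding zz tensor_complex_simps(3) snoc_tensor_gens by simp
  show "idx tensor_complex (emb tensor_complex z) = z"
    using z by (simp add: zz bituples_iff)
next
  fix n x assume "x \<in> gens tensor_complex n"
  then obtain gs ks g k where x: "x = (gs @ [g], ks @ [k])" and z: "(gs, ks) \<in> bituples G n"
    and gk: "g \<in> carrier G" "k \<in> carrier G"
    by (rule tensor_gensE)
  have ks: "set ks \<subseteq> carrier G"
    using z by (simp add: bituples_iff)
  show "idx tensor_complex x \<in> bidx tensor_complex n"
    using z gk by (auto simp: x bituples_iff)
  show "pos tensor_complex x \<in> carrier (conj_semidirect G)"
    using gk by (simp add: x)
  show "act tensor_complex (pos tensor_complex x) (emb tensor_complex (idx tensor_complex x)) = x"
    using gk ks by (simp add: x tensor_action_def map_conj_by_conj_by del: map_map)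
  fix \<gamma> assume "\<gamma> \<in> carrier (conj_semidirect G)"
  then obtain l h where \<gamma>: "\<gamma> = (l, h)" "l \<in> carrier G" "h \<in> carrier G"
    by auto
  have ax: "act tensor_complex \<gamma> x = (gs @ [g \<otimes> inv h], map (conj_by G h) ks @ [conj_by G h k \<otimes> inv l])"
    by (simp add: x \<gamma>(1) tensor_action_def)
  show "act tensor_complex \<gamma> x \<in> gens tensor_complex n"
    unfolding ax snoc_tensor_gens using z gk \<gamma> by (auto simp: bituples_iff)
  show "idx tensor_complex (act tensor_complex \<gamma> x) = idx tensor_complex x"
    unfolding ax using gk \<gamma> ks by (simp add: x map_conj_by_conj_by m_assoc del: map_map)
  show "pos tensor_complex (act tensor_complex \<gamma> x) = \<gamma> \<otimes>\<^bsub>conj_semidirect G\<^esub> pos tensor_complex x"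
    unfolding ax using gk \<gamma> by (simp add: x inv_mult_group conj_by_inv)
  fix \<gamma>' assume "\<gamma>' \<in> carrier (conj_semidirect G)"
  then obtain l' h' where \<gamma>': "\<gamma>' = (l', h')" "l' \<in> carrier G" "h' \<in> carrier G"
    by auto
  show "act tensor_complex \<gamma>' (act tensor_complex \<gamma> x) = act tensor_complex (\<gamma>' \<otimes>\<^bsub>conj_semidirect G\<^esub> \<gamma>) x"
    unfolding ax using gk \<gamma> \<gamma>' ks
    by (simp add: x tensor_action_def map_conj_by_conj_by conj_by_conj_by conj_by_mult conj_by_inv
        inv_mult_group m_assoc del: map_map)
next
  show "equivariant (conj_semidirect G) tensor_complex tensor_complex (Suc n) n (bd tensor_complex)" for n
    by (simp add: tensor_boundary_equivariant del: tensor_complex_simps(1))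
  show "frag_extend (bd tensor_complex) (bd tensor_complex x) = 0"
    if "x \<in> gens tensor_complex (Suc (Suc n))" for n x
    using tensor_boundary_tensor_boundary[OF that] by simp
  show "augmentation (bd tensor_complex x) = 0" if "x \<in> gens tensor_complex (Suc 0)" for x
    using augmentation_tensor_boundary[OF that] by simp
qed

text \<open>The usual contraction \<open>s \<otimes> 1 + \<eta>\<epsilon> \<otimes> s\<close> of a
  tensor product. Here \<open>\<eta>\<epsilon>\<close> is the projection onto the base point, which
  sends words of one letter to \<open>[\<one>]\<close> and longer words to zero.\<close>

definition tensor_contraction :: "'a list \<times> 'a list \<Rightarrow> 'a list \<times> 'a list \<Rightarrow>\<^sub>0 int" where
  "tensor_contraction = (\<lambda>(gs, ks). cross (bar_contraction gs) (frag_of ks)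
     + (if length gs = 1 then cross (frag_of [\<one>]) (bar_contraction ks) else 0))"

definition degenerate_pairs :: "('a list \<times> 'a list) set" where
  "degenerate_pairs = {(gs, ks). \<one> \<in> set gs \<union> set ks}"

text \<open>Extended to chains of degree \<open>0\<close>, the projection onto the base point
  multiplies by the augmentation.\<close>

lemma frag_extend_tensor_contraction_cross:
  assumes "\<And>w. w \<in> keys c \<Longrightarrow> length w = Suc p"
  shows "frag_extend tensor_contraction (cross c d) = cross (frag_extend bar_contraction c) d
     + (if p = 0 then frag_cmul (augmentation c) (cross (frag_of [\<one>]) (frag_extend bar_contraction d)) else 0)"
proof -
  let ?e = "if p = 0 then 1 else 0 :: int"
  have "frag_extend tensor_contraction (cross c d)
      = frag_extend (\<lambda>x. frag_extend (\<lambda>y. cross (bar_contraction x) (frag_of y)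
          + frag_cmul ?e (cross (frag_of [\<one>]) (bar_contraction y))) d) c"
    unfolding frag_extend_cross
    by (rule frag_extend_eq) (simp add: tensor_contraction_def assms)
  also have "\<dots> = frag_extend (\<lambda>x. frag_extend (\<lambda>y. cross (bar_contraction x) (frag_of y)) d) c
      + frag_cmul ?e (frag_extend (\<lambda>x. frag_extend (\<lambda>y. cross (frag_of [\<one>]) (bar_contraction y)) d) c)"
    by (simp only: frag_extend_fun_add frag_extend_fun_cmul)
  also have "frag_extend (\<lambda>x. frag_extend (\<lambda>y. cross (bar_contraction x) (frag_of y)) d) c
      = cross (frag_extend bar_contraction c) d"
    by (rule frag_eqI) (simp add: lin_eval_cross, simp add: lin_eval_def sum_distrib_left,
        simp add: sum.swap[of _ "keys d"] mult.left_commute)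
  also have "frag_extend (\<lambda>x. frag_extend (\<lambda>y. cross (frag_of [\<one>]) (bar_contraction y)) d) c
      = frag_cmul (augmentation c) (cross (frag_of [\<one>]) (frag_extend bar_contraction d))"
  proof (rule frag_eqI)
    fix F :: "'a list \<times> 'a list \<Rightarrow> int"
    let ?k = "lin_eval (\<lambda>y. lin_eval (\<lambda>y. F ([\<one>], y)) (bar_contraction y)) d"
    show "lin_eval F (frag_extend (\<lambda>x. frag_extend (\<lambda>y. cross (frag_of [\<one>]) (bar_contraction y)) d) c)
        = lin_eval F (frag_cmul (augmentation c) (cross (frag_of [\<one>]) (frag_extend bar_contraction d)))"
      using lin_eval_fun_cmul[of ?k "\<lambda>_. 1" c] by (simp add: lin_eval_cross augmentation_def)
  qed
  finally show ?thesis
    by auto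
qed

text \<open>Combines the homotopy identities of the two factors. For \<open>p = 0\<close> the first
  contraction leaves \<open>([\<one>], ks)\<close>, and this is what the second one contracts
  further, so that only \<open>([\<one>], [\<one>])\<close> remains.\<close>

lemma tensor_boundary_contraction:
  assumes "gs \<in> tuples G (Suc p)" "ks \<in> tuples G (Suc q)"
  shows "frag_extend (tensor_boundary G) (tensor_contraction (gs, ks))
    = frag_of (gs, ks) - frag_extend tensor_contraction (tensor_boundary G (gs, ks))
      - (if p + q = 0 then frag_of ([\<one>], [\<one>]) else 0)"
proof -
  let ?s = bar_contraction and ?E = "E_boundary G"
  have lg: "length gs = Suc p"
    using assms(1) by (simp add: tuples_def)
  have "frag_extend (tensor_boundary G) (cross (?s gs) (frag_of ks))
      = cross (frag_extend ?E (?s gs)) (frag_of ks) + frag_cmul ((- 1) ^ Suc p) (cross (?s gs) (?E ks))"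
    by (subst frag_extend_tensor_boundary_cross[where p = "Suc p"]) (auto simp: bar_contraction_def lg)
  moreover have "frag_extend (tensor_boundary G) (cross (frag_of [\<one>]) (?s ks))
      = cross (frag_of [\<one>]) (frag_extend ?E (?s ks))"
    by (subst frag_extend_tensor_boundary_cross[where p = 0]) auto
  ultimately have L: "frag_extend (tensor_boundary G) (tensor_contraction (gs, ks))
      = frag_of (gs, ks) - cross (frag_extend ?s (?E gs)) (frag_of ks)
        - (if p = 0 then frag_of ([\<one>], ks) else 0)
        + frag_cmul ((- 1) ^ Suc p) (cross (?s gs) (?E ks))
        + (if p = 0 then frag_of ([\<one>], ks) - cross (frag_of [\<one>]) (frag_extend ?s (?E ks))
            - (if q = 0 then frag_of ([\<one>], [\<one>]) else 0) else 0)"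
    by (simp add: tensor_contraction_def lg frag_extend_add cross_diff_left cross_diff_right
        E_boundary_bar_contraction[OF assms(1)] E_boundary_bar_contraction[OF assms(2)])
  have "frag_extend tensor_contraction (cross (?E gs) (frag_of ks))
      = cross (frag_extend ?s (?E gs)) (frag_of ks)"
  proof (cases p)
    case 0
    with assms(1) show ?thesis
      by (auto simp: tuples_Suc tuples_0)
  next
    case (Suc p')
    \<comment> \<open>The rule \<open>\<epsilon> \<partial> = 0\<close> removes the contribution of
      the second contraction to boundaries of words of two letters.\<close>
    have "p' = 0 \<Longrightarrow> augmentation (?E gs) = 0"
      using augmentation_E_boundary[of gs] assms(1) Suc by simp
    moreover have "frag_extend tensor_contraction (cross (?E gs) (frag_of ks)) = cross (frag_extend ?s (?E gs)) (frag_of ks)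
        + (if p' = 0 then frag_cmul (augmentation (?E gs)) (cross (frag_of [\<one>]) (frag_extend ?s (frag_of ks))) else 0)"
      by (rule frag_extend_tensor_contraction_cross) (use length_keys_E_boundary[OF assms(1)] Suc in simp)
    ultimately show ?thesis
      by auto
  qed
  moreover have "frag_extend tensor_contraction (cross (frag_of gs) (?E ks)) = cross (?s gs) (?E ks)
      + (if p = 0 then cross (frag_of [\<one>]) (frag_extend ?s (?E ks)) else 0)"
    by (subst frag_extend_tensor_contraction_cross[where p = p]) (auto simp: lg)
  ultimately have R: "frag_extend tensor_contraction (tensor_boundary G (gs, ks))
      = cross (frag_extend ?s (?E gs)) (frag_of ks) + frag_cmul ((- 1) ^ p) (cross (?s gs) (?E ks))
        + (if p = 0 then cross (frag_of [\<one>]) (frag_extend ?s (?E ks)) else 0)"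
    by (simp add: tensor_boundary_cross lg frag_extend_add frag_extend_cmul frag_cmul_distrib2)
  have sign: "frag_cmul (- ((- 1) ^ p)) c = - frag_cmul ((- 1) ^ p) c" for c :: "'a list \<times> 'a list \<Rightarrow>\<^sub>0 int"
    by simp
  show ?thesis
    unfolding L R by (simp add: sign del: minus_frag_cmul)
qed

text \<open>Conjugation sends \<open>1\<close>, and nothing else, to \<open>1\<close>, so the twist
  in \<open>idx\<close> does not affect degeneracy.\<close>

lemma idx_degenerate_iff:
  assumes "(gs, ks) \<in> gens tensor_complex n"
  shows "idx tensor_complex (gs, ks) \<in> degenerate_pairs \<longleftrightarrow> \<one> \<in> set (butlast gs) \<or> \<one> \<in> set (butlast ks)"
proof -
  obtain gs' ks' g k where *: "(gs, ks) = (gs' @ [g], ks' @ [k])" "(gs', ks') \<in> bituples G n" "g \<in> carrier G"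
    using assms by (rule tensor_gensE)
  then have "conj_by G g k = \<one> \<longleftrightarrow> k = \<one>" if "k \<in> set ks'" for k
    using that by (intro conj_by_eq_one) (auto simp: bituples_iff)
  then have "\<one> \<in> conj_by G g ` set ks' \<longleftrightarrow> \<one> \<in> set ks'"
    unfolding image_iff by metis
  with * show ?thesis
    by (auto simp: degenerate_pairs_def)
qed

lemma contracted_tensor_complex:
  "contracted_complex (conj_semidirect G) tensor_complex degenerate_pairs tensor_contraction ([\<one>], [\<one>])"
proof -
  interpret B: contracted_complex G bar_complex degenerate_words bar_contraction "[\<one>]"
    by (rule contracted_bar_complex)
  have E_deg: "\<one> \<in> set (butlast v)"
    if "w \<in> tuples G (Suc m)" "\<one> \<in> set (butlast w)" "v \<in> keys (E_boundary G w)" for m w v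
  proof (cases m)
    case 0
    with that show ?thesis
      by (auto simp: tuples_Suc tuples_0)
  next
    case (Suc m')
    with that show ?thesis
      using B.bd_degenerate[of w m' v] by (simp add: degenerate_words_def)
  qed
  show ?thesis
  proof (intro contracted_complex.intro equivariant_tensor_complex, unfold_locales)
    fix n x y
    assume x: "x \<in> gens tensor_complex (Suc n)" and deg: "idx tensor_complex x \<in> degenerate_pairs"
      and y: "y \<in> keys (bd tensor_complex x)"
    obtain gs ks where xx: "x = (gs, ks)" by fastforce
    obtain gs' ks' where yy: "y = (gs', ks')" by fastforce
    obtain p q where pq: "gs \<in> tuples G (Suc p)" "ks \<in> tuples G (Suc q)"
      using x unfolding xx tensor_gens_iff by blast
    have y_gens: "y \<in> gens tensor_complex n"
      using keys_tensor_boundary_gens[OF x] y by auto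
    have "y \<in> keys (cross (E_boundary G gs) (frag_of ks))
        \<union> keys (cross (frag_of gs) (E_boundary G ks))"
      using y subsetD[OF keys_add] unfolding xx by (force simp: tensor_boundary_cross)
    then have "gs' \<in> keys (E_boundary G gs) \<and> ks' = ks
        \<or> gs' = gs \<and> ks' \<in> keys (E_boundary G ks)"
      using keys_cross[OF order_refl order_refl, of "E_boundary G gs" "frag_of ks"]
        keys_cross[OF order_refl order_refl, of "frag_of gs" "E_boundary G ks"] unfolding yy by auto
    with deg E_deg[OF pq(1)] E_deg[OF pq(2)]
    show "idx tensor_complex y \<in> degenerate_pairs"
      using idx_degenerate_iff[OF x[unfolded xx]] idx_degenerate_iff[OF y_gens[unfolded yy]]
      unfolding xx yy by blast
  next
    fix n x
    assume x: "x \<in> gens tensor_complex n"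
    obtain gs ks where xx: "x = (gs, ks)" by fastforce
    obtain p q where pq: "p + q = n" "gs \<in> tuples G (Suc p)" "ks \<in> tuples G (Suc q)"
      using x unfolding xx tensor_gens_iff by blast
    have keys: "y = (gs @ [\<one>], ks) \<or> p = 0 \<and> y = ([\<one>], ks @ [\<one>])"
      if "y \<in> keys (tensor_contraction x)" for y
      using that pq(2) unfolding xx tensor_contraction_def bar_contraction_def
      by (auto simp: tuples_def dest!: subsetD[OF keys_add] subsetD[OF keys_diff] split: if_splits)
    show s_gens: "keys (tensor_contraction x) \<subseteq> gens tensor_complex (Suc n)"
    proof
      fix y assume "y \<in> keys (tensor_contraction x)"
      from keys[OF this] show "y \<in> gens tensor_complex (Suc n)"
      proof
        assume y: "y = (gs @ [\<one>], ks)"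
        show ?thesis
          unfolding y tensor_gens_iff
          by (rule exI[of _ "Suc p"], rule exI[of _ q]) (use pq in \<open>simp add: snoc_tuples\<close>)
      next
        assume y: "p = 0 \<and> y = ([\<one>], ks @ [\<one>])"
        then have y': "y = ([\<one>], ks @ [\<one>])" and "p = 0" by simp_all
        show ?thesis
          unfolding y' tensor_gens_iff
          by (rule exI[of _ 0], rule exI[of _ "Suc q"])
            (use pq \<open>p = 0\<close> in \<open>simp add: tuples_def\<close>)
      qed
    qed
    show "idx tensor_complex y \<in> degenerate_pairs"
      if deg: "idx tensor_complex x \<in> degenerate_pairs" and y: "y \<in> keys (tensor_contraction x)" for y
    proof -
      obtain gs' ks' where yy: "y = (gs', ks')" by fastforce
      have "(gs', ks') \<in> gens tensor_complex (Suc n)"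
        using s_gens y yy by blast
      moreover have "\<one> \<in> set (butlast gs) \<or> \<one> \<in> set (butlast ks)"
        using deg idx_degenerate_iff[OF x[unfolded xx]] unfolding xx by blast
      \<comment> \<open>Here \<open>gs\<close> has one letter, so the \<open>1\<close> sits in
        \<open>ks\<close> and survives in \<open>ks @ [\<one>]\<close>.\<close>
      moreover have "p = 0 \<Longrightarrow> butlast gs = []"
        using pq(2) by (auto simp: tuples_Suc tuples_0)
      ultimately show ?thesis
        using keys[OF y] idx_degenerate_iff[of gs' ks' "Suc n"] unfolding yy
        by (auto dest: in_set_butlastD simp del: tensor_complex_simps)
    qed
  next
    fix x
    assume x: "x \<in> gens tensor_complex 0"
    obtain gs ks where xx: "x = (gs, ks)" by fastforce
    obtain p q where pq: "p + q = 0" "gs \<in> tuples G (Suc p)" "ks \<in> tuples G (Suc q)"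
      using x unfolding xx tensor_gens_iff by blast
    obtain g k where gk: "gs = [g]" "ks = [k]"
      using pq by (auto simp: tuples_Suc tuples_0)
    show "frag_extend (bd tensor_complex) (tensor_contraction x) = frag_of x - frag_of ([\<one>], [\<one>])"
      using tensor_boundary_contraction[OF pq(2,3)] pq(1)
      unfolding xx by (simp add: gk tensor_boundary_cross)
    show "idx tensor_complex x \<notin> degenerate_pairs"
      by (simp add: xx gk degenerate_pairs_def)
  next
    fix n x
    assume x: "x \<in> gens tensor_complex (Suc n)"
    obtain gs ks where xx: "x = (gs, ks)" by fastforce
    obtain p q where pq: "p + q = Suc n" "gs \<in> tuples G (Suc p)" "ks \<in> tuples G (Suc q)"
      using x unfolding xx tensor_gens_iff by blast
    show "frag_extend (bd tensor_complex) (tensor_contraction x)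
        = frag_of x - frag_extend tensor_contraction (bd tensor_complex x)"
      using tensor_boundary_contraction[OF pq(2,3)] pq(1) unfolding xx by simp
  next
    show "([\<one>], [\<one>]) \<in> gens tensor_complex 0"
      by (simp add: tuples_def)
  qed
qed

text \<open>The last face of the first word leaves \<open>last gs\<close> at its end, and taking the
  index conjugates \<open>ks\<close> by this letter. In the faces of the second word the first word
  still ends in \<open>1\<close>, so nothing is conjugated. A factor of degree \<open>0\<close> has
  no boundary.\<close>

lemma lin_eval_tensor_boundary:
  assumes gs: "gs \<in> tuples G p" and ks: "ks \<in> tuples G q"
  shows "lin_eval (\<lambda>y. F (idx tensor_complex y)) (tensor_boundary G (gs @ [\<one>], ks @ [\<one>]))
    = (if p = 0 then 0 else delta_G G (p - 1) q F (gs, ks))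
      + (if q = 0 then 0 else (- 1) ^ p * delta_K G p (q - 1) F (gs, ks))"
proof -
  have kc: "set ks \<subseteq> carrier G"
    using ks by (simp add: tuples_def)
  have "lin_eval (\<lambda>y. F (idx tensor_complex y)) (cross (E_boundary G (gs @ [\<one>])) (frag_of (ks @ [\<one>])))
      = (if p = 0 then 0 else delta_G G (p - 1) q F (gs, ks))"
  proof (cases p)
    case 0
    with gs show ?thesis
      by (simp add: tuples_0)
  next
    case (Suc p')
    with gs obtain u c where u: "gs = u @ [c]" "u \<in> tuples G p'" "c \<in> carrier G"
      by (auto elim: tuples_SucE)
    have "lin_eval (\<lambda>w. F (w, ks)) (front_faces G gs)
        = F (tl gs, ks) + (\<Sum>i = 1..p'. (- 1) ^ i * F (merge G i gs, ks))"
      using gs Suc by (simp add: front_faces_def tuples_def u(1))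
    with u(2,3) gs ks show ?thesis
      by (simp add: Suc lin_eval_cross E_boundary_snoc u(1) delta_G_def map_conj_by_one[OF kc] tuples_def
          butlast_append)
  qed
  moreover have "lin_eval (\<lambda>y. F (idx tensor_complex y)) (cross (frag_of (gs @ [\<one>])) (E_boundary G (ks @ [\<one>])))
      = (if q = 0 then 0 else delta_K G p (q - 1) F (gs, ks))"
  proof (cases q)
    case 0
    with ks show ?thesis
      by (simp add: tuples_0)
  next
    case (Suc q')
    have "lin_eval (\<lambda>y. F (gs, map (conj_by G \<one>) (butlast y))) (E_boundary G (ks @ [\<one>]))
        = lin_eval (\<lambda>y. F (gs, butlast y)) (E_boundary G (ks @ [\<one>]))"
    proof (rule lin_eval_cong)
      fix y assume "y \<in> keys (E_boundary G (ks @ [\<one>]))"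
      then have "y \<in> tuples G q"
        using keys_E_boundary[of "ks @ [\<one>]" q] ks by (auto simp: snoc_tuples)
      then have "set (butlast y) \<subseteq> carrier G"
        by (auto simp: tuples_def dest: in_set_butlastD)
      then show "F (gs, map (conj_by G \<one>) (butlast y)) = F (gs, butlast y)"
        by (simp only: map_conj_by_one)
    qed
    also have "\<dots> = bar_delta G q' (\<lambda>ks'. F (gs, ks')) ks"
      using ks Suc by (simp add: bar_delta_eq_delta delta_def dual_def)
    finally show ?thesis
      using gs by (simp add: lin_eval_cross delta_K_def Suc)
  qed
  ultimately show ?thesis
    using gs by (simp add: tensor_boundary_cross tuples_def)
qed

text \<open>At a pair of bidegree \<open>(p, q)\<close> at most two summands survive:
  \<open>delta_G\<close> coming from \<open>(p - 1, q)\<close> and \<open>delta_K\<close> coming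
  from \<open>(p, q - 1)\<close>. The length conditions in their definitions annihilate the
  others.\<close>

lemma tot_delta_eq_delta: "tot_delta G n F = delta tensor_complex n F"
proof
  fix x :: "'a list \<times> 'a list"
  obtain gs ks where x: "x = (gs, ks)" by fastforce
  show "tot_delta G n F x = delta tensor_complex n F x"
  proof (cases "x \<in> bituples G (Suc n)")
    case False
    have "delta_G G p (n - p) F x = 0" "delta_K G p (n - p) F x = 0" if "p \<le> n" for p
      using False that by (auto simp: x delta_G_def delta_K_def bar_delta_def bituples_iff tuples_def)
    then show ?thesis
      using False by (simp add: tot_delta_def delta_def dual_def)
  next
    case True
    define p q where "p = length gs" and "q = length ks"
    have pq: "p + q = Suc n" "gs \<in> tuples G p" "ks \<in> tuples G q"
      using True by (auto simp: x bituples_iff tuples_def p_def q_def)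
    have G: "delta_G G r (n - r) F x = (if Suc r = p then delta_G G (p - 1) q F x else 0)" if "r \<le> n" for r
    proof (cases "Suc r = p")
      case True
      then have "r = p - 1" "n - r = q"
        using pq(1) by auto
      with True show ?thesis
        by simp
    next
      case False
      then show ?thesis
        using pq by (simp add: x delta_G_def tuples_def)
    qed
    have K: "delta_K G r (n - r) F x = (if r = p \<and> q \<noteq> 0 then delta_K G p (q - 1) F x else 0)" if "r \<le> n" for r
    proof (cases "r = p \<and> q \<noteq> 0")
      case True
      then have "r = p" "n - r = q - 1"
        using pq(1) by auto
      with True show ?thesis
        by simp
    next
      case False
      then show ?thesis
        using pq that by (auto simp: x delta_K_def bar_delta_def tuples_def)
    qed
    have "tot_delta G n F x = (\<Sum>r\<le>n. delta_G G r (n - r) F x) + (\<Sum>r\<le>n. (- 1) ^ r * delta_K G r (n - r) F x)"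
      by (simp add: tot_delta_def sum.distrib)
    also have "(\<Sum>r\<le>n. delta_G G r (n - r) F x) = (if p = 0 then 0 else delta_G G (p - 1) q F x)"
    proof (cases p)
      case 0
      then show ?thesis by (simp add: G)
    next
      case (Suc p')
      then have "(\<Sum>r\<le>n. delta_G G r (n - r) F x) = (\<Sum>r\<le>n. if r = p' then delta_G G (p - 1) q F x else 0)"
        by (intro sum.cong) (simp_all add: G)
      also have "\<dots> = delta_G G (p - 1) q F x"
        using pq Suc by simp
      finally show ?thesis
        using Suc by simp
    qed
    also have "(\<Sum>r\<le>n. (- 1) ^ r * delta_K G r (n - r) F x)
        = (\<Sum>r\<le>n. if r = p then (if q = 0 then 0 else (- 1) ^ p * delta_K G p (q - 1) F x) else 0)"
      by (intro sum.cong) (simp_all add: K)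
    also have "\<dots> = (if q = 0 then 0 else (- 1) ^ p * delta_K G p (q - 1) F x)"
      using pq by simp
    finally show ?thesis
      using True lin_eval_tensor_boundary[OF pq(2,3), of F] by (simp add: delta_def dual_def x)
  qed
qed

lemma full_tot_cochains_eq: "full_tot_cochains G n = cochains tensor_complex n"
  by (simp add: full_tot_cochains_def cochains_def)

lemma tot_cochains_eq: "tot_cochains G n = cochains (quotient_complex tensor_complex degenerate_pairs) n"
  by (auto simp: tot_cochains_def full_tot_cochains_def cochains_def degenerate_pairs_def)

end

section \<open>Shuffles\<close>

text \<open>The shuffle sum by recursion on the last letter, with both words given in reverse order. The letters
  of the two words are embedded by \<open>\<iota>\<close> and \<open>\<kappa>\<close> into a common group.\<close>

function shuffle_rev :: "('a, 'b) monoid_scheme \<Rightarrow> ('a \<Rightarrow> 'c) \<Rightarrow> ('a \<Rightarrow> 'c) \<Rightarrow> 'a list \<Rightarrow> 'a list \<Rightarrow> 'c list \<Rightarrow>\<^sub>0 int" where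
  "shuffle_rev K \<iota> \<kappa> [] [] = frag_of []"
| "shuffle_rev K \<iota> \<kappa> [] (k # ks) = snoc_map (\<kappa> k) (shuffle_rev K \<iota> \<kappa> [] ks)"
| "shuffle_rev K \<iota> \<kappa> (g # gs) [] = snoc_map (\<iota> g) (shuffle_rev K \<iota> \<kappa> gs [])"
| "shuffle_rev K \<iota> \<kappa> (g # gs) (k # ks) = snoc_map (\<kappa> k) (shuffle_rev K \<iota> \<kappa> (g # gs) ks)
     + frag_cmul ((- 1) ^ Suc (length ks)) (snoc_map (\<iota> g) (shuffle_rev K \<iota> \<kappa> gs (map (conj_by K g) (k # ks))))"
  by pat_completeness auto
termination
  by (relation "measure (\<lambda>(K, \<iota>, \<kappa>, gs, ks). length gs + length ks)") auto

definition shuffle :: "('a, 'b) monoid_scheme \<Rightarrow> ('a \<Rightarrow> 'c) \<Rightarrow> ('a \<Rightarrow> 'c) \<Rightarrow> 'a list \<Rightarrow> 'a list \<Rightarrow> 'c list \<Rightarrow>\<^sub>0 int" where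
  "shuffle K \<iota> \<kappa> gs ks = shuffle_rev K \<iota> \<kappa> (rev gs) (rev ks)"

lemma shuffle_simps [simp]:
  "shuffle K \<iota> \<kappa> [] [] = frag_of []"
  "shuffle K \<iota> \<kappa> [] (ks @ [k]) = snoc_map (\<kappa> k) (shuffle K \<iota> \<kappa> [] ks)"
  "shuffle K \<iota> \<kappa> (gs @ [g]) [] = snoc_map (\<iota> g) (shuffle K \<iota> \<kappa> gs [])"
  by (simp_all add: shuffle_def)

text \<open>A shuffle ends in the last \<open>k\<close>, or in the last \<open>g\<close> once it has
  passed all \<open>Suc (length ks)\<close> letters of the second word; each passage contributes a
  sign and conjugates the letter passed.\<close>

lemma shuffle_snoc_snoc:
  "shuffle K \<iota> \<kappa> (gs @ [g]) (ks @ [k]) = snoc_map (\<kappa> k) (shuffle K \<iota> \<kappa> (gs @ [g]) ks)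
     + frag_cmul ((- 1) ^ Suc (length ks)) (snoc_map (\<iota> g) (shuffle K \<iota> \<kappa> gs (map (conj_by K g) (ks @ [k]))))"
  by (simp add: shuffle_def rev_map)

text \<open>The hypothesis for the shorter first word covers every second word of the right length,
  since the recursion conjugates the letters of \<open>ks @ [k]\<close>.\<close>

lemma shuffle_induct [case_names Nil_Nil Nil_snoc snoc_Nil snoc_snoc]:
  assumes "P [] []"
    and "\<And>ks k. P [] ks \<Longrightarrow> P [] (ks @ [k])"
    and "\<And>gs g. P gs [] \<Longrightarrow> P (gs @ [g]) []"
    and "\<And>gs g ks k. P (gs @ [g]) ks \<Longrightarrow> (\<And>ks'. length ks' = Suc (length ks) \<Longrightarrow> P gs ks')
      \<Longrightarrow> P (gs @ [g]) (ks @ [k])"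
  shows "P gs ks"
proof (induction "length gs + length ks" arbitrary: gs ks rule: less_induct)
  case less
  show ?case
    by (cases gs rule: rev_cases; cases ks rule: rev_cases) (use less assms in auto)
qed

text \<open>Conjugation takes place in \<open>K\<close> before the letters are embedded, so any
  \<open>f\<close> can be absorbed into the embeddings.\<close>

lemma frag_map_shuffle:
  "frag_map (map f) (shuffle K \<iota> \<kappa> gs ks) = shuffle K (\<lambda>x. f (\<iota> x)) (\<lambda>x. f (\<kappa> x)) gs ks"
proof -
  have snoc: "frag_map (map f) (snoc_map a c) = snoc_map (f a) (frag_map (map f) c)" for a c
    by (simp add: frag_extend_frag_extend)
  show ?thesis
  proof (induction gs ks rule: shuffle_induct)
    case (snoc_snoc gs g ks k)
    have "frag_map (map f) (shuffle K \<iota> \<kappa> gs (map (conj_by K g) (ks @ [k])))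
        = shuffle K (\<lambda>x. f (\<iota> x)) (\<lambda>x. f (\<kappa> x)) gs (map (conj_by K g) (ks @ [k]))"
      by (rule snoc_snoc.IH(2)) simp
    then show ?case
      unfolding shuffle_snoc_snoc frag_extend_add frag_extend_cmul snoc snoc_snoc.IH(1) by (simp only:)
  qed (simp_all only: shuffle_simps snoc frag_extend_of list.map)
qed

lemma (in group) shuffle_cong:
  assumes "\<And>x. x \<in> carrier G \<Longrightarrow> \<iota> x = \<iota>' x" "\<And>x. x \<in> carrier G \<Longrightarrow> \<kappa> x = \<kappa>' x"
    and "set gs \<subseteq> carrier G" "set ks \<subseteq> carrier G"
  shows "shuffle G \<iota> \<kappa> gs ks = shuffle G \<iota>' \<kappa>' gs ks"
  using assms(3,4)
proof (induction gs ks rule: shuffle_induct)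
  case (snoc_snoc gs g ks k)
  have "shuffle G \<iota> \<kappa> gs (map (conj_by G g) (ks @ [k])) = shuffle G \<iota>' \<kappa>' gs (map (conj_by G g) (ks @ [k]))"
    using snoc_snoc.prems by (intro snoc_snoc.IH(2)) auto
  with snoc_snoc show ?case
    unfolding shuffle_snoc_snoc by (simp add: assms(1,2) del: map_append)
qed (simp_all add: assms(1,2))

text \<open>Used for the two embeddings of \<open>K\<close> into the semidirect product, and for the
  identity of \<open>K\<close>, where \<open>commute\<close> reads
  \<open>g k = (g k g\<inverse>) g\<close>.\<close>

locale shuffle_letters = K: group K + H: group H
  for K :: "('a, 'b) monoid_scheme" and H :: "('c, 'd) monoid_scheme" +
  fixes \<iota> \<kappa> :: "'a \<Rightarrow> 'c"
  assumes \<iota>_hom: "\<iota> \<in> hom K H" and \<kappa>_hom: "\<kappa> \<in> hom K H"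
    and commute: "g \<in> carrier K \<Longrightarrow> k \<in> carrier K \<Longrightarrow>
      \<iota> g \<otimes>\<^bsub>H\<^esub> \<kappa> k = \<kappa> (conj_by K g k) \<otimes>\<^bsub>H\<^esub> \<iota> g"
begin

abbreviation S :: "'a list \<Rightarrow> 'a list \<Rightarrow> 'c list \<Rightarrow>\<^sub>0 int" where
  "S \<equiv> shuffle K \<iota> \<kappa>"

lemma letters_closed [simp, intro]:
  "a \<in> carrier K \<Longrightarrow> \<iota> a \<in> carrier H" "a \<in> carrier K \<Longrightarrow> \<kappa> a \<in> carrier H"
  using hom_in_carrier[OF \<iota>_hom] hom_in_carrier[OF \<kappa>_hom] by auto

lemma letters_one: "\<iota> \<one>\<^bsub>K\<^esub> = \<one>\<^bsub>H\<^esub>" "\<kappa> \<one>\<^bsub>K\<^esub> = \<one>\<^bsub>H\<^esub>"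
  using hom_one[OF \<iota>_hom] hom_one[OF \<kappa>_hom] by auto

lemmas letters_mult = hom_mult[OF \<iota>_hom] hom_mult[OF \<kappa>_hom]

lemma keys_shuffle:
  assumes "set gs \<subseteq> carrier K" "set ks \<subseteq> carrier K"
  shows "keys (S gs ks) \<subseteq> tuples H (length gs + length ks)"
  using assms
proof (induction gs ks rule: shuffle_induct)
  case (snoc_snoc gs g ks k)
  have A: "keys (snoc_map (\<kappa> k) (S (gs @ [g]) ks)) \<subseteq> tuples H (Suc (Suc (length gs + length ks)))"
    by (rule keys_snoc_map) (use snoc_snoc in auto)
  have "keys (S gs (map (conj_by K g) (ks @ [k]))) \<subseteq> tuples H (Suc (length gs + length ks))"
    using snoc_snoc.IH(2)[of "map (conj_by K g) (ks @ [k])"] snoc_snoc.prems by auto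
  then have B: "keys (snoc_map (\<iota> g) (S gs (map (conj_by K g) (ks @ [k]))))
      \<subseteq> tuples H (Suc (Suc (length gs + length ks)))"
    by (rule keys_snoc_map) (use snoc_snoc in auto)
  show ?case
    unfolding shuffle_snoc_snoc using A B
    by (intro keys_add_subset keys_cmul_subset) simp_all
next
  case (Nil_snoc ks k)
  then show ?case
    using keys_snoc_map[of "S [] ks" H "length ks" "\<kappa> k"] by simp
next
  case (snoc_Nil gs g)
  then show ?case
    using keys_snoc_map[of "S gs []" H "length gs" "\<iota> g"] by simp
qed (simp add: tuples_0)

text \<open>Conjugation fixes \<open>1\<close> and both embeddings preserve it, so the letter
  \<open>1\<close> is present in every shuffle.\<close>

lemma shuffle_degenerate:
  assumes "set gs \<subseteq> carrier K" "set ks \<subseteq> carrier K" "\<one>\<^bsub>K\<^esub> \<in> set gs \<union> set ks"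
    "w \<in> keys (S gs ks)"
  shows "\<one>\<^bsub>H\<^esub> \<in> set w"
proof -
  have "keys (S gs ks) \<subseteq> {w. \<one>\<^bsub>H\<^esub> \<in> set w}"
    using assms(1-3)
  proof (induction gs ks rule: shuffle_induct)
    case (snoc_snoc gs g ks k)
    have "keys (snoc_map (\<kappa> k) (S (gs @ [g]) ks)) \<subseteq> {w. \<one>\<^bsub>H\<^esub> \<in> set w}"
    proof (cases "k = \<one>\<^bsub>K\<^esub>")
      case False
      with snoc_snoc show ?thesis
        by (intro keys_frag_extend_subset) auto
    qed (intro keys_frag_extend_subset, auto simp: letters_one)
    moreover have "keys (snoc_map (\<iota> g) (S gs (map (conj_by K g) (ks @ [k])))) \<subseteq> {w. \<one>\<^bsub>H\<^esub> \<in> set w}"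
    proof (cases "g = \<one>\<^bsub>K\<^esub>")
      case False
      have one: "conj_by K g \<one>\<^bsub>K\<^esub> = \<one>\<^bsub>K\<^esub>"
        using snoc_snoc.prems by simp
      have "\<one>\<^bsub>K\<^esub> \<in> set gs \<union> set (map (conj_by K g) (ks @ [k]))"
        using False snoc_snoc.prems(3) image_eqI[of "\<one>\<^bsub>K\<^esub>" "conj_by K g" "\<one>\<^bsub>K\<^esub>"] one by auto
      then have "keys (S gs (map (conj_by K g) (ks @ [k]))) \<subseteq> {w. \<one>\<^bsub>H\<^esub> \<in> set w}"
        using snoc_snoc.IH(2)[of "map (conj_by K g) (ks @ [k])"] snoc_snoc.prems by auto
      then show ?thesis
        by (intro keys_frag_extend_subset) auto
    qed (intro keys_frag_extend_subset, auto simp: letters_one)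
    ultimately show ?case
      unfolding shuffle_snoc_snoc by (intro keys_add_subset keys_cmul_subset)
  next
    case (Nil_snoc ks k)
    then show ?case
      by (cases "k = \<one>\<^bsub>K\<^esub>") (auto simp: letters_one keys_frag_of dest!: subsetD[OF keys_frag_extend])
  next
    case (snoc_Nil gs g)
    then show ?case
      by (cases "g = \<one>\<^bsub>K\<^esub>") (auto simp: letters_one keys_frag_of dest!: subsetD[OF keys_frag_extend])
  qed simp
  with assms(4) show ?thesis
    by auto
qed

section \<open>The Leibniz rule for shuffles\<close>

lemma frag_map_mult_last_snoc_map: "frag_map (mult_last H a) (snoc_map b c) = snoc_map (b \<otimes>\<^bsub>H\<^esub> a) c"
  by (simp add: frag_extend_frag_extend)

text \<open>Splits the shuffles by the origin of their last letter, so that its product with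
  \<open>a\<close> can be named.\<close>

lemma mult_last_shuffle:
  assumes "gs \<noteq> [] \<or> ks \<noteq> []"
  shows "frag_map (mult_last H a) (S gs ks) =
    (if ks = [] then 0 else snoc_map (\<kappa> (last ks) \<otimes>\<^bsub>H\<^esub> a) (S gs (butlast ks)))
    + (if gs = [] then 0 else frag_cmul ((- 1) ^ length ks)
        (snoc_map (\<iota> (last gs) \<otimes>\<^bsub>H\<^esub> a) (S (butlast gs) (map (conj_by K (last gs)) ks))))"
  using assms
  by (cases gs rule: rev_cases; cases ks rule: rev_cases)
    (simp_all add: shuffle_snoc_snoc frag_extend_add frag_extend_cmul frag_map_mult_last_snoc_map
      del: map_append)

lemma front_faces_snoc_map_shuffle:
  assumes "set gs \<subseteq> carrier K" "set ks \<subseteq> carrier K" "gs \<noteq> [] \<or> ks \<noteq> []"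
  shows "frag_extend (front_faces H) (snoc_map a (S gs ks)) = snoc_map a (frag_extend (front_faces H) (S gs ks))
    + frag_cmul ((- 1) ^ (length gs + length ks)) (frag_map (mult_last H a) (S gs ks))"
proof -
  obtain m where "length gs + length ks = Suc m"
    using assms(3) by (cases "length gs + length ks") auto
  moreover have "length w = length gs + length ks" if "w \<in> keys (S gs ks)" for w
    using keys_shuffle[OF assms(1,2)] that by (auto simp: tuples_def)
  ultimately show ?thesis
    using front_faces_snoc_map[of "S gs ks" m H a] by simp
qed

text \<open>The recursion is applied to every face of \<open>u @ [g]\<close>. Most faces still end
  in \<open>g\<close>; the one that merges \<open>g\<close> into \<open>u\<close> yields the
  additional term, whose second word is conjugated by the product.\<close>

lemma shuffle_front_faces_left:
  "frag_extend (\<lambda>v. S v (t @ [k])) (front_faces K (u @ [g])) =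
     snoc_map (\<kappa> k) (frag_extend (\<lambda>v. S v t) (front_faces K (u @ [g])))
     + frag_cmul ((- 1) ^ Suc (length t))
         (snoc_map (\<iota> g) (frag_extend (\<lambda>v. S v (map (conj_by K g) (t @ [k]))) (front_faces K u)))
     + (if u = [] then 0 else frag_cmul ((- 1) ^ Suc (length u + length t))
         (snoc_map (\<iota> (last u \<otimes>\<^bsub>K\<^esub> g)) (S (butlast u) (map (conj_by K (last u \<otimes>\<^bsub>K\<^esub> g)) (t @ [k])))))"
proof (cases u rule: rev_cases)
  case Nil
  then show ?thesis
    by (simp del: map_append)
next
  case (snoc u' g')
  have L: "frag_extend (\<lambda>v. S v (t @ [k])) (snoc_map g (front_faces K u))
      = snoc_map (\<kappa> k) (frag_extend (\<lambda>v. S v t) (snoc_map g (front_faces K u)))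
        + frag_cmul ((- 1) ^ Suc (length t))
           (snoc_map (\<iota> g) (frag_extend (\<lambda>v. S v (map (conj_by K g) (t @ [k]))) (front_faces K u)))"
    unfolding frag_extend_frag_extend frag_extend_of shuffle_snoc_snoc frag_extend_fun_add frag_extend_fun_cmul ..
  have ff: "front_faces K (u @ [g]) = snoc_map g (front_faces K u)
      + frag_cmul ((- 1) ^ length u) (frag_of (u' @ [g' \<otimes>\<^bsub>K\<^esub> g]))"
    using front_faces_snoc[of K u' g' g] by (simp add: snoc)
  have last: "last u = g'" "butlast u = u'" "u \<noteq> []"
    by (simp_all add: snoc)
  show ?thesis
    unfolding ff frag_extend_add frag_extend_cmul L frag_extend_of shuffle_snoc_snoc last frag_cmul_distrib2
    by (simp add: last power_add del: map_append)
qed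

text \<open>The faces of \<open>t @ [k]\<close> have one letter fewer, so \<open>g\<close> passes
  \<open>length t\<close> letters, which explains the exponent. The additional term comes from
  merging \<open>k\<close> into \<open>t\<close>.\<close>

lemma shuffle_front_faces_right:
  assumes "set t \<subseteq> carrier K" "k \<in> carrier K"
  shows "frag_extend (S (u @ [g])) (front_faces K (t @ [k])) =
     snoc_map (\<kappa> k) (frag_extend (S (u @ [g])) (front_faces K t))
     + frag_cmul ((- 1) ^ length t)
         (snoc_map (\<iota> g) (frag_extend (\<lambda>v. S u (map (conj_by K g) v)) (front_faces K (t @ [k]))))
     + (if t = [] then 0 else frag_cmul ((- 1) ^ length t)
         (snoc_map (\<kappa> (last t \<otimes>\<^bsub>K\<^esub> k)) (S (u @ [g]) (butlast t))))"
proof (cases t rule: rev_cases)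
  case Nil
  then show ?thesis
    by simp
next
  case (snoc t' k')
  have "t \<in> tuples K (Suc (length t'))"
    using assms by (simp add: tuples_def snoc)
  then have len: "length v = length t'" if "v \<in> keys (front_faces K t)" for v
    using K.keys_front_faces that by (auto simp: tuples_def)
  have "frag_extend (S (u @ [g])) (snoc_map k (front_faces K t))
      = frag_extend (\<lambda>v. snoc_map (\<kappa> k) (S (u @ [g]) v)
          + frag_cmul ((- 1) ^ length t) (snoc_map (\<iota> g) (S u (map (conj_by K g) (v @ [k])))))
          (front_faces K t)"
    unfolding frag_extend_frag_extend frag_extend_of
    by (rule frag_extend_eq) (simp add: shuffle_snoc_snoc len snoc)
  then have R: "frag_extend (S (u @ [g])) (snoc_map k (front_faces K t))
      = snoc_map (\<kappa> k) (frag_extend (S (u @ [g])) (front_faces K t))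
        + frag_cmul ((- 1) ^ length t)
           (snoc_map (\<iota> g) (frag_extend (\<lambda>v. S u (map (conj_by K g) v)) (snoc_map k (front_faces K t))))"
    unfolding frag_extend_fun_add frag_extend_fun_cmul frag_extend_frag_extend frag_extend_of .
  have ff: "front_faces K (t @ [k]) = snoc_map k (front_faces K t)
      + frag_cmul ((- 1) ^ length t) (frag_of (t' @ [k' \<otimes>\<^bsub>K\<^esub> k]))"
    using front_faces_snoc[of K t' k' k] by (simp add: snoc)
  have last: "last t = k'" "butlast t = t'" "t \<noteq> []" "length t = Suc (length t')"
    by (simp_all add: snoc)
  show ?thesis
    unfolding ff frag_extend_add frag_extend_cmul R frag_extend_of shuffle_snoc_snoc last(1,2) frag_cmul_distrib2
    by (simp add: last(3,4) add_ac del: map_append)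
qed

text \<open>The faces multiplying a letter of the first word with a letter of the second cancel in pairs.\<close>

theorem front_faces_shuffle:
  assumes "set gs \<subseteq> carrier K" "set ks \<subseteq> carrier K"
  shows "frag_extend (front_faces H) (S gs ks) = frag_extend (\<lambda>v. S v ks) (front_faces K gs)
    + frag_cmul ((- 1) ^ length gs) (frag_extend (S gs) (front_faces K ks))"
  using assms
proof (induction gs ks rule: shuffle_induct)
  case Nil_Nil
  then show ?case
    by simp
next
  case (Nil_snoc t k)
  show ?case
  proof (cases t rule: rev_cases)
    case Nil
    then show ?thesis
      using shuffle_simps(2)[of K \<iota> \<kappa> "[]"] by simp
  next
    case (snoc t' k')
    have t: "t \<noteq> []" "last t = k'" "butlast t = t'" "set t \<subseteq> carrier K" "k \<in> carrier K" "k' \<in> carrier K"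
      using Nil_snoc.prems by (auto simp: snoc)
    have "frag_extend (front_faces H) (S [] (t @ [k])) = snoc_map (\<kappa> k) (frag_extend (S []) (front_faces K t))
        + frag_cmul ((- 1) ^ length t) (snoc_map (\<kappa> (k' \<otimes>\<^bsub>K\<^esub> k)) (S [] t'))"
      using front_faces_snoc_map_shuffle[of "[]" t "\<kappa> k"] mult_last_shuffle[of "[]" t "\<kappa> k"]
        Nil_snoc.IH t by (simp add: letters_mult)
    also have "\<dots> = frag_extend (S []) (front_faces K (t @ [k]))"
      using front_faces_snoc[of K t' k' k]
      by (simp add: snoc frag_extend_add frag_extend_diff frag_extend_minus frag_extend_cmul frag_extend_frag_extend)
    finally show ?thesis
      by simp
  qed
next
  case (snoc_Nil u g)
  show ?case
  proof (cases u rule: rev_cases)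
    case Nil
    then show ?thesis
      using shuffle_simps(3)[of K \<iota> \<kappa> "[]"] by simp
  next
    case (snoc u' g')
    have u: "u \<noteq> []" "last u = g'" "butlast u = u'" "set u \<subseteq> carrier K" "g \<in> carrier K" "g' \<in> carrier K"
      using snoc_Nil.prems by (auto simp: snoc)
    have "frag_extend (front_faces H) (S (u @ [g]) []) = snoc_map (\<iota> g) (frag_extend (\<lambda>v. S v []) (front_faces K u))
        + frag_cmul ((- 1) ^ length u) (snoc_map (\<iota> (g' \<otimes>\<^bsub>K\<^esub> g)) (S u' []))"
      using front_faces_snoc_map_shuffle[of u "[]" "\<iota> g"] mult_last_shuffle[of u "[]" "\<iota> g"]
        snoc_Nil.IH u by (simp add: letters_mult)
    also have "\<dots> = frag_extend (\<lambda>v. S v []) (front_faces K (u @ [g]))"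
      using front_faces_snoc[of K u' g' g]
      by (simp add: snoc frag_extend_add frag_extend_diff frag_extend_minus frag_extend_cmul frag_extend_frag_extend)
    finally show ?thesis
      by simp
  qed
next
  case (snoc_snoc u g t k)
  let ?c = "map (conj_by K g)" and ?p = "length u" and ?q = "length t"
  have cl: "set u \<subseteq> carrier K" "g \<in> carrier K" "set t \<subseteq> carrier K" "k \<in> carrier K"
    using snoc_snoc.prems by auto
  have cc: "set (?c (t @ [k])) \<subseteq> carrier K"
    using cl by auto
  have IH1: "frag_extend (front_faces H) (S (u @ [g]) t) = frag_extend (\<lambda>v. S v t) (front_faces K (u @ [g]))
      + frag_cmul ((- 1) ^ Suc ?p) (frag_extend (S (u @ [g])) (front_faces K t))"
    using snoc_snoc.IH(1) cl by simp
  \<comment> \<open>Conjugation by \<open>g\<close> is a homomorphism, so it commutes with taking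
    faces of the second word.\<close>
  have IH2: "frag_extend (front_faces H) (S u (?c (t @ [k])))
      = frag_extend (\<lambda>v. S v (?c (t @ [k]))) (front_faces K u)
        + frag_cmul ((- 1) ^ ?p) (frag_extend (\<lambda>v. S u (?c v)) (front_faces K (t @ [k])))"
    using snoc_snoc.IH(2)[of "?c (t @ [k])"] cl cc front_faces_map[OF K.conj_by_hom[OF cl(2)], of "t @ [k]"]
    by (simp add: frag_extend_frag_extend del: map_append)
  have last_t: "\<kappa> (last t) \<otimes>\<^bsub>H\<^esub> \<kappa> k = \<kappa> (last t \<otimes>\<^bsub>K\<^esub> k)" if "t \<noteq> []"
    using subsetD[OF cl(3) last_in_set[OF that]] cl(4) by (simp add: letters_mult)
  have last_u: "\<iota> (last u) \<otimes>\<^bsub>H\<^esub> \<iota> g = \<iota> (last u \<otimes>\<^bsub>K\<^esub> g)"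
      "map (conj_by K (last u)) (?c (t @ [k])) = map (conj_by K (last u \<otimes>\<^bsub>K\<^esub> g)) (t @ [k])" if "u \<noteq> []"
  proof -
    have lu: "last u \<in> carrier K"
      using subsetD[OF cl(1) last_in_set[OF that]] .
    then show "\<iota> (last u) \<otimes>\<^bsub>H\<^esub> \<iota> g = \<iota> (last u \<otimes>\<^bsub>K\<^esub> g)"
      using cl by (simp add: letters_mult)
    show "map (conj_by K (last u)) (?c (t @ [k])) = map (conj_by K (last u \<otimes>\<^bsub>K\<^esub> g)) (t @ [k])"
      using cl by (intro K.map_conj_by_conj_by lu) auto
  qed
  \<comment> \<open>\<open>X\<close> collects the mixed faces at the end of the word. It arises in
    \<open>M1\<close> with last letter \<open>\<iota> g \<otimes> \<kappa> k\<close> and in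
    \<open>M2\<close> with \<open>\<kappa> (conj_by K g k) \<otimes> \<iota> g\<close>;
    \<open>commute\<close> identifies the two, and their total signs \<open>(- 1) ^ Suc ?p\<close>
    and \<open>(- 1) ^ ?p\<close> are opposite. \<open>Y\<close> and \<open>Z\<close> stay within
    one word.\<close>
  define X where "X = snoc_map (\<iota> g \<otimes>\<^bsub>H\<^esub> \<kappa> k) (S u (?c t))"
  define Y where "Y = (if t = [] then 0 else snoc_map (\<kappa> (last t \<otimes>\<^bsub>K\<^esub> k)) (S (u @ [g]) (butlast t)))"
  define Z where "Z = (if u = [] then 0 else
    snoc_map (\<iota> (last u \<otimes>\<^bsub>K\<^esub> g)) (S (butlast u) (map (conj_by K (last u \<otimes>\<^bsub>K\<^esub> g)) (t @ [k]))))"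
  have M1: "frag_map (mult_last H (\<kappa> k)) (S (u @ [g]) t) = Y + frag_cmul ((- 1) ^ ?q) X"
    by (subst mult_last_shuffle) (auto simp: X_def Y_def last_t)
  have M2: "frag_map (mult_last H (\<iota> g)) (S u (?c (t @ [k]))) = X + frag_cmul ((- 1) ^ Suc ?q) Z"
  proof -
    have lb: "last (?c (t @ [k])) = conj_by K g k" "butlast (?c (t @ [k])) = ?c t"
      by simp_all
    show ?thesis
      by (subst mult_last_shuffle)
        (simp_all add: X_def Z_def last_u lb commute[OF cl(2,4)] del: map_append map_map)
  qed
  have "frag_extend (front_faces H) (S (u @ [g]) (t @ [k]))
      = snoc_map (\<kappa> k) (frag_extend (front_faces H) (S (u @ [g]) t))
        + frag_cmul ((- 1) ^ Suc (?p + ?q)) (Y + frag_cmul ((- 1) ^ ?q) X)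
        + frag_cmul ((- 1) ^ Suc ?q) (snoc_map (\<iota> g) (frag_extend (front_faces H) (S u (?c (t @ [k]))))
          + frag_cmul ((- 1) ^ Suc (?p + ?q)) (X + frag_cmul ((- 1) ^ Suc ?q) Z))"
    unfolding shuffle_snoc_snoc frag_extend_add frag_extend_cmul
    using front_faces_snoc_map_shuffle[of "u @ [g]" t "\<kappa> k"] cl
      front_faces_snoc_map_shuffle[of u "?c (t @ [k])" "\<iota> g"] cc
    unfolding M1 M2 by (simp del: map_append)
  also have "\<dots> = snoc_map (\<kappa> k) (frag_extend (\<lambda>v. S v t) (front_faces K (u @ [g])))
        + frag_cmul ((- 1) ^ Suc ?q) (snoc_map (\<iota> g) (frag_extend (\<lambda>v. S v (?c (t @ [k]))) (front_faces K u)))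
        + frag_cmul ((- 1) ^ Suc (?p + ?q)) Z
      + frag_cmul ((- 1) ^ Suc ?p) (snoc_map (\<kappa> k) (frag_extend (S (u @ [g])) (front_faces K t))
        + frag_cmul ((- 1) ^ ?q) (snoc_map (\<iota> g) (frag_extend (\<lambda>v. S u (?c v)) (front_faces K (t @ [k]))))
        + frag_cmul ((- 1) ^ ?q) Y)"
    unfolding IH1 IH2 frag_extend_add frag_extend_cmul
    by (cases "even ?p"; cases "even ?q") (simp_all add: algebra_simps)
  also have "\<dots> = frag_extend (\<lambda>v. S v (t @ [k])) (front_faces K (u @ [g]))
      + frag_cmul ((- 1) ^ Suc ?p) (frag_extend (S (u @ [g])) (front_faces K (t @ [k])))"
    unfolding shuffle_front_faces_left shuffle_front_faces_right[OF cl(3,4)] Y_def Z_def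
    by (simp del: map_append)
  finally show ?case
    by simp
qed

end

text \<open>\<open>last_to p m\<close> moves position \<open>p + 1\<close> to \<open>p + 1 + m\<close> and shifts the positions in between down. Every
  shuffle ending in the last letter of the first word is a shuffle of the remaining letters composed with it.\<close>

primrec last_to :: "nat \<Rightarrow> nat \<Rightarrow> nat \<Rightarrow> nat" where
  "last_to p 0 = id"
| "last_to p (Suc m) = transpose (Suc (p + m)) (Suc (Suc (p + m))) \<circ> last_to p m"

lemma last_to_apply:
  "last_to p m i = (if i = Suc p then Suc (p + m) else if Suc p < i \<and> i \<le> Suc (p + m) then i - 1 else i)"
  by (induction m arbitrary: i) (auto simp: transpose_def)

lemma last_to_permutes: "last_to p m permutes {1..Suc (p + m)}"
proof (induction m)
  case (Suc m)
  have "transpose (Suc (p + m)) (Suc (Suc (p + m))) permutes {1..Suc (p + Suc m)}"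
    by (intro permutes_swap_id) auto
  moreover have "last_to p m permutes {1..Suc (p + Suc m)}"
    by (rule permutes_subset[OF Suc]) auto
  ultimately show ?case
    unfolding last_to.simps by (rule permutes_compose[rotated])
qed (simp add: permutes_id id_def[symmetric])

lemma permutation_if_permutes: "\<sigma> permutes {a..b::nat} \<Longrightarrow> permutation \<sigma>"
  by (auto simp: permutation_permutes)

lemma sign_last_to: "sign (last_to p m) = (- 1) ^ m"
proof (induction m)
  case (Suc m)
  have "sign (last_to p (Suc m)) = sign (transpose (Suc (p + m)) (Suc (Suc (p + m)))) * sign (last_to p m)"
    unfolding last_to.simps
    by (intro sign_compose permutation_swap_id permutation_if_permutes[OF last_to_permutes])
  then show ?case
    unfolding Suc by (simp add: sign_swap_id del: last_to.simps)
qed (simp add: sign_id flip: id_def)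

declare last_to.simps(2) [simp del]

lemma inv_last_to:
  "inv_into UNIV (last_to p m) i = (if i = Suc (p + m) then Suc p else if p < i \<and> i < Suc (p + m) then Suc i else i)"
  by (subst permutes_inv_eq[OF last_to_permutes]) (auto simp: last_to_apply)

text \<open>Counting down from the end of an increasing block. It bounds by \<open>p\<close> the
  number \<open>p + \<sigma> i - i\<close> of letters dropped in
  \<open>shuffle_letter\<close>.\<close>

lemma shuffle_perms_apply_le:
  assumes "\<sigma> \<in> shuffle_perms p q" "p < i" "i \<le> p + q"
  shows "\<sigma> i \<le> i"
  using assms(3,2)
proof (induction i rule: inc_induct)
  case base
  then show ?case
    using assms(1) permutes_in_image[of \<sigma> "{1..p + q}" "p + q"] by (auto simp: shuffle_perms_def)
next
  case (step i)
  have "\<sigma> i < \<sigma> (Suc i)"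
    using assms(1) step by (auto simp: shuffle_perms_def strict_mono_on_def)
  with step show ?case
    by simp
qed

text \<open>The upper bound is \<open>shuffle_perms_apply_le\<close> for an empty first word, the
  lower bound its mirror image.\<close>

lemma strict_mono_on_permutes_id:
  assumes \<sigma>: "\<sigma> permutes {1..n::nat}" and mono: "strict_mono_on {1..n} \<sigma>"
  shows "\<sigma> = id"
proof
  fix i
  show "\<sigma> i = id i"
  proof (cases "i \<in> {1..n}")
    case True
    have "\<sigma> \<in> shuffle_perms 0 n"
      using assms by (simp add: shuffle_perms_def strict_mono_on_def)
    then have "\<sigma> i \<le> i"
      using shuffle_perms_apply_le[of \<sigma> 0 n i] True by simp
    moreover have "i \<le> \<sigma> i"
      using True
    proof (induction i)
      case (Suc i)
      show ?case
      proof (cases "i = 0")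
        case True
        then show ?thesis
          using permutes_in_image[OF \<sigma>, of 1] Suc by auto
      next
        case False
        then have "\<sigma> i < \<sigma> (Suc i)"
          using mono Suc.prems by (auto simp: strict_mono_on_def)
        with False Suc show ?thesis
          by simp
      qed
    qed simp
    ultimately show ?thesis
      by simp
  next
    case False
    then show ?thesis
      using \<sigma> by (simp add: permutes_not_in)
  qed
qed

section \<open>Shuffle permutations by the origin of the last letter\<close>

lemma shuffle_perms_0: "shuffle_perms 0 q = {id}" "shuffle_perms p 0 = {id}"
  using strict_mono_on_permutes_id permutes_id[of "{1..q}"] permutes_id[of "{1..p}"]
  by (auto simp: shuffle_perms_def strict_mono_on_def)

lemma finite_shuffle_perms: "finite (shuffle_perms p q)"
  by (rule finite_subset[OF _ finite_permutations[of "{1..p + q}"]]) (auto simp: shuffle_perms_def)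

lemma permutes_last_fixed:
  assumes "\<sigma> permutes {1..Suc n}" "\<sigma> (Suc n) = Suc n"
  shows "\<sigma> permutes {1..n}"
proof (rule permutes_superset[OF assms(1)])
  fix x assume "x \<in> {1..Suc n} - {1..n}"
  then have "x = Suc n"
    by auto
  with assms(2) show "\<sigma> x = x"
    by simp
qed

text \<open>These are the shuffles whose last letter is the last \<open>k\<close>; removing it
  leaves the first word unchanged.\<close>

lemma shuffle_perms_fixing_last:
  "{\<sigma> \<in> shuffle_perms (Suc p) (Suc q). \<sigma> (Suc (Suc (p + q))) = Suc (Suc (p + q))} = shuffle_perms (Suc p) q"
proof (intro equalityI subsetI)
  fix \<sigma> assume "\<sigma> \<in> {\<sigma> \<in> shuffle_perms (Suc p) (Suc q). \<sigma> (Suc (Suc (p + q))) = Suc (Suc (p + q))}"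
  then show "\<sigma> \<in> shuffle_perms (Suc p) q"
    using permutes_last_fixed[of \<sigma> "Suc (p + q)"] by (auto simp: shuffle_perms_def strict_mono_on_def)
next
  fix \<sigma> assume \<sigma>: "\<sigma> \<in> shuffle_perms (Suc p) q"
  then have perm: "\<sigma> permutes {1..Suc (p + q)}"
    by (simp add: shuffle_perms_def)
  then have last: "\<sigma> (Suc (Suc (p + q))) = Suc (Suc (p + q))"
    by (simp add: permutes_not_in)
  have bound: "\<sigma> i \<le> Suc (p + q)" if "1 \<le> i" "i \<le> Suc (p + q)" for i
    using permutes_in_image[OF perm, of i] that by auto
  have "\<sigma> i < \<sigma> j" if ij: "p + 2 \<le> i" "i < j" "j \<le> p + q + 2" for i j
  proof (cases "j = p + q + 2")
    case True
    have "\<sigma> i \<le> Suc (p + q)"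
      by (rule bound) (use ij in auto)
    with True last show ?thesis
      by simp
  next
    case False
    with \<sigma> ij show ?thesis
      by (auto simp: shuffle_perms_def strict_mono_on_def)
  qed
  then have "strict_mono_on {p + 2..p + q + 2} \<sigma>"
    by (auto simp: strict_mono_on_def)
  moreover have "\<sigma> permutes {1..Suc (Suc (p + q))}"
    by (rule permutes_subset[OF perm]) auto
  ultimately show "\<sigma> \<in> {\<sigma> \<in> shuffle_perms (Suc p) (Suc q). \<sigma> (Suc (Suc (p + q))) = Suc (Suc (p + q))}"
    using \<sigma> last by (simp add: shuffle_perms_def)
qed

text \<open>The remaining shuffles end in the last \<open>g\<close>, since an increasing block takes
  its largest value at its end. Composition with \<open>last_to\<close> carries the index
  \<open>Suc p\<close> of that letter beyond the block of the second word.\<close>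

lemma shuffle_perms_moving_last:
  "{\<sigma> \<in> shuffle_perms (Suc p) (Suc q). \<sigma> (Suc (Suc (p + q))) \<noteq> Suc (Suc (p + q))}
     = (\<lambda>\<sigma>. \<sigma> \<circ> last_to p (Suc q)) ` shuffle_perms p (Suc q)"
proof (intro equalityI subsetI)
  let ?n = "Suc (p + q)" and ?c = "last_to p (Suc q)"
  have c: "?c permutes {1..Suc ?n}"
    using last_to_permutes[of p "Suc q"] by simp
  fix \<sigma> assume "\<sigma> \<in> {\<sigma> \<in> shuffle_perms (Suc p) (Suc q). \<sigma> (Suc ?n) \<noteq> Suc ?n}"
  then have perm: "\<sigma> permutes {1..Suc ?n}" and mg: "strict_mono_on {1..Suc p} \<sigma>"
    and mk: "strict_mono_on {p + 2..p + q + 2} \<sigma>" and neq: "\<sigma> (Suc ?n) \<noteq> Suc ?n"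
    by (auto simp: shuffle_perms_def)
  have bound: "\<sigma> i \<le> Suc ?n" if "1 \<le> i" "i \<le> Suc ?n" for i
    using permutes_in_image[OF perm, of i] that by auto
  obtain i where i: "1 \<le> i" "i \<le> Suc ?n" "\<sigma> i = Suc ?n"
  proof -
    have "Suc ?n \<in> \<sigma> ` {1..Suc ?n}"
      unfolding permutes_image[OF perm] by simp
    then show ?thesis
      using that by auto
  qed
  have "i = Suc p"
  proof (rule ccontr)
    assume "i \<noteq> Suc p"
    then consider "i < Suc p" | "Suc p < i" "i < Suc ?n"
      using i neq by (metis le_neq_implies_less linorder_neqE_nat)
    then show False
    proof cases
      case 1
      then have "\<sigma> i < \<sigma> (Suc p)"
        using i by (intro strict_mono_onD[OF mg]) auto
      with i bound[of "Suc p"] show False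
        by simp
    next
      case 2
      then have "\<sigma> i < \<sigma> (Suc ?n)"
        using mk by (auto simp: strict_mono_on_def)
      with i bound[of "Suc ?n"] show False
        by simp
    qed
  qed
  with i have last: "\<sigma> (Suc p) = Suc ?n"
    by simp
  \<comment> \<open>Undoing \<open>last_to\<close> makes the last position a fixed point, which can
    then be forgotten.\<close>
  let ?\<tau> = "\<sigma> \<circ> inv_into UNIV ?c"
  have \<tau>: "?\<tau> i = (if i = Suc ?n then Suc ?n else if p < i \<and> i \<le> ?n then \<sigma> (Suc i) else \<sigma> i)" for i
    using last by (simp add: inv_last_to less_Suc_eq_le)
  have "?\<tau> permutes {1..?n}"
    by (rule permutes_last_fixed[OF permutes_compose[OF permutes_inv[OF c] perm]]) (unfold \<tau>, simp)
  moreover have "strict_mono_on {1..p} ?\<tau>"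
  proof (rule strict_mono_onI)
    fix i j assume "i \<in> {1..p}" "j \<in> {1..p}" "i < j"
    then show "?\<tau> i < ?\<tau> j"
      unfolding \<tau> using strict_mono_onD[OF mg, of i j] by simp
  qed
  moreover have "strict_mono_on {p + 1..p + Suc q} ?\<tau>"
  proof (rule strict_mono_onI)
    fix i j assume "i \<in> {p + 1..p + Suc q}" "j \<in> {p + 1..p + Suc q}" "i < j"
    then show "?\<tau> i < ?\<tau> j"
      unfolding \<tau> using strict_mono_onD[OF mk, of "Suc i" "Suc j"] by simp
  qed
  ultimately have "?\<tau> \<in> shuffle_perms p (Suc q)"
    by (simp add: shuffle_perms_def)
  moreover have "\<sigma> = ?\<tau> \<circ> ?c"
    by (simp add: comp_assoc permutes_inv_o[OF c])
  ultimately show "\<sigma> \<in> (\<lambda>\<sigma>. \<sigma> \<circ> ?c) ` shuffle_perms p (Suc q)"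
    by blast
next
  let ?n = "Suc (p + q)" and ?c = "last_to p (Suc q)"
  have c: "?c permutes {1..Suc ?n}"
    using last_to_permutes[of p "Suc q"] by simp
  fix \<rho> assume "\<rho> \<in> (\<lambda>\<sigma>. \<sigma> \<circ> ?c) ` shuffle_perms p (Suc q)"
  then obtain \<sigma> where \<rho>: "\<rho> = \<sigma> \<circ> ?c" and \<sigma>: "\<sigma> \<in> shuffle_perms p (Suc q)"
    by blast
  have perm: "\<sigma> permutes {1..?n}" and mg: "strict_mono_on {1..p} \<sigma>"
    and mk: "strict_mono_on {p + 1..?n} \<sigma>"
    using \<sigma> by (simp_all add: shuffle_perms_def)
  have bound: "\<sigma> i < Suc ?n" if "1 \<le> i" "i \<le> ?n" for i
    using permutes_in_image[OF perm, of i] that by auto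
  have last: "\<sigma> (Suc ?n) = Suc ?n"
    using perm by (simp add: permutes_not_in)
  have \<rho>_apply: "\<rho> i = (if i = Suc p then Suc ?n else if Suc p < i \<and> i \<le> Suc ?n then \<sigma> (i - 1) else \<sigma> i)" for i
    using last by (simp add: \<rho> last_to_apply)
  have "\<rho> permutes {1..Suc ?n}"
    unfolding \<rho> by (rule permutes_compose[OF c permutes_subset[OF perm]]) auto
  moreover have "strict_mono_on {1..Suc p} \<rho>"
  proof (rule strict_mono_onI)
    fix i j assume "i \<in> {1..Suc p}" "j \<in> {1..Suc p}" "i < j"
    then show "\<rho> i < \<rho> j"
      unfolding \<rho>_apply using strict_mono_onD[OF mg, of i j] bound[of i] by simp
  qed
  moreover have "strict_mono_on {Suc p + 1..Suc p + Suc q} \<rho>"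
  proof (rule strict_mono_onI)
    fix i j assume "i \<in> {Suc p + 1..Suc p + Suc q}" "j \<in> {Suc p + 1..Suc p + Suc q}" "i < j"
    then show "\<rho> i < \<rho> j"
      unfolding \<rho>_apply using strict_mono_onD[OF mk, of "i - 1" "j - 1"] by simp
  qed
  moreover have "\<rho> (Suc ?n) < Suc ?n"
    using bound[of ?n] by (simp add: \<rho>_apply)
  ultimately show "\<rho> \<in> {\<sigma> \<in> shuffle_perms (Suc p) (Suc q). \<sigma> (Suc ?n) \<noteq> Suc ?n}"
    by (simp add: shuffle_perms_def)
qed

section \<open>The sum over permutations satisfies the recursion on the last letter\<close>

context group
begin

lemma list_mult_closed [simp]: "set xs \<subseteq> carrier G \<Longrightarrow> list_mult G xs \<in> carrier G"
  by (induction xs) (auto simp: list_mult_def)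

lemma list_mult_snoc: "set xs \<subseteq> carrier G \<Longrightarrow> g \<in> carrier G \<Longrightarrow> list_mult G (xs @ [g]) = list_mult G xs \<otimes> g"
proof (induction xs)
  case (Cons x xs)
  then have "list_mult G xs \<in> carrier G"
    by simp
  with Cons show ?case
    by (simp add: list_mult_def m_assoc)
qed (simp add: list_mult_def)

text \<open>\<open>\<sigma>\<close> fixes the new position, where the conjugating product is empty,
  so the appended letter is \<open>k\<close> itself.\<close>

lemma shuffle_word_snoc_right:
  assumes \<sigma>: "\<sigma> \<in> shuffle_perms p q" and len: "length gs = p" "length ks = q" and k: "k \<in> carrier G"
  shows "shuffle_word G \<sigma> gs (ks @ [k]) = shuffle_word G \<sigma> gs ks @ [k]"
proof -
  have perm: "\<sigma> permutes {1..p + q}"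
    using \<sigma> by (simp add: shuffle_perms_def)
  have "shuffle_letter G \<sigma> gs (ks @ [k]) (inv_into UNIV \<sigma> j) = shuffle_letter G \<sigma> gs ks (inv_into UNIV \<sigma> j)"
    if "j \<in> set [1..<p + q + 1]" for j
  proof -
    have "inv_into UNIV \<sigma> j \<in> {1..p + q}"
      using permutes_in_image[OF permutes_inv[OF perm], of j] that by auto
    then show ?thesis
      using len by (auto simp: shuffle_letter_def Let_def nth_append)
  qed
  moreover have last: "\<sigma> (Suc (p + q)) = Suc (p + q)"
    using perm by (simp add: permutes_not_in)
  then have "inv_into UNIV \<sigma> (Suc (p + q)) = Suc (p + q)"
    by (simp add: permutes_inv_eq[OF perm])
  then have "shuffle_letter G \<sigma> gs (ks @ [k]) (inv_into UNIV \<sigma> (Suc (p + q))) = k"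
    using k len last by (simp add: shuffle_letter_def Let_def list_mult_def nth_append)
  ultimately show ?thesis
    using len by (simp add: shuffle_word_def)
qed

text \<open>The index of each letter of \<open>ks\<close> and the length of the first word both grow
  by one, so equally many letters are dropped and the conjugating product \<open>u\<close> becomes
  \<open>u \<otimes> g\<close>. The extra \<open>g\<close> is moved into the conjugated second
  word.\<close>

lemma shuffle_word_snoc_left:
  assumes \<sigma>: "\<sigma> \<in> shuffle_perms p q" and len: "length gs = p" "length ks = q"
    and gs: "set gs \<subseteq> carrier G" and g: "g \<in> carrier G" and ks: "set ks \<subseteq> carrier G"
  shows "shuffle_word G (\<sigma> \<circ> last_to p q) (gs @ [g]) ks = shuffle_word G \<sigma> gs (map (conj_by G g) ks) @ [g]"
proof -
  let ?\<rho> = "\<sigma> \<circ> last_to p q"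
  have perm: "\<sigma> permutes {1..p + q}"
    using \<sigma> by (simp add: shuffle_perms_def)
  have inv_\<rho>: "inv_into UNIV ?\<rho> j = inv_into UNIV (last_to p q) (inv_into UNIV \<sigma> j)" for j
    using o_inv_distrib[OF permutes_bij[OF perm] permutes_bij[OF last_to_permutes[of p q]]] by simp
  have "shuffle_letter G ?\<rho> (gs @ [g]) ks (inv_into UNIV ?\<rho> j) = shuffle_letter G \<sigma> gs (map (conj_by G g) ks) (inv_into UNIV \<sigma> j)"
    if "j \<in> set [1..<p + q + 1]" for j
  proof -
    define i where "i = inv_into UNIV \<sigma> j"
    have i: "1 \<le> i" "i \<le> p + q"
      using permutes_in_image[OF permutes_inv[OF perm], of j] that by (auto simp: i_def)
    show ?thesis
    proof (cases "i \<le> p")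
      case True
      then have "inv_into UNIV ?\<rho> j = i"
        using i by (simp add: inv_\<rho> inv_last_to flip: i_def)
      with True i show ?thesis
        using len by (auto simp: shuffle_letter_def Let_def nth_append simp flip: i_def)
    next
      case False
      then have inv_j: "inv_into UNIV ?\<rho> j = Suc i"
        using i by (simp add: inv_\<rho> inv_last_to flip: i_def)
      have "?\<rho> (Suc i) = \<sigma> i"
        using False i by (simp add: last_to_apply)
      \<comment> \<open>Nothing beyond \<open>gs\<close> is dropped, so that \<open>g\<close> stays
        at the end of the product.\<close>
      moreover have "p + \<sigma> i - i \<le> p"
        using shuffle_perms_apply_le[OF \<sigma>, of i] False i by simp
      moreover have "list_mult G (drop (p + \<sigma> i - i) gs @ [g]) = list_mult G (drop (p + \<sigma> i - i) gs) \<otimes> g"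
        using gs g by (intro list_mult_snoc) (auto dest: in_set_dropD)
      moreover have "ks ! (i - p - 1) \<in> carrier G" "i - p - 1 < length ks"
        using ks len False i by (auto intro!: subsetD[OF ks nth_mem])
      moreover have "set (drop (p + \<sigma> i - i) gs) \<subseteq> carrier G"
        using gs by (auto dest: in_set_dropD)
      ultimately show ?thesis
        using False g len by (simp add: shuffle_letter_def Let_def inv_j conj_by_conj_by flip: i_def)
    qed
  qed
  moreover have "inv_into UNIV \<sigma> (Suc (p + q)) = Suc (p + q)"
    using permutes_not_in[OF perm] by (simp add: permutes_inv_eq[OF perm])
  then have "shuffle_letter G ?\<rho> (gs @ [g]) ks (inv_into UNIV ?\<rho> (Suc (p + q))) = g"
    unfolding inv_\<rho> using len by (simp add: shuffle_letter_def Let_def inv_last_to nth_append)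
  ultimately show ?thesis
    using len by (simp add: shuffle_word_def)
qed

text \<open>Both sides obey the same recursion: the sum over permutations splits according to
  whether the last position is fixed, and the sign of \<open>last_to\<close> is the sign in the
  recursion.\<close>

theorem tau_eq_shuffle:
  assumes "set gs \<subseteq> carrier G" "set ks \<subseteq> carrier G"
  shows "tau G (gs, ks) = shuffle G (\<lambda>x. x) (\<lambda>x. x) gs ks"
  using assms
proof (induction gs ks rule: shuffle_induct)
  case Nil_Nil
  then show ?case
    by (simp add: tau_def shuffle_perms_0 shuffle_word_def flip: id_def)
next
  case (Nil_snoc ks k)
  have "id \<in> shuffle_perms 0 (length ks)"
    by (simp add: shuffle_perms_0)
  from shuffle_word_snoc_right[OF this, of "[]" ks k] Nil_snoc show ?case
    by (simp add: tau_def shuffle_perms_0 flip: Nil_snoc.IH)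
next
  case (snoc_Nil gs g)
  have "id \<in> shuffle_perms (length gs) 0"
    by (simp add: shuffle_perms_0)
  from shuffle_word_snoc_left[OF this, of gs "[]" g] snoc_Nil show ?case
    by (simp add: tau_def shuffle_perms_0 flip: snoc_Nil.IH)
next
  case (snoc_snoc gs g ks k)
  let ?p = "length gs" and ?q = "length ks"
  let ?n = "Suc (Suc (?p + ?q))" and ?c = "last_to ?p (Suc ?q)"
  let ?t = "\<lambda>\<sigma>. frag_cmul (sign \<sigma>) (frag_of (shuffle_word G \<sigma> (gs @ [g]) (ks @ [k])))"
  have cl: "set gs \<subseteq> carrier G" "g \<in> carrier G" "set ks \<subseteq> carrier G" "k \<in> carrier G"
    using snoc_snoc.prems by auto
  have "tau G (gs @ [g], ks @ [k]) = (\<Sum>\<sigma>\<in>shuffle_perms (Suc ?p) (Suc ?q). ?t \<sigma>)"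
    by (simp add: tau_def)
  also have "\<dots> = (\<Sum>\<sigma>\<in>{\<sigma> \<in> shuffle_perms (Suc ?p) (Suc ?q). \<sigma> ?n = ?n}. ?t \<sigma>)
      + (\<Sum>\<sigma>\<in>{\<sigma> \<in> shuffle_perms (Suc ?p) (Suc ?q). \<sigma> ?n \<noteq> ?n}. ?t \<sigma>)"
    by (subst sum.union_disjoint[symmetric]) (auto simp: finite_shuffle_perms intro!: sum.cong)
  also have "(\<Sum>\<sigma>\<in>{\<sigma> \<in> shuffle_perms (Suc ?p) (Suc ?q). \<sigma> ?n = ?n}. ?t \<sigma>)
      = (\<Sum>\<sigma>\<in>shuffle_perms (Suc ?p) ?q.
          snoc_map k (frag_cmul (sign \<sigma>) (frag_of (shuffle_word G \<sigma> (gs @ [g]) ks))))"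
    unfolding shuffle_perms_fixing_last
  proof (rule sum.cong[OF refl])
    fix \<sigma> assume "\<sigma> \<in> shuffle_perms (Suc ?p) ?q"
    then have "shuffle_word G \<sigma> (gs @ [g]) (ks @ [k]) = shuffle_word G \<sigma> (gs @ [g]) ks @ [k]"
      using cl by (intro shuffle_word_snoc_right) auto
    then show "?t \<sigma> = snoc_map k (frag_cmul (sign \<sigma>) (frag_of (shuffle_word G \<sigma> (gs @ [g]) ks)))"
      by (simp add: frag_extend_cmul)
  qed
  also have "\<dots> = snoc_map k (shuffle G (\<lambda>x. x) (\<lambda>x. x) (gs @ [g]) ks)"
  proof -
    have "snoc_map k (tau G (gs @ [g], ks)) = (\<Sum>\<sigma>\<in>shuffle_perms (Suc ?p) ?q.
        snoc_map k (frag_cmul (sign \<sigma>) (frag_of (shuffle_word G \<sigma> (gs @ [g]) ks))))"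
      by (simp add: tau_def frag_extend_sum')
    then show ?thesis
      using snoc_snoc.IH(1) cl by simp
  qed
  also have "(\<Sum>\<sigma>\<in>{\<sigma> \<in> shuffle_perms (Suc ?p) (Suc ?q). \<sigma> ?n \<noteq> ?n}. ?t \<sigma>)
      = (\<Sum>\<sigma>\<in>shuffle_perms ?p (Suc ?q). ?t (\<sigma> \<circ> ?c))"
  proof -
    have "inj_on (\<lambda>\<sigma>. \<sigma> \<circ> ?c) (shuffle_perms ?p (Suc ?q))"
      by (intro inj_onI) (metis comp_assoc comp_id permutes_inv_o(1)[OF last_to_permutes])
    then show ?thesis
      unfolding shuffle_perms_moving_last by (subst sum.reindex) (simp_all add: comp_def)
  qed
  also have "\<dots> = (\<Sum>\<sigma>\<in>shuffle_perms ?p (Suc ?q). frag_cmul ((- 1) ^ Suc ?q) (snoc_map g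
        (frag_cmul (sign \<sigma>) (frag_of (shuffle_word G \<sigma> gs (map (conj_by G g) (ks @ [k])))))))"
  proof (rule sum.cong[OF refl])
    fix \<sigma> assume \<sigma>: "\<sigma> \<in> shuffle_perms ?p (Suc ?q)"
    then have "permutation \<sigma>"
      using permutation_if_permutes by (auto simp: shuffle_perms_def)
    then have "sign (\<sigma> \<circ> ?c) = sign \<sigma> * (- 1) ^ Suc ?q"
      by (simp only: sign_compose permutation_if_permutes[OF last_to_permutes] sign_last_to)
    moreover have "shuffle_word G (\<sigma> \<circ> ?c) (gs @ [g]) (ks @ [k])
        = shuffle_word G \<sigma> gs (map (conj_by G g) (ks @ [k])) @ [g]"
      using \<sigma> cl by (intro shuffle_word_snoc_left) auto
    ultimately show "?t (\<sigma> \<circ> ?c) = frag_cmul ((- 1) ^ Suc ?q) (snoc_map g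
        (frag_cmul (sign \<sigma>) (frag_of (shuffle_word G \<sigma> gs (map (conj_by G g) (ks @ [k]))))))"
      by (simp add: frag_extend_cmul mult.commute del: map_append)
  qed
  also have "\<dots> = frag_cmul ((- 1) ^ Suc ?q)
      (snoc_map g (shuffle G (\<lambda>x. x) (\<lambda>x. x) gs (map (conj_by G g) (ks @ [k]))))"
  proof -
    have "tau G (gs, map (conj_by G g) (ks @ [k])) = shuffle G (\<lambda>x. x) (\<lambda>x. x) gs (map (conj_by G g) (ks @ [k]))"
      using cl by (intro snoc_snoc.IH(2)) auto
    moreover have "frag_cmul ((- 1) ^ Suc ?q) (snoc_map g (tau G (gs, map (conj_by G g) (ks @ [k]))))
        = (\<Sum>\<sigma>\<in>shuffle_perms ?p (Suc ?q). frag_cmul ((- 1) ^ Suc ?q) (snoc_map g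
            (frag_cmul (sign \<sigma>) (frag_of (shuffle_word G \<sigma> gs (map (conj_by G g) (ks @ [k])))))))"
      by (simp add: tau_def frag_extend_sum' frag_cmul_sum del: map_append)
    ultimately show ?thesis
      by simp
  qed
  finally show ?case
    by (simp only: shuffle_snoc_snoc)
qed

end

section \<open>The shuffle map as a morphism of resolutions\<close>

context group
begin

abbreviation GG :: "('a \<times> 'a) monoid" where
  "GG \<equiv> conj_semidirect G"

abbreviation incl_G :: "'a \<Rightarrow> 'a \<times> 'a" where
  "incl_G g \<equiv> (\<one>, g)"

abbreviation incl_K :: "'a \<Rightarrow> 'a \<times> 'a" where
  "incl_K k \<equiv> (k, \<one>)"

lemma shuffle_letters_conj_semidirect: "shuffle_letters G GG incl_G incl_K"
  by (intro shuffle_letters.intro group_conj_semidirect is_group shuffle_letters_axioms.intro homI)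
    (auto simp: conj_by_def)

text \<open>The equivariant extension of the shuffle sum from the basis: translating a word that
  ends in \<open>1\<close> by \<open>pos x\<close> leaves the inverse of \<open>pos x\<close> as its
  last letter.\<close>

definition shuffle_map :: "'a list \<times> 'a list \<Rightarrow> ('a \<times> 'a) list \<Rightarrow>\<^sub>0 int" where
  "shuffle_map x = snoc_map (inv\<^bsub>GG\<^esub> (pos tensor_complex x))
     (shuffle G incl_G incl_K (fst (idx tensor_complex x)) (snd (idx tensor_complex x)))"

text \<open>The last letter is factored as \<open>(1, g)(k, 1)\<close>, the form in which letters of
  either word can be merged into it.\<close>

lemma shuffle_map_snoc:
  assumes "g \<in> carrier G" "k \<in> carrier G"
  shows "shuffle_map (gs @ [g], ks @ [k])
    = snoc_map (incl_G g \<otimes>\<^bsub>GG\<^esub> incl_K k) (shuffle G incl_G incl_K gs (map (conj_by G g) ks))"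
  using assms by (simp add: shuffle_map_def inv_conj_semidirect)

lemma equivariant_shuffle_map:
  "equivariant GG tensor_complex (group.bar_complex GG) n n shuffle_map"
proof -
  interpret GG: group GG by (rule group_conj_semidirect)
  interpret T: equivariant_complex GG tensor_complex by (rule equivariant_tensor_complex)
  interpret L: shuffle_letters G GG incl_G incl_K by (rule shuffle_letters_conj_semidirect)
  show ?thesis
    unfolding equivariant_def
  proof (intro ballI conjI)
    fix x assume x: "x \<in> gens tensor_complex n"
    note p = T.pos_closed[OF x]
    obtain us vs where z: "idx tensor_complex x = (us, vs)" "(us, vs) \<in> bituples G n"
      using T.idx_gens[OF x] by (metis surj_pair tensor_complex_simps(2))
    have "keys (L.S us vs) \<subseteq> tuples GG n"
      using L.keys_shuffle[of us vs] z(2) by (auto simp: bituples_iff)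
    then show "keys (shuffle_map x) \<subseteq> gens GG.bar_complex n"
      using keys_snoc_map[OF _ GG.inv_closed[OF p], of "L.S us vs" n] by (simp add: shuffle_map_def z)
    fix \<gamma> assume \<gamma>: "\<gamma> \<in> carrier GG"
    show "shuffle_map (act tensor_complex \<gamma> x) = frag_map (act GG.bar_complex \<gamma>) (shuffle_map x)"
      unfolding shuffle_map_def T.idx_act[OF x \<gamma>] T.pos_act[OF x \<gamma>] GG.inv_mult_group[OF \<gamma> p]
      by (simp add: GG.E_action_mult_last L.frag_map_mult_last_snoc_map)
  qed
qed

text \<open>The inner faces obey the Leibniz rule. The face at the end merges the last letter of a
  shuffle into \<open>(1, g)(k, 1)\<close>: a letter from \<open>gs\<close> joins \<open>g\<close>,
  while a letter from \<open>ks\<close>, conjugated by \<open>g\<close>, passes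
  \<open>(1, g)\<close>, loses its conjugation and joins \<open>k\<close>. These are the last faces
  in the two directions.\<close>

lemma E_boundary_shuffle_map:
  assumes x: "x \<in> gens tensor_complex (Suc n)"
  shows "frag_extend (E_boundary GG) (shuffle_map x) = frag_extend shuffle_map (tensor_boundary G x)"
proof -
  interpret GG: group GG by (rule group_conj_semidirect)
  interpret L: shuffle_letters G GG incl_G incl_K by (rule shuffle_letters_conj_semidirect)
  obtain gs ks g k where xx: "x = (gs @ [g], ks @ [k])" and z: "(gs, ks) \<in> bituples G (Suc n)"
    and g: "g \<in> carrier G" and k: "k \<in> carrier G"
    using x by (rule tensor_gensE)
  let ?a = "incl_G g \<otimes>\<^bsub>GG\<^esub> incl_K k" and ?c = "map (conj_by G g)" and ?p = "length gs" and ?q = "length ks"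
  have cl: "set gs \<subseteq> carrier G" "set ks \<subseteq> carrier G" and n: "?p + ?q = Suc n"
    using z by (simp_all add: bituples_iff)
  then have ne: "gs \<noteq> [] \<or> ks \<noteq> []"
    by auto
  have cc: "set (?c ks) \<subseteq> carrier G"
    using cl g by auto
  have S_len: "length w = Suc n" if "w \<in> keys (L.S gs (?c ks))" for w
    using L.keys_shuffle[OF cl(1) cc] that n by (auto simp: tuples_def)
  define A where "A = snoc_map ?a (frag_extend (\<lambda>v. L.S v (?c ks)) (front_faces G gs))"
  define B where "B = snoc_map ?a (frag_extend (\<lambda>v. L.S gs (?c v)) (front_faces G ks))"
  define Y where "Y = (if ks = [] then 0 else
    snoc_map (incl_G g \<otimes>\<^bsub>GG\<^esub> incl_K (last ks \<otimes> k)) (L.S gs (?c (butlast ks))))"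
  define Z where "Z = (if gs = [] then 0 else
    snoc_map (incl_G (last gs \<otimes> g) \<otimes>\<^bsub>GG\<^esub> incl_K k) (L.S (butlast gs) (map (conj_by G (last gs \<otimes> g)) ks)))"
  have M: "frag_map (mult_last GG ?a) (L.S gs (?c ks)) = Y + frag_cmul ((- 1) ^ ?q) Z"
  proof -
    have "incl_K (conj_by G g (last ks)) \<otimes>\<^bsub>GG\<^esub> ?a = incl_G g \<otimes>\<^bsub>GG\<^esub> incl_K (last ks \<otimes> k)" if "ks \<noteq> []"
      using subsetD[OF cl(2) last_in_set[OF that]] g k by (simp add: conj_by_mult)
    moreover have "incl_G (last gs) \<otimes>\<^bsub>GG\<^esub> ?a = incl_G (last gs \<otimes> g) \<otimes>\<^bsub>GG\<^esub> incl_K k"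
        "map (conj_by G (last gs)) (?c ks) = map (conj_by G (last gs \<otimes> g)) ks" if "gs \<noteq> []"
      using subsetD[OF cl(1) last_in_set[OF that]] g k cl
      by (simp_all add: map_conj_by_conj_by conj_by_conj_by del: map_map)
    ultimately show ?thesis
      using ne by (subst L.mult_last_shuffle)
        (auto simp: Y_def Z_def last_map map_butlast simp del: mult_conj_semidirect map_map)
  qed
  have "frag_extend (E_boundary GG) (shuffle_map x) = frag_extend (front_faces GG) (snoc_map ?a (L.S gs (?c ks)))"
    unfolding xx shuffle_map_snoc[OF g k] frag_extend_frag_extend
    by (rule frag_extend_eq) (simp add: E_boundary_front_faces S_len del: mult_conj_semidirect)
  also have "\<dots> = snoc_map ?a (frag_extend (front_faces GG) (L.S gs (?c ks)))
      + frag_cmul ((- 1) ^ (?p + ?q)) (Y + frag_cmul ((- 1) ^ ?q) Z)"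
    using L.front_faces_snoc_map_shuffle[OF cl(1) cc, of ?a] ne by (simp add: M del: mult_conj_semidirect)
  also have "\<dots> = A + frag_cmul ((- 1) ^ ?p) B + frag_cmul ((- 1) ^ (?p + ?q)) (Y + frag_cmul ((- 1) ^ ?q) Z)"
    unfolding L.front_faces_shuffle[OF cl(1) cc] front_faces_map[OF conj_by_hom[OF g] cl(2)] A_def B_def
    by (simp add: frag_extend_add frag_extend_cmul frag_extend_frag_extend del: mult_conj_semidirect)
  \<comment> \<open>Regrouped by direction: \<open>A\<close> with \<open>Z\<close> is the boundary
    of the first word, \<open>B\<close> with \<open>Y\<close> that of the second.\<close>
  also have "\<dots> = (A + frag_cmul ((- 1) ^ ?p) Z) + frag_cmul ((- 1) ^ ?p) (B + frag_cmul ((- 1) ^ ?q) Y)"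
    by (cases "even ?p"; cases "even ?q") (simp_all add: algebra_simps)
  also have "A + frag_cmul ((- 1) ^ ?p) Z
      = frag_extend shuffle_map (cross (E_boundary G (gs @ [g])) (frag_of (ks @ [k])))"
  proof (cases gs rule: rev_cases)
    case Nil
    then show ?thesis
      by (simp add: A_def Z_def)
  next
    case (snoc u g')
    have g': "g' \<in> carrier G"
      using cl by (simp add: snoc)
    have "E_boundary G (gs @ [g]) = snoc_map g (front_faces G gs) + frag_cmul ((- 1) ^ ?p) (frag_of (u @ [g' \<otimes> g]))"
      using E_boundary_snoc[of G u g' g] by (simp add: snoc)
    then have "frag_extend shuffle_map (cross (E_boundary G (gs @ [g])) (frag_of (ks @ [k])))
        = frag_extend (\<lambda>v. shuffle_map (v @ [g], ks @ [k])) (front_faces G gs)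
          + frag_cmul ((- 1) ^ ?p) (shuffle_map (u @ [g' \<otimes> g], ks @ [k]))"
      by (simp add: cross_frag_of_right frag_extend_add frag_extend_cmul frag_extend_frag_extend)
    also have "\<dots> = A + frag_cmul ((- 1) ^ ?p) Z"
      using snoc shuffle_map_snoc[OF m_closed[OF g' g] k]
      by (simp add: A_def Z_def shuffle_map_snoc[OF g k] frag_extend_frag_extend del: mult_conj_semidirect)
    finally show ?thesis ..
  qed
  also have "B + frag_cmul ((- 1) ^ ?q) Y
      = frag_extend shuffle_map (cross (frag_of (gs @ [g])) (E_boundary G (ks @ [k])))"
  proof (cases ks rule: rev_cases)
    case Nil
    then show ?thesis
      by (simp add: B_def Y_def)
  next
    case (snoc t k')
    have k': "k' \<in> carrier G"
      using cl by (simp add: snoc)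
    have "E_boundary G (ks @ [k]) = snoc_map k (front_faces G ks) + frag_cmul ((- 1) ^ ?q) (frag_of (t @ [k' \<otimes> k]))"
      using E_boundary_snoc[of G t k' k] by (simp add: snoc)
    then have "frag_extend shuffle_map (cross (frag_of (gs @ [g])) (E_boundary G (ks @ [k])))
        = frag_extend (\<lambda>v. shuffle_map (gs @ [g], v @ [k])) (front_faces G ks)
          + frag_cmul ((- 1) ^ ?q) (shuffle_map (gs @ [g], t @ [k' \<otimes> k]))"
      by (simp add: cross_frag_of_left frag_extend_add frag_extend_cmul frag_extend_frag_extend)
    also have "\<dots> = B + frag_cmul ((- 1) ^ ?q) Y"
      using snoc shuffle_map_snoc[OF g m_closed[OF k' k]]
      by (simp add: B_def Y_def shuffle_map_snoc[OF g k] frag_extend_frag_extend del: mult_conj_semidirect)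
    finally show ?thesis ..
  qed
  finally show ?thesis
    by (simp add: xx tensor_boundary_cross frag_extend_add frag_extend_cmul)
qed

lemma chain_map_shuffle_map: "chain_map GG tensor_complex (group.bar_complex GG) (\<lambda>_. shuffle_map)"
  unfolding chain_map_def
proof (intro conjI allI ballI equivariant_shuffle_map)
  interpret GG: group GG by (rule group_conj_semidirect)
  show "frag_extend (bd GG.bar_complex) (shuffle_map x) = frag_extend shuffle_map (bd tensor_complex x)"
    if "x \<in> gens tensor_complex (Suc n)" for n x
    using E_boundary_shuffle_map[OF that] by simp
  show "augmentation (shuffle_map x) = 1" if x: "x \<in> gens tensor_complex 0" for x
    using x
  proof (rule tensor_gensE)
    fix gs ks g k
    assume "x = (gs @ [g], ks @ [k])" "(gs, ks) \<in> bituples G 0"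
    then show ?thesis
      by (simp add: shuffle_map_def bituples_iff)
  qed
qed

section \<open>Morphisms of resolutions as chain maps given on generators\<close>

lemma E_chains_eq: "E_chains GG n = free_Abelian_group (gens (group.bar_complex GG) n)"
  by (simp add: E_chains_def group.bar_complex_simps[OF group_conj_semidirect])

lemma tensor_chains_eq: "tensor_chains G n = free_Abelian_group (gens tensor_complex n)"
  by (simp add: tensor_chains_def)

lemma resolution_morphism_of_chain_map:
  assumes f: "chain_map GG tensor_complex (group.bar_complex GG) f"
  shows "resolution_morphism G (\<lambda>n. frag_extend (f n))"
proof -
  interpret GG: group GG by (rule group_conj_semidirect)
  interpret B: equivariant_complex GG GG.bar_complex by (rule GG.equivariant_bar_complex)
  have fe: "equivariant GG tensor_complex GG.bar_complex n n (f n)" for n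
    using f by (simp add: chain_map_def)
  show ?thesis
    unfolding resolution_morphism_def E_chains_eq tensor_chains_eq carrier_free_Abelian_group_iff
  proof (intro conjI allI ballI impI)
    show "frag_extend (f n) \<in> hom (free_Abelian_group (gens tensor_complex n))
        (free_Abelian_group (gens GG.bar_complex n))" for n
      using keys_equivariant[OF fe] by (intro homI) (auto simp: frag_extend_add simp del: tensor_complex_simps GG.bar_complex_simps)
    fix n \<gamma> c
    assume "\<gamma> \<in> carrier GG" "c \<in> carrier (free_Abelian_group (gens tensor_complex n))"
    then show "frag_extend (f n) (frag_map (tensor_action G \<gamma>) c) = frag_map (E_action GG \<gamma>) (frag_extend (f n) c)"
      using equivariant_frag_map_act[OF fe, of c n \<gamma>] by simp
  next
    fix n c
    assume "c \<in> carrier (free_Abelian_group (gens tensor_complex (n + 1)))"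
    then have c: "keys c \<subseteq> gens tensor_complex (Suc n)"
      by simp
    show "frag_extend (f n) (frag_extend (tensor_boundary G) c)
        = frag_extend (E_boundary GG) (frag_extend (f (n + 1)) c)"
      unfolding frag_extend_frag_extend
      using f c by (intro frag_extend_eq) (auto simp: chain_map_def)
  next
    fix c
    assume "c \<in> carrier (free_Abelian_group (gens tensor_complex 0))"
    then have "keys c \<subseteq> gens tensor_complex 0"
      by (simp only: carrier_free_Abelian_group_iff)
    then show "augmentation (frag_extend (f 0) c) = augmentation c"
      using f by (subst augmentation_frag_extend[where k = 1]) (auto simp: chain_map_def)
  qed
qed

lemma chain_map_of_resolution_morphism:
  assumes \<phi>: "resolution_morphism G \<phi>"
  shows "chain_map GG tensor_complex (group.bar_complex GG) (\<lambda>n x. \<phi> n (frag_of x))"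
proof -
  interpret GG: group GG by (rule group_conj_semidirect)
  have hom: "\<phi> n \<in> hom (free_Abelian_group (gens tensor_complex n)) (free_Abelian_group (gens GG.bar_complex n))" for n
    using \<phi> unfolding resolution_morphism_def E_chains_eq tensor_chains_eq by blast
  have act: "\<phi> n (frag_map (tensor_action G \<gamma>) c) = frag_map (E_action GG \<gamma>) (\<phi> n c)"
    if "\<gamma> \<in> carrier GG" "keys c \<subseteq> gens tensor_complex n" for n \<gamma> c
    using \<phi> that(1) that(2)[folded carrier_free_Abelian_group_iff]
    unfolding resolution_morphism_def tensor_chains_eq by blast
  have bd: "\<phi> n (frag_extend (tensor_boundary G) c) = frag_extend (E_boundary GG) (\<phi> (Suc n) c)"
    if "keys c \<subseteq> gens tensor_complex (Suc n)" for n c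
    using \<phi> that[folded carrier_free_Abelian_group_iff]
    unfolding resolution_morphism_def tensor_chains_eq Suc_eq_plus1 by blast
  have aug: "augmentation (\<phi> 0 c) = augmentation c" if "keys c \<subseteq> gens tensor_complex 0" for c
    using \<phi> that[folded carrier_free_Abelian_group_iff]
    unfolding resolution_morphism_def tensor_chains_eq by blast
  \<comment> \<open>The boundary of a generator is a combination of generators, so additivity of
    \<open>\<phi> n\<close> is needed to express its value there by the values on
    generators.\<close>
  have lin: "\<phi> n c = frag_extend (\<lambda>x. \<phi> n (frag_of x)) c" if "keys c \<subseteq> gens tensor_complex n" for n c
  proof (rule free_Abelian_group_induct[OF that, where P = "\<lambda>c. \<phi> n c = frag_extend (\<lambda>x. \<phi> n (frag_of x)) c"])
    show "\<phi> n 0 = frag_extend (\<lambda>x. \<phi> n (frag_of x)) 0"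
      using hom_one[OF hom[of n]] by simp
    show "\<phi> n (a - b) = frag_extend (\<lambda>x. \<phi> n (frag_of x)) (a - b)"
      if "keys a \<subseteq> gens tensor_complex n" "keys b \<subseteq> gens tensor_complex n"
        "\<phi> n a = frag_extend (\<lambda>x. \<phi> n (frag_of x)) a" "\<phi> n b = frag_extend (\<lambda>x. \<phi> n (frag_of x)) b" for a b
      using hom_frag_diff[OF hom that(1,2)] that(3,4) by (simp add: frag_extend_diff)
  qed simp
  show ?thesis
    unfolding chain_map_def equivariant_def
  proof (intro conjI allI ballI)
    fix n x assume x: "x \<in> gens tensor_complex n"
    show "keys (\<phi> n (frag_of x)) \<subseteq> gens GG.bar_complex n"
      using hom_in_carrier[OF hom, of "frag_of x" n] x by (simp del: tensor_complex_simps GG.bar_complex_simps)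
    show "\<phi> n (frag_of (act tensor_complex \<gamma> x)) = frag_map (act GG.bar_complex \<gamma>) (\<phi> n (frag_of x))"
      if "\<gamma> \<in> carrier GG" for \<gamma>
      using act[OF that, of "frag_of x" n] x by (simp del: tensor_complex_simps(1))
  next
    fix n x assume x: "x \<in> gens tensor_complex (Suc n)"
    have "frag_extend (E_boundary GG) (\<phi> (Suc n) (frag_of x)) = \<phi> n (tensor_boundary G x)"
      using bd[of "frag_of x" n] x by (simp del: tensor_complex_simps(1))
    also have "\<dots> = frag_extend (\<lambda>x. \<phi> n (frag_of x)) (tensor_boundary G x)"
      by (rule lin[OF keys_tensor_boundary_gens[OF x]])
    finally show "frag_extend (bd GG.bar_complex) (\<phi> (Suc n) (frag_of x))
        = frag_extend (\<lambda>x. \<phi> n (frag_of x)) (bd tensor_complex x)"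
      by simp
  next
    fix x assume "x \<in> gens tensor_complex 0"
    then show "augmentation (\<phi> 0 (frag_of x)) = 1"
      using aug[of "frag_of x"] by (simp del: tensor_complex_simps(1))
  qed
qed

section \<open>The cochain complexes and cochain maps of the statement\<close>

lemma bar_delta_eq_quotient:
  assumes "F \<in> bar_cochains G n"
  shows "bar_delta G n F = delta (quotient_complex bar_complex degenerate_words) n F"
proof -
  interpret B: contracted_complex G bar_complex degenerate_words bar_contraction "[\<one>]"
    by (rule contracted_bar_complex)
  show ?thesis
    using B.delta_quotient assms by (simp add: bar_delta_eq_delta bar_cochains_eq)
qed

lemma tot_delta_eq_quotient:
  assumes "F \<in> tot_cochains G n"
  shows "tot_delta G n F = delta (quotient_complex tensor_complex degenerate_pairs) n F"
proof -
  interpret T: contracted_complex GG tensor_complex degenerate_pairs tensor_contraction "([\<one>], [\<one>])"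
    by (rule contracted_tensor_complex)
  show ?thesis
    using T.delta_quotient assms by (simp add: tot_delta_eq_delta tot_cochains_eq)
qed

lemma bar_cochain_complex: "cochain_complex (bar_cochains G) (bar_delta G)"
proof -
  have "cochain_complex (bar_cochains G) (delta (quotient_complex bar_complex degenerate_words))"
    unfolding bar_cochains_eq[abs_def]
    by (rule equivariant_complex.cochain_complex[OF
          contracted_complex.equivariant_complex_quotient[OF contracted_bar_complex]])
  then show ?thesis
    by (rule cochain_complex_cong) (simp add: bar_delta_eq_quotient)
qed

lemma inclusion_tot_cochain_map:
  "cochain_map (tot_cochains G) (tot_delta G) (full_tot_cochains G) (tot_delta G) (\<lambda>_. id)"
proof -
  have "cochain_map (tot_cochains G) (delta (quotient_complex tensor_complex degenerate_pairs))
      (full_tot_cochains G) (delta tensor_complex) (\<lambda>_. id)"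
    unfolding tot_cochains_eq[abs_def] full_tot_cochains_eq[abs_def]
    by (rule contracted_complex.inclusion_cochain_map[OF contracted_tensor_complex])
  then show ?thesis
    by (rule cochain_map_cong) (simp add: tot_delta_eq_quotient, simp add: tot_delta_eq_delta, simp)
qed

lemma inclusion_tot_iso:
  "cohomology_map (full_tot_cochains G) (tot_delta G) n id \<in> iso (tot_cohomology G n) (full_tot_cohomology G n)"
proof -
  have "cohomology_map (full_tot_cochains G) (delta tensor_complex) n id
      \<in> iso (cohomology (tot_cochains G) (delta (quotient_complex tensor_complex degenerate_pairs)) n)
          (cohomology (full_tot_cochains G) (delta tensor_complex) n)"
    unfolding tot_cochains_eq[abs_def] full_tot_cochains_eq[abs_def]
    by (rule contracted_complex.cohomology_inclusion_iso[OF contracted_tensor_complex])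
  moreover have "tot_cohomology G n
      = cohomology (tot_cochains G) (delta (quotient_complex tensor_complex degenerate_pairs)) n"
    by (rule cohomology_cong) (rule tot_delta_eq_quotient)
  moreover have "tot_delta G = delta tensor_complex"
    by (simp add: fun_eq_iff tot_delta_eq_delta)
  ultimately show ?thesis
    by simp
qed

lemma pullback_mu_cochain_map:
  "cochain_map (bar_cochains G) (bar_delta G) (bar_cochains GG) (bar_delta GG) (pullback GG (mu G))"
proof (intro cochain_map.intro bar_cochain_complex group.bar_cochain_complex[OF group_conj_semidirect]
    cochain_map_axioms.intro)
  fix n F
  assume F: "F \<in> bar_cochains G n"
  have "F (map (mu G) w) = 0" if "\<one>\<^bsub>GG\<^esub> \<in> set w" for w
  proof -
    have "mu G \<one>\<^bsub>GG\<^esub> = \<one>"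
      by (simp add: mu_def)
    then have "\<one> \<in> set (map (mu G) w)"
      using image_eqI[OF _ that, of \<one> "mu G"] by simp
    with F show ?thesis
      by (auto simp: bar_cochains_def)
  qed
  then show "pullback GG (mu G) n F \<in> bar_cochains GG n"
    by (simp add: bar_cochains_def pullback_def)
  show "bar_delta GG n (pullback GG (mu G) n F) = pullback GG (mu G) (Suc n) (bar_delta G n F)"
    by (rule bar_delta_pullback[OF group_conj_semidirect mu_hom])
qed (auto simp: pullback_def)

subsection \<open>Comparison with the multiplication homomorphism\<close>

text \<open>On a basis element the appended letter is \<open>1\<close>, which the index removes. The
  equation makes \<open>tau_dual\<close> the composite of two maps that commute with the
  differentials, a property that it thereby inherits.\<close>

lemma tau_dual_eq_dual:
  "tau_dual G n F = dual tensor_complex (group.bar_complex GG) n shuffle_map (pullback GG (mu G) n F)"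
proof
  fix z :: "'a list \<times> 'a list"
  interpret GG: group GG by (rule group_conj_semidirect)
  interpret L: shuffle_letters G GG incl_G incl_K by (rule shuffle_letters_conj_semidirect)
  obtain gs ks where z: "z = (gs, ks)" by fastforce
  show "tau_dual G n F z = dual tensor_complex GG.bar_complex n shuffle_map (pullback GG (mu G) n F) z"
  proof (cases "z \<in> bituples G n")
    case True
    then have cl: "set gs \<subseteq> carrier G" "set ks \<subseteq> carrier G" and n: "length gs + length ks = n"
      by (simp_all add: z bituples_iff)
    have "dual tensor_complex GG.bar_complex n shuffle_map (pullback GG (mu G) n F) z
        = lin_eval (pullback GG (mu G) n F) (L.S gs ks)"
      using True shuffle_map_snoc[OF one_closed one_closed, of gs ks] cl(2)
      by (simp add: dual_def z)
    also have "\<dots> = lin_eval (\<lambda>w. F (map (mu G) w)) (L.S gs ks)"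
      using L.keys_shuffle[OF cl] n by (intro lin_eval_cong) (auto simp: pullback_def)
    also have "\<dots> = lin_eval F (frag_map (map (mu G)) (L.S gs ks))"
      by simp
    also have "frag_map (map (mu G)) (L.S gs ks) = shuffle G (\<lambda>x. x) (\<lambda>x. x) gs ks"
      unfolding frag_map_shuffle by (rule shuffle_cong) (simp_all add: mu_def cl)
    also have "\<dots> = tau G (gs, ks)"
      by (rule tau_eq_shuffle[OF cl, symmetric])
    finally show ?thesis
      using True by (simp add: tau_dual_def z)
  qed (simp add: tau_dual_def dual_def)
qed

lemma tau_dual_cochain_map:
  "cochain_map (bar_cochains G) (bar_delta G) (tot_cochains G) (tot_delta G) (tau_dual G)"
proof -
  interpret GG: group GG by (rule group_conj_semidirect)
  interpret mu: cochain_map "bar_cochains G" "bar_delta G" "bar_cochains GG" "bar_delta GG" "pullback GG (mu G)"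
    by (rule pullback_mu_cochain_map)
  interpret incl: cochain_map "tot_cochains G" "tot_delta G" "full_tot_cochains G" "tot_delta G" "\<lambda>_. id"
    by (rule inclusion_tot_cochain_map)
  interpret D: cochain_map "cochains GG.bar_complex" "delta GG.bar_complex" "cochains tensor_complex"
      "delta tensor_complex" "\<lambda>n. dual tensor_complex GG.bar_complex n shuffle_map"
    by (rule dual_cochain_map[OF chain_map_shuffle_map equivariant_tensor_complex GG.equivariant_bar_complex])
  \<comment> \<open>This instance shows that \<open>tau\<close> sends degenerate pairs to
    combinations of degenerate words, hence that \<open>tau_dual\<close> of a normalized cochain is
    normalized.\<close>
  interpret id: shuffle_letters G G "\<lambda>x. x" "\<lambda>x. x"
    by unfold_locales (auto simp: hom_def conj_by_def m_assoc)
  show ?thesis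
  proof
    fix n F
    assume F: "F \<in> bar_cochains G n"
    have "lin_eval F (tau G (gs, ks)) = 0"
      if "(gs, ks) \<in> bituples G n" "\<one> \<in> set gs \<union> set ks" for gs ks
    proof (rule lin_eval_zero_on)
      fix w assume "w \<in> keys (tau G (gs, ks))"
      then have "\<one> \<in> set w"
        using id.shuffle_degenerate[of gs ks w] that by (simp add: tau_eq_shuffle bituples_iff)
      with F show "F w = 0"
        by (simp add: bar_cochains_def)
    qed
    then show "tau_dual G n F \<in> tot_cochains G n"
      by (auto simp: tot_cochains_def full_tot_cochains_def tau_dual_def)
    have "pullback GG (mu G) n F \<in> cochains GG.bar_complex n"
      by (simp add: cochains_def pullback_def)
    from D.map_d[OF this] show "tot_delta G n (tau_dual G n F) = tau_dual G (Suc n) (bar_delta G n F)"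
      by (simp add: tau_dual_eq_dual tot_delta_eq_delta mu.map_d[OF F, symmetric] GG.bar_delta_eq_delta)
  qed (auto simp: tau_dual_def lin_eval_fun_add)
qed

theorem multiplication_and_shuffle_agree:
  assumes \<phi>: "resolution_morphism G \<phi>"
  shows "tot_identification G \<phi> n \<in> iso (bar_cohomology GG n) (tot_cohomology G n)"
    and "x \<in> carrier (bar_cohomology G n) \<Longrightarrow> tot_identification G \<phi> n (mu_star G n x) = tau_star G n x"
proof -
  interpret GG: group GG by (rule group_conj_semidirect)
  interpret B: contracted_complex GG GG.bar_complex GG.degenerate_words GG.bar_contraction "[\<one>\<^bsub>GG\<^esub>]"
    by (rule GG.contracted_bar_complex)
  interpret T: contracted_complex GG tensor_complex degenerate_pairs tensor_contraction "([\<one>], [\<one>])"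
    by (rule contracted_tensor_complex)
  let ?NB = "quotient_complex GG.bar_complex GG.degenerate_words"
  let ?incl = "cohomology_map (full_tot_cochains G) (tot_delta G) n id"
  let ?\<phi> = "cohomology_map (full_tot_cochains G) (tot_delta G) n (resolution_dual G \<phi> n)"
  have tot_delta: "tot_delta G = delta tensor_complex"
    by (simp add: fun_eq_iff tot_delta_eq_delta)
  have full_tot: "full_tot_cochains G = cochains tensor_complex"
    by (simp add: fun_eq_iff full_tot_cochains_eq)
  have bar: "bar_cochains GG = cochains ?NB"
    by (simp add: fun_eq_iff GG.bar_cochains_eq)
  interpret pull: cochain_map "bar_cochains G" "bar_delta G" "bar_cochains GG" "bar_delta GG" "pullback GG (mu G)"
    by (rule pullback_mu_cochain_map)
  interpret tau: cochain_map "bar_cochains G" "bar_delta G" "tot_cochains G" "tot_delta G" "tau_dual G"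
    by (rule tau_dual_cochain_map)
  interpret incl: cochain_map "tot_cochains G" "tot_delta G" "full_tot_cochains G" "tot_delta G" "\<lambda>_. id"
    by (rule inclusion_tot_cochain_map)
  \<comment> \<open>After projection the target is the complex that computes
    \<open>bar_cohomology\<close>, and on normalized cochains the dual is still
    \<open>resolution_dual\<close>.\<close>
  define f where "f n x = nondeg GG.bar_complex GG.degenerate_words (\<phi> n (frag_of x))" for n x
  have f: "chain_map GG tensor_complex ?NB f"
    unfolding f_def by (intro B.chain_map_nondeg chain_map_of_resolution_morphism \<phi>)
  have s: "chain_map GG tensor_complex ?NB (\<lambda>_ x. nondeg GG.bar_complex GG.degenerate_words (shuffle_map x))"
    by (intro B.chain_map_nondeg chain_map_shuffle_map)
  have dual_nondeg: "dual tensor_complex ?NB m (\<lambda>x. nondeg GG.bar_complex GG.degenerate_words (h x)) F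
      = dual tensor_complex GG.bar_complex m h F" if "F \<in> bar_cochains GG m" for m h F
  proof -
    have F0: "\<And>w. w \<in> GG.degenerate_words \<Longrightarrow> F w = 0"
      using that by (simp add: bar cochains_def)
    show ?thesis
      using lin_eval_nondeg[of GG.degenerate_words F GG.bar_complex, OF F0] by (simp add: dual_def fun_eq_iff)
  qed
  have res_dual: "dual tensor_complex ?NB m (f m) F = resolution_dual G \<phi> m F"
    if "F \<in> bar_cochains GG m" for m F
  proof -
    have "dual tensor_complex ?NB m (f m) F = dual tensor_complex GG.bar_complex m (\<lambda>x. \<phi> m (frag_of x)) F"
      using dual_nondeg[OF that, of "\<lambda>x. \<phi> m (frag_of x)"] by (simp only: f_def[abs_def])
    then show ?thesis
      by (auto simp: dual_def resolution_dual_def fun_eq_iff)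
  qed
  interpret \<phi>: cochain_map "bar_cochains GG" "bar_delta GG" "full_tot_cochains G" "tot_delta G" "resolution_dual G \<phi>"
    by (rule cochain_map_cong[OF dual_cochain_map[OF f T.equivariant_complex_axioms
            B.equivariant_complex_quotient, folded bar full_tot tot_delta]])
      (simp_all add: res_dual GG.bar_delta_eq_quotient)
  have "?\<phi> \<in> iso (bar_cohomology GG n) (full_tot_cohomology G n)"
  proof (rule iso_cong_on)
    show "cohomology_map (full_tot_cochains G) (tot_delta G) n (dual tensor_complex ?NB n (f n))
        \<in> iso (bar_cohomology GG n) (full_tot_cohomology G n)"
      using cohomology_map_dual_iso[OF T.resolution B.resolution_quotient f, of n]
      by (simp add: full_tot tot_delta cohomology_cong[OF GG.bar_delta_eq_quotient] flip: bar)
    show "cohomology_map (full_tot_cochains G) (tot_delta G) n (dual tensor_complex ?NB n (f n)) y = ?\<phi> y"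
      if "y \<in> carrier (bar_cohomology GG n)" for y
      by (rule pull.B.cohomology_map_cong_on[OF _ that]) (rule res_dual)
  qed (rule pull.B.cohomology_mult_closed)
  moreover have incl_inv: "inv_into (carrier (tot_cohomology G n)) ?incl \<in> iso (full_tot_cohomology G n) (tot_cohomology G n)"
    by (rule iso_inv_into[OF inclusion_tot_iso tau.B.cohomology_mult_closed])
  ultimately have "inv_into (carrier (tot_cohomology G n)) ?incl \<circ> ?\<phi> \<in> iso (bar_cohomology GG n) (tot_cohomology G n)"
    by (rule iso_set_trans)
  moreover have "tot_identification G \<phi> n = inv_into (carrier (tot_cohomology G n)) ?incl \<circ> ?\<phi>"
    by (simp add: fun_eq_iff tot_identification_def)
  ultimately show "tot_identification G \<phi> n \<in> iso (bar_cohomology GG n) (tot_cohomology G n)"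
    by simp
  assume "x \<in> carrier (bar_cohomology G n)"
  then obtain F where F: "F \<in> cocycles (bar_cochains G) (bar_delta G) n"
      "x = coh_class (bar_cochains G) (bar_delta G) n F"
    by (auto simp: carrier_cohomology)
  let ?P = "pullback GG (mu G) n F"
  have P: "?P \<in> cocycles (bar_cochains GG) (bar_delta GG) n"
    by (rule pull.map_cocycles[OF F(1)])
  then have "?P \<in> cocycles (cochains ?NB) (delta ?NB) n"
    by (simp add: cocycles_cong[OF GG.bar_delta_eq_quotient] flip: bar)
  \<comment> \<open>\<open>f\<close> and the projected shuffle map run between the same complexes,
    so their duals at \<open>?P\<close> differ by a coboundary of full cochains; the dual of the
    shuffle map at \<open>?P\<close> is \<open>tau_dual\<close> at \<open>F\<close>.\<close>
  from chain_maps_cohomologous[OF T.equivariant_complex_axioms B.resolution_quotient f s this]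
  have "(\<lambda>z. resolution_dual G \<phi> n ?P z - tau_dual G n F z) \<in> coboundaries (full_tot_cochains G) (tot_delta G) n"
    using P by (simp add: res_dual dual_nondeg tau_dual_eq_dual full_tot tot_delta cocycles_def)
  then have "coh_class (full_tot_cochains G) (tot_delta G) n (resolution_dual G \<phi> n ?P)
      = coh_class (full_tot_cochains G) (tot_delta G) n (tau_dual G n F)"
    using \<phi>.map_cocycles[OF P] incl.map_cocycles[OF tau.map_cocycles[OF F(1)]]
    by (simp add: incl.B.coh_class_eq_iff)
  moreover have "?\<phi> (mu_star G n x) = coh_class (full_tot_cochains G) (tot_delta G) n (resolution_dual G \<phi> n ?P)"
    using pull.cohomology_map_class[OF F(1)] \<phi>.cohomology_map_class[OF P] by (simp add: mu_star_def F(2))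
  moreover have tau_x: "tau_star G n x = coh_class (tot_cochains G) (tot_delta G) n (tau_dual G n F)"
    using tau.cohomology_map_class[OF F(1)] by (simp add: tau_star_def F(2))
  moreover have "?incl (tau_star G n x) = coh_class (full_tot_cochains G) (tot_delta G) n (tau_dual G n F)"
    using incl.cohomology_map_class[OF tau.map_cocycles[OF F(1)]] by (simp add: tau_x)
  \<comment> \<open>This equality holds for full cochains; injectivity of \<open>?incl\<close> on
    normalized classes turns it into the value of the inverse.\<close>
  ultimately have "?\<phi> (mu_star G n x) = ?incl (tau_star G n x)"
    by simp
  moreover have "tau_star G n x \<in> carrier (tot_cohomology G n)"
    using tau.map_cocycles[OF F(1)] by (simp add: tau_x carrier_cohomology)
  moreover have "inj_on ?incl (carrier (tot_cohomology G n))"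
    using inclusion_tot_iso[of n] by (simp add: iso_def bij_betw_def)
  ultimately show "tot_identification G \<phi> n (mu_star G n x) = tau_star G n x"
    by (simp add: tot_identification_def)
qed

end

theorem theorem2p3:
  fixes K :: "('a, 'b) monoid_scheme"
  assumes "group K"
  shows
    "mu K \<in> hom (conj_semidirect K) K
     \<and> (\<forall>n. tau_dual K n \<in> hom (int_fun_group (bar_cochains K n)) (int_fun_group (tot_cochains K n)))
     \<and> (\<forall>n. \<forall>F\<in>bar_cochains K n.
          tau_dual K (n + 1) (bar_delta K n F) = tot_delta K n (tau_dual K n F))
     \<and> (\<exists>\<phi>. resolution_morphism K \<phi>)
     \<and> (\<forall>\<phi> n. resolution_morphism K \<phi> \<longrightarrow>
          cohomology_map (full_tot_cochains K) (tot_delta K) n id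
            \<in> iso (tot_cohomology K n) (full_tot_cohomology K n)
          \<and> tot_identification K \<phi> n
              \<in> iso (bar_cohomology (conj_semidirect K) n) (tot_cohomology K n)
          \<and> (\<forall>x\<in>carrier (bar_cohomology K n).
               tot_identification K \<phi> n (mu_star K n x) = tau_star K n x))"
proof -
  interpret K: group K by fact
  interpret tau: cochain_map "bar_cochains K" "bar_delta K" "tot_cochains K" "tot_delta K" "tau_dual K"
    by (rule K.tau_dual_cochain_map)
  have "tau_dual K n \<in> hom (int_fun_group (bar_cochains K n)) (int_fun_group (tot_cochains K n))" for n
    by (rule homI) (simp_all add: int_fun_group_def tau.map_mem tau.map_add)
  \<comment> \<open>The shuffle map itself is a witness, so the quantification over
    \<open>\<phi>\<close> is not empty.\<close>
  moreover have "\<exists>\<phi>. resolution_morphism K \<phi>"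
    using K.resolution_morphism_of_chain_map[OF K.chain_map_shuffle_map] by blast
  ultimately show ?thesis
    using K.mu_hom tau.map_d K.inclusion_tot_iso K.multiplication_and_shuffle_agree by simp
qed

end
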